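(* Let $q\in\mathbb{C}$ with $0<|q|<1$ and let $\omega$ be a primitive third root of unity. Then $$q^{2}\phi(q^9)-\frac{\psi(\omega q)-\psi(\omega^2 q)}{\omega - \omega^2}=-q\,\frac{J_{1,2}}{J_{3,6}}\cdot\frac{J_{3,15}J_{6}}{J_{3}}.$$
   Context: For a complex number $p$ with $0<|p|<1$ and $x\in\mathbb{C}^*=\mathbb{C}\setminus\{0\}$: $(x;p)_n=\prod_{i=0}^{n-1}(1-p^ix)$, $(x;p)_\infty=\prod_{i\ge0}(1-p^ix)$, and $j(x;p)=(x;p)_\infty(p/x;p)_\infty(p;p)_\infty=\sum_{n\in\mathbb{Z}}(-1)^np^{\binom n2}x^n$. For integers $a,m$ with $m\ge1$: $J_{a,m}=j(q^a;q^m)$ and $J_m=J_{m,3m}=\prod_{i\ge1}(1-q^{mi})$. The tenth-order mock theta functions $\phi,\psi$ are, for $|q|<1$, $\phi(q)=\sum_{n\ge0}\frac{q^{\binom{n+1}{2}}}{(q;q^2)_{n+1}}$ and $\psi(q)=\sum_{n\ge0}\frac{q^{\binom{n+2}{2}}}{(q;q^2)_{n+1}}$. *)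

theory Defs
  imports "HOL-Analysis.Analysis"
begin

definition qpoch :: "complex \<Rightarrow> complex \<Rightarrow> nat \<Rightarrow> complex" where
  "qpoch x p n = (\<Prod>i<n. 1 - p ^ i * x)"

definition qpoch_inf :: "complex \<Rightarrow> complex \<Rightarrow> complex" where
  "qpoch_inf x p = (\<Prod>i. 1 - p ^ i * x)"

text \<open>The intended domain is \<open>0 < norm p < 1\<close> and \<open>x \<noteq> 0\<close>.\<close>

definition jtheta :: "complex \<Rightarrow> complex \<Rightarrow> complex" where
  "jtheta x p = qpoch_inf x p * qpoch_inf (p / x) p * qpoch_inf p p"

text \<open>\<open>J2 a m q\<close> and \<open>J1 m q\<close> stand for \<open>J\<^sub>a\<^sub>,\<^sub>m\<close> and \<open>J\<^sub>m\<close>, for \<open>m \<ge> 1\<close>.\<close>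

definition J2 :: "int \<Rightarrow> nat \<Rightarrow> complex \<Rightarrow> complex" where
  "J2 a m q = jtheta (q powi a) (q ^ m)"

definition J1 :: "nat \<Rightarrow> complex \<Rightarrow> complex" where
  "J1 m q = J2 (int m) (3 * m) q"

definition mock_phi :: "complex \<Rightarrow> complex" where
  "mock_phi q = (\<Sum>n. q ^ ((n + 1) choose 2) / qpoch q (q\<^sup>2) (n + 1))"

definition mock_psi :: "complex \<Rightarrow> complex" where
  "mock_psi q = (\<Sum>n. q ^ ((n + 2) choose 2) / qpoch q (q\<^sup>2) (n + 1))"

definition primitive_root_of_unity :: "nat \<Rightarrow> complex \<Rightarrow> bool" where
  "primitive_root_of_unity n w \<longleftrightarrow>
     0 < n \<and> w ^ n = 1 \<and> (\<forall>k. 0 < k \<and> k < n \<longrightarrow> w ^ k \<noteq> 1)"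

end

theory Submission
  imports Defs
begin

text \<open>
  Multiplied by \<open>J\<^sub>1\<^sub>,\<^sub>2\<close>, both \<open>\<phi>\<close> and \<open>\<psi>\<close> become Hecke sums (a Bailey pair argument): with
  \<open>sg(r, s)\<close> equal to \<open>1\<close> for \<open>r, s \<ge> 0\<close>, to \<open>-1\<close> for \<open>r, s < 0\<close> and to \<open>0\<close> otherwise,
  \<open>J\<^sub>1\<^sub>,\<^sub>2 \<phi> = \<Sum> sg(r, s) (-1)\<^bsup>r+s\<^esup> q\<^bsup>r\<^sup>2+3rs+s\<^sup>2+r+s\<^esup>\<close> and
  \<open>J\<^sub>1\<^sub>,\<^sub>2 \<psi> = - \<Sum> sg(r, s) (-1)\<^bsup>r+s\<^esup> q\<^bsup>r\<^sup>2+3rs+s\<^sup>2+3r+3s+2\<^esup>\<close>.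

  Modulo 3 the last exponent is \<open>r\<^sup>2 + s\<^sup>2 + 2\<close>, and the terms with \<open>3 | r\<close> and \<open>3 | s\<close> add up to \<open>-q\<^sup>2\<close>
  times the sum for \<open>\<phi>\<close> at \<open>q\<^sup>9\<close>. Write \<open>J\<^sub>1\<^sub>,\<^sub>2 = a + \<zeta> b\<close> at \<open>\<zeta> q\<close>, for \<open>\<zeta>\<^sup>3 = 1\<close> and \<open>a = J\<^sub>9\<^sub>,\<^sub>1\<^sub>8\<close>. In the
  combination to be evaluated everything cancels except the Hecke sum of \<open>\<psi>\<close> with its terms weighted by
  \<open>u\<^sub>r u\<^sub>s\<close>, where \<open>u\<^sub>r = -b\<close> if \<open>3 | r\<close> and \<open>u\<^sub>r = a\<close> otherwise.

  Put \<open>p = q\<^sup>3\<close>. Up to a constant, \<open>(-1)\<^sup>r u\<^sub>r q\<^bsup>r\<^sup>2+3r\<^esup>\<close> is the \<open>r\<close>-th coefficient of a product of two theta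
  functions, one of nome \<open>p\<close> and one of nome \<open>p\<^sup>2\<close>. The first one cancels the poles of Kronecker's
  series \<open>\<Sum> sg(r, s) p\<^bsup>rs\<^esup> x\<^sup>r y\<^sup>s\<close>, so the weighted sum collapses to a single theta series, \<open>J\<^sub>3\<^sub>,\<^sub>1\<^sub>5\<close>.
\<close>

section \<open>Infinite products\<close>

text \<open>Tannery's theorem (dominated convergence for sums). The majorant \<open>h\<close> makes
  the partial sums over finite sets converge uniformly in \<open>n\<close> (Weierstrass M-test), so
  the two limits may be exchanged.\<close>

lemma infsum_tannery:
  fixes f :: "nat \<Rightarrow> 'a \<Rightarrow> 'b :: banach"
  assumes h: "h summable_on A"
    and bound: "\<And>n x. x \<in> A \<Longrightarrow> norm (f n x) \<le> h x"
    and lim: "\<And>x. x \<in> A \<Longrightarrow> (\<lambda>n. f n x) \<longlonglongrightarrow> g x"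
  shows "(\<lambda>n. \<Sum>\<^sub>\<infinity>x\<in>A. f n x) \<longlonglongrightarrow> (\<Sum>\<^sub>\<infinity>x\<in>A. g x)"
proof -
  have g_bound: "norm (g x) \<le> h x" if "x \<in> A" for x
    using lim[OF that] bound[OF that] by (intro LIMSEQ_le_const2[OF tendsto_norm]) auto
  have "g summable_on A"
    by (rule abs_summable_summable, rule Infinite_Sum.abs_summable_on_comparison_test'[OF h g_bound])
  then have g: "((\<lambda>X. \<Sum>x\<in>X. g x) \<longlongrightarrow> (\<Sum>\<^sub>\<infinity>x\<in>A. g x)) (finite_subsets_at_top A)"
    by (rule infsum_tendsto)
  have "uniform_limit UNIV (\<lambda>X n. \<Sum>x\<in>X. f n x) (\<lambda>n. \<Sum>\<^sub>\<infinity>x\<in>A. f n x) (finite_subsets_at_top A)"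
    by (rule Weierstrass_m_test_general[OF _ h]) (use bound in auto)
  moreover have "\<forall>\<^sub>F X in finite_subsets_at_top A.
      (\<lambda>n. \<Sum>x\<in>X. f n x) \<longlonglongrightarrow> (\<Sum>x\<in>X. g x)"
    by (rule eventually_finite_subsets_at_top_weakI) (use lim in \<open>auto intro!: tendsto_sum\<close>)
  ultimately show ?thesis
    by (intro swap_uniform_limit'[OF _ g]) auto
qed

lemma qpoch_0 [simp]: "qpoch x p 0 = 1"
  and qpoch_Suc: "qpoch x p (Suc n) = qpoch x p n * (1 - p ^ n * x)"
  by (simp_all add: qpoch_def)

lemma qpoch_add: "qpoch x p (m + n) = qpoch x p m * qpoch (p ^ m * x) p n"
  by (induction n) (simp_all add: qpoch_Suc power_add mult_ac)

lemma qpoch_mult_minus: "qpoch x p n * qpoch (- x) p n = qpoch (x\<^sup>2) (p\<^sup>2) n"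
  unfolding qpoch_def prod.distrib[symmetric]
  by (intro prod.cong) (simp_all add: power2_eq_square power_mult_distrib algebra_simps)

lemma qpoch_odd: "qpoch q q (2 * n + 1) = qpoch q (q\<^sup>2) (n + 1) * qpoch (q\<^sup>2) (q\<^sup>2) n"
proof (induction n)
  case (Suc n)
  have "qpoch q q (2 * Suc n + 1) = qpoch q q (2 * n + 1) * (1 - q ^ (2 * n + 1) * q) * (1 - q ^ (2 * n + 2) * q)"
    by (simp add: qpoch_Suc)
  also have "q ^ (2 * n + 1) * q = (q\<^sup>2) ^ n * q\<^sup>2"
    by (simp add: power2_eq_square power_mult)
  also have "q ^ (2 * n + 2) * q = (q\<^sup>2) ^ (n + 1) * q"
    by (simp add: power2_eq_square power_mult)
  finally show ?case
    unfolding Suc.IH by (simp add: qpoch_Suc mult_ac)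
qed (simp add: qpoch_Suc)

lemma qpoch_nonzero:
  assumes "norm p < 1" "norm x < 1"
  shows "qpoch x p n \<noteq> 0"
proof -
  have "p ^ i * x \<noteq> 1" for i
  proof
    assume "p ^ i * x = 1"
    then have "norm p ^ i * norm x = 1"
      by (metis norm_mult norm_one norm_power)
    moreover have "norm p ^ i * norm x \<le> 1 * norm x"
      using assms by (intro mult_right_mono power_le_one) auto
    ultimately show False
      using assms(2) by simp
  qed
  then show ?thesis
    by (auto simp: qpoch_def)
qed

lemma convergent_prod_qpoch:
  fixes p x :: complex
  assumes "norm p < 1"
  shows "convergent_prod (\<lambda>i. 1 - p ^ i * x)"
proof -
  have "summable (\<lambda>i. norm x * norm p ^ i)"
    by (intro summable_mult summable_geometric) (use assms in simp)
  then have "summable (\<lambda>i. norm ((1 - p ^ i * x) - 1))"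
    by (simp add: norm_mult norm_power mult.commute)
  then show ?thesis
    by (intro abs_convergent_prod_imp_convergent_prod summable_imp_abs_convergent_prod)
qed

lemma qpoch_LIMSEQ:
  assumes "norm p < 1"
  shows "qpoch x p \<longlonglongrightarrow> qpoch_inf x p"
proof -
  have "(\<lambda>n. \<Prod>i\<le>n. 1 - p ^ i * x) \<longlonglongrightarrow> qpoch_inf x p"
    unfolding qpoch_inf_def by (rule convergent_prod_LIMSEQ[OF convergent_prod_qpoch[OF assms]])
  then have "(\<lambda>n. qpoch x p (Suc n)) \<longlonglongrightarrow> qpoch_inf x p"
    by (simp add: qpoch_def lessThan_Suc_atMost)
  then show ?thesis
    by (rule LIMSEQ_imp_Suc)
qed

lemma qpoch_LIMSEQ_subseq:
  assumes "norm p < 1" "strict_mono f"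
  shows "(\<lambda>n. qpoch x p (f n)) \<longlonglongrightarrow> qpoch_inf x p"
  using LIMSEQ_subseq_LIMSEQ[OF qpoch_LIMSEQ[OF assms(1)] assms(2)] by (simp add: o_def)

lemma qpoch_inf_nonzero:
  assumes "norm p < 1" "norm x < 1"
  shows "qpoch_inf x p \<noteq> 0"
  unfolding qpoch_inf_def
proof (rule prodinf_nonzero[OF convergent_prod_qpoch[OF assms(1)]])
  show "1 - p ^ i * x \<noteq> 0" for i
    using qpoch_nonzero[OF assms, of "Suc i"] by (simp add: qpoch_Suc)
qed

lemma qpoch_inf_rec:
  assumes "norm p < 1"
  shows "qpoch_inf x p = (1 - x) * qpoch_inf (p * x) p"
proof (rule LIMSEQ_unique)
  show "(\<lambda>n. qpoch x p (1 + n)) \<longlonglongrightarrow> qpoch_inf x p"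
    by (rule qpoch_LIMSEQ_subseq[OF assms]) (simp add: strict_mono_def)
  show "(\<lambda>n. qpoch x p (1 + n)) \<longlonglongrightarrow> (1 - x) * qpoch_inf (p * x) p"
    unfolding qpoch_add
    using tendsto_mult_left[OF qpoch_LIMSEQ[OF assms, of "p * x"], of "1 - x"]
    by (simp add: qpoch_def)
qed

lemma qpoch_inf_dissect:
  assumes "norm p < 1" "k > 0"
  shows "qpoch_inf x p = (\<Prod>j<k. qpoch_inf (p ^ j * x) (p ^ k))"
proof (rule LIMSEQ_unique)
  have fin: "qpoch x p (k * n) = (\<Prod>j<k. qpoch (p ^ j * x) (p ^ k) n)" for n
  proof (induction n)
    case (Suc n)
    have "qpoch x p (k * Suc n) = qpoch x p (k * n) * qpoch (p ^ (k * n) * x) p k"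
      by (simp add: qpoch_add[symmetric] add.commute)
    also have "qpoch (p ^ (k * n) * x) p k = (\<Prod>j<k. 1 - (p ^ k) ^ n * (p ^ j * x))"
      by (simp add: qpoch_def power_mult mult_ac)
    finally show ?case
      by (simp add: Suc.IH qpoch_Suc prod.distrib)
  qed simp
  have pk: "norm (p ^ k) < 1"
    using assms by (simp add: norm_power power_less_one_iff)
  show "(\<lambda>n. qpoch x p (k * n)) \<longlonglongrightarrow> qpoch_inf x p"
    by (rule qpoch_LIMSEQ_subseq[OF assms(1)]) (use assms in \<open>simp add: strict_mono_def\<close>)
  show "(\<lambda>n. qpoch x p (k * n)) \<longlonglongrightarrow> (\<Prod>j<k. qpoch_inf (p ^ j * x) (p ^ k))"
    unfolding fin by (intro tendsto_prod qpoch_LIMSEQ pk)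
qed

lemma qpoch_inf_mult_minus:
  assumes "norm p < 1"
  shows "qpoch_inf x p * qpoch_inf (- x) p = qpoch_inf (x\<^sup>2) (p\<^sup>2)"
proof (rule LIMSEQ_unique)
  show "qpoch (x\<^sup>2) (p\<^sup>2) \<longlonglongrightarrow> qpoch_inf x p * qpoch_inf (- x) p"
    using tendsto_mult[OF qpoch_LIMSEQ[OF assms, of x] qpoch_LIMSEQ[OF assms, of "- x"]]
    by (simp add: qpoch_mult_minus)
  show "qpoch (x\<^sup>2) (p\<^sup>2) \<longlonglongrightarrow> qpoch_inf (x\<^sup>2) (p\<^sup>2)"
    by (rule qpoch_LIMSEQ) (use assms in \<open>simp add: norm_power power_less_one_iff\<close>)
qed

text \<open>Factor by factor this is (1 - y)(1 - w y)(1 - w^2 y) = 1 - y^3.\<close>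

lemma qpoch_inf_cube:
  assumes "norm p < 1" "1 + w + w\<^sup>2 = 0"
  shows "qpoch_inf x p * qpoch_inf (w * x) p * qpoch_inf (w\<^sup>2 * x) p = qpoch_inf (x ^ 3) (p ^ 3)"
proof (rule LIMSEQ_unique)
  have w2: "w\<^sup>2 = - 1 - w"
    using assms(2) by (simp add: algebra_simps eq_neg_iff_add_eq_0)
  have cube: "(1 - y) * (1 - w * y) * (1 - w\<^sup>2 * y) = 1 - y ^ 3" for y
  proof -
    have "w * w\<^sup>2 = w * (1 + w + w\<^sup>2) - (1 + w + w\<^sup>2) + 1"
      by (simp add: algebra_simps power2_eq_square)
    then have w3: "w * w\<^sup>2 = 1"
      by (simp add: assms(2))
    have "(1 - y) * (1 - w * y) * (1 - w\<^sup>2 * y) =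
        1 - (1 + w + w\<^sup>2) * y + (w + w\<^sup>2 + w * w\<^sup>2) * y\<^sup>2 - w * w\<^sup>2 * y ^ 3"
      by (simp add: algebra_simps power2_eq_square power3_eq_cube)
    then show ?thesis
      using w3 w2 by simp
  qed
  have "qpoch x p n * qpoch (w * x) p n * qpoch (w\<^sup>2 * x) p n = qpoch (x ^ 3) (p ^ 3) n" for n
    unfolding qpoch_def prod.distrib[symmetric]
  proof (intro prod.cong refl)
    fix i
    show "(1 - p ^ i * x) * (1 - p ^ i * (w * x)) * (1 - p ^ i * (w\<^sup>2 * x)) = 1 - (p ^ 3) ^ i * x ^ 3"
      using cube[of "p ^ i * x"] by (simp add: mult_ac power_mult_distrib flip: power_mult)
  qed
  then show "qpoch (x ^ 3) (p ^ 3) \<longlonglongrightarrow> qpoch_inf x p * qpoch_inf (w * x) p * qpoch_inf (w\<^sup>2 * x) p"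
    using tendsto_mult[OF tendsto_mult[OF qpoch_LIMSEQ[OF assms(1), of x]
      qpoch_LIMSEQ[OF assms(1), of "w * x"]] qpoch_LIMSEQ[OF assms(1), of "w\<^sup>2 * x"]] by simp
  show "qpoch (x ^ 3) (p ^ 3) \<longlonglongrightarrow> qpoch_inf (x ^ 3) (p ^ 3)"
    by (rule qpoch_LIMSEQ) (use assms in \<open>simp add: norm_power power_less_one_iff\<close>)
qed

section \<open>Gaussian sums over the integers\<close>

text \<open>Triangular numbers extended to negative arguments. They are invariant under n -> -1 - n,
  and \<open>tri (- n)\<close> is the binomial exponent n over 2 of the usual theta series.\<close>

definition tri :: "int \<Rightarrow> int" where
  "tri n = n * (n + 1) div 2"

lemma two_tri: "2 * tri n = n * (n + 1)"
  unfolding tri_def by (simp add: even_two_times_div_two)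

lemma tri_nonneg: "tri n \<ge> 0"
proof -
  have "n * (n + 1) \<ge> 0"
    by (cases "n \<ge> 0") (auto intro: mult_nonneg_nonneg mult_nonpos_nonpos)
  then show ?thesis
    using two_tri[of n] by linarith
qed

lemma tri_reflect: "tri (- 1 - n) = tri n"
  unfolding tri_def by (simp add: algebra_simps)

lemma tri_add: "tri (m + n) = tri m + tri n + m * n"
  using two_tri[of m] two_tri[of n] two_tri[of "m + n"] by (simp add: algebra_simps)

lemma tri_Suc: "tri (int (Suc n)) = tri (int n) + int (Suc n)"
  using tri_add[of "int n" 1] by (simp add: tri_def[of 1] add_ac)

lemma choose_2_tri: "int (Suc n choose 2) = tri (int n)"
proof -
  have "Suc n choose 2 = n * (n + 1) div 2"
    by (simp add: choose_two mult.commute)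
  then show ?thesis
    by (simp add: tri_def zdiv_int algebra_simps)
qed

text \<open>Quadratic growth beats every slope \<open>L\<close>; most convergence estimates rest on
  this. The source is (a - L)(a - L - 1) \<ge> 0 for integers, with a = |n|.\<close>

lemma tri_ge:
  assumes "L \<ge> 0"
  shows "L * \<bar>n\<bar> - L * (L + 1) \<le> tri n"
proof -
  have key: "2 * (L * a - L * (L + 1)) \<le> a * a - a" for a :: int
  proof -
    define t where "t = a - L"
    have "t * (t - 1) \<ge> 0"
      by (cases "t \<ge> 1") (auto intro: mult_nonneg_nonneg mult_nonpos_nonpos)
    moreover have "L * (L + 1) \<ge> 0"
      using assms by simp
    ultimately show ?thesis
      by (simp add: t_def algebra_simps)
  qed
  have "\<bar>n\<bar> * \<bar>n\<bar> - \<bar>n\<bar> \<le> n * (n + 1)"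
    by (simp add: distrib_left)
  with key[of "\<bar>n\<bar>"] have "2 * (L * \<bar>n\<bar> - L * (L + 1)) \<le> 2 * tri n"
    unfolding two_tri by (rule order_trans)
  then show ?thesis
    by simp
qed

section \<open>Absolutely convergent sums over the integers and over pairs of integers\<close>

lemma summable_on_powi_abs:
  assumes "0 < \<rho>" "\<rho> < (1::real)"
  shows "(\<lambda>n::int. \<rho> powi \<bar>n\<bar>) summable_on UNIV"
proof -
  have nat: "(\<lambda>n. \<rho> ^ n) summable_on UNIV"
    using assms by (intro summable_nonneg_imp_summable_on summable_geometric) auto
  have "(\<lambda>n::int. \<rho> powi \<bar>n\<bar>) summable_on range int"
    by (subst summable_on_reindex) (simp_all add: o_def nat)
  moreover have "(\<lambda>n::int. \<rho> powi \<bar>n\<bar>) summable_on range (\<lambda>n. - int n)"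
    by (subst summable_on_reindex) (simp_all add: o_def nat inj_on_def)
  moreover have "(UNIV :: int set) = range int \<union> range (\<lambda>n. - int n)"
  proof -
    have "x \<in> range int \<union> range (\<lambda>n. - int n)" for x
      by (cases x rule: int_cases2) auto
    then show ?thesis by auto
  qed
  ultimately show ?thesis
    by (metis summable_on_union)
qed

lemma summable_on_product_real:
  fixes f :: "'a \<Rightarrow> real" and g :: "'b \<Rightarrow> real"
  assumes "f summable_on UNIV" "g summable_on UNIV" "\<And>x. f x \<ge> 0" "\<And>y. g y \<ge> 0"
  shows "(\<lambda>(x, y). f x * g y) summable_on UNIV"
proof -
  have "(\<lambda>(x, y). f x * g y) summable_on (SIGMA x:UNIV. UNIV)"
  proof (rule summable_on_SigmaI)
    show "((\<lambda>y. case (x, y) of (x, y) \<Rightarrow> f x * g y) has_sum f x * (\<Sum>\<^sub>\<infinity>y. g y)) UNIV" for x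
      using has_sum_cmult_right[OF has_sum_infsum[OF assms(2)]] by simp
    show "(\<lambda>x. f x * (\<Sum>\<^sub>\<infinity>y. g y)) summable_on UNIV"
      by (intro summable_on_cmult_left assms)
  qed (use assms in auto)
  then show ?thesis by simp
qed

lemma summable_on_powi_abs2:
  assumes "0 < \<rho>" "\<rho> < (1::real)"
  shows "(\<lambda>(r::int, s::int). \<rho> powi (\<bar>r\<bar> + \<bar>s\<bar>)) summable_on UNIV"
  using summable_on_product_real[OF summable_on_powi_abs[OF assms] summable_on_powi_abs[OF assms]] assms
  by (simp add: power_int_add)

lemma powi_mono_exp:
  assumes "0 < \<rho>" "\<rho> < (1::real)" "m \<le> n"
  shows "\<rho> powi n \<le> \<rho> powi m"
  using assms by (intro power_int_decreasing) auto

lemma abs_summable_gauss: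
  fixes f :: "int \<Rightarrow> 'b :: real_normed_vector"
  assumes "0 < \<rho>" "\<rho> < (1::real)" "B \<ge> 0"
    and "\<And>n. norm (f n) \<le> B * \<rho> powi e n" "\<And>n. \<bar>n\<bar> \<le> e n + C"
  shows "(\<lambda>n. norm (f n)) summable_on UNIV"
proof (rule Infinite_Sum.abs_summable_on_comparison_test')
  show "(\<lambda>n. B * \<rho> powi (- C) * \<rho> powi \<bar>n\<bar>) summable_on UNIV"
    by (intro summable_on_cmult_right summable_on_powi_abs assms)
  show "norm (f n) \<le> B * \<rho> powi (- C) * \<rho> powi \<bar>n\<bar>" for n
  proof -
    have "norm (f n) \<le> B * \<rho> powi (- C + \<bar>n\<bar>)"
      using assms(3) assms(4)[of n] powi_mono_exp[OF assms(1,2), of "- C + \<bar>n\<bar>" "e n"] assms(5)[of n]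
      by (smt (verit) mult_left_mono)
    then show ?thesis
      using assms(1) by (subst (asm) power_int_add) (simp_all add: mult.assoc)
  qed
qed

lemma abs_summable_gauss2:
  fixes f :: "int \<times> int \<Rightarrow> 'b :: real_normed_vector"
  assumes "0 < \<rho>" "\<rho> < (1::real)" "B \<ge> 0"
    and "\<And>r s. f (r, s) \<noteq> 0 \<Longrightarrow> norm (f (r, s)) \<le> B * \<rho> powi e r s"
    and "\<And>r s. f (r, s) \<noteq> 0 \<Longrightarrow> \<bar>r\<bar> + \<bar>s\<bar> \<le> e r s + C"
  shows "(\<lambda>n. norm (f n)) summable_on UNIV"
proof (rule Infinite_Sum.abs_summable_on_comparison_test')
  show "(\<lambda>x. B * \<rho> powi (- C) * (case x of (r, s) \<Rightarrow> \<rho> powi (\<bar>r\<bar> + \<bar>s\<bar>))) summable_on UNIV"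
    by (intro summable_on_cmult_right summable_on_powi_abs2 assms)
  show "norm (f x) \<le> B * \<rho> powi (- C) * (case x of (r, s) \<Rightarrow> \<rho> powi (\<bar>r\<bar> + \<bar>s\<bar>))" for x
  proof (cases x)
    case (Pair r s)
    show ?thesis
    proof (cases "f (r, s) = 0")
      case False
      have "norm (f (r, s)) \<le> B * \<rho> powi (- C + (\<bar>r\<bar> + \<bar>s\<bar>))"
        using assms(3) assms(4)[OF False] powi_mono_exp[OF assms(1,2), of "- C + (\<bar>r\<bar> + \<bar>s\<bar>)" "e r s"] assms(5)[OF False]
        by (smt (verit) mult_left_mono)
      moreover have "\<rho> powi (- C + (\<bar>r\<bar> + \<bar>s\<bar>)) = \<rho> powi (- C) * \<rho> powi (\<bar>r\<bar> + \<bar>s\<bar>)"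
        using assms(1) by (subst power_int_add) auto
      ultimately show ?thesis
        by (simp add: Pair mult.assoc)
    qed (use assms in \<open>simp add: Pair\<close>)
  qed
qed

section \<open>Hecke sums and the finite Jacobi product\<close>

definition sgn2 :: "int \<Rightarrow> int \<Rightarrow> complex" where
  "sgn2 r s = (if 0 \<le> r \<and> 0 \<le> s then 1 else if r < 0 \<and> s < 0 then -1 else 0)"

lemma sgn2_nonzeroD: "sgn2 r s \<noteq> 0 \<Longrightarrow> r * s \<ge> 0 \<and> \<bar>r + s\<bar> = \<bar>r\<bar> + \<bar>s\<bar>"
  by (auto simp: sgn2_def mult_nonpos_nonpos split: if_splits)

lemma norm_sgn2_le: "norm (sgn2 r s) \<le> 1"
  by (simp add: sgn2_def)

lemma sgn2_reflect: "sgn2 (- 1 - r) (- 1 - s) = - sgn2 r s"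
  by (simp add: sgn2_def)

text \<open>A diagonal shift changes the weight only on the lines r = -1 and s = -1; these become
  the boundary terms in \<open>hecke_shift\<close>.\<close>

lemma sgn2_shift:
  "sgn2 (r + 1) (s + 1) = sgn2 r s + ((if r = - 1 then 1 else 0) + (if s = - 1 then 1 else 0))"
  by (auto simp: sgn2_def)

lemma infsum_int_shift: "(\<Sum>\<^sub>\<infinity>n. f (n + k)) = (\<Sum>\<^sub>\<infinity>n::int. f n)"
  by (rule infsum_reindex_bij_witness[of _ "\<lambda>n. n - k" "\<lambda>n. n + k"]) auto

locale nome =
  fixes q :: complex
  assumes q_nz: "q \<noteq> 0" and q_lt1: "norm q < 1"
begin

lemma norm_q_pos: "0 < norm q"
  using q_nz by simp

lemma q_powi_add: "q powi (m + n) = q powi m * q powi n"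
  using q_nz by (simp add: power_int_add)

lemma q_powi_ne_1: "q powi n \<noteq> 1" if "n \<noteq> 0"
proof
  assume "q powi n = 1"
  then have "norm q powi n = 1"
    by (metis norm_one norm_power_int)
  moreover have "norm q powi n < 1" if "n > 0"
    using power_int_strict_decreasing[of 0 n "norm q"] that norm_q_pos q_lt1 by simp
  moreover have "norm q powi n > 1" if "n < 0"
    using power_int_strict_decreasing[of n 0 "norm q"] that norm_q_pos q_lt1 by simp
  ultimately show False
    using that by (cases "n > 0") auto
qed

text \<open>With the value 0 at negative \<open>k\<close>, \<open>invq_rec\<close> holds for every
  integer (both sides vanish at k = 0), and \<open>jcoef n\<close> has finite support.\<close>

definition invq :: "int \<Rightarrow> complex" where
  "invq k = (if k < 0 then 0 else 1 / qpoch q q (nat k))"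

lemma invq_rec: "invq (k - 1) = (1 - q powi k) * invq k"
proof (cases "k > 0")
  case True
  then obtain n where k: "k = int (Suc n)"
    by (metis gr0_implies_Suc zero_less_imp_eq_int)
  have "1 - q ^ n * q \<noteq> 0"
    using qpoch_nonzero[OF q_lt1 q_lt1, of "Suc n"] by (simp add: qpoch_Suc)
  moreover have "q powi k = q ^ n * q"
    unfolding k power_int_of_nat by simp
  moreover have "nat k = Suc n" "nat (k - 1) = n"
    by (simp_all add: k)
  ultimately show ?thesis
    by (simp add: invq_def qpoch_Suc k)
next
  case False
  then show ?thesis
    by (cases "k = 0") (simp_all add: invq_def)
qed

lemma invq_LIMSEQ: "(\<lambda>n. invq (int n + k)) \<longlonglongrightarrow> 1 / qpoch_inf q q"
proof -
  have lim: "(\<lambda>n. 1 / qpoch q q n) \<longlonglongrightarrow> 1 / qpoch_inf q q"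
    by (intro tendsto_divide tendsto_const qpoch_LIMSEQ qpoch_inf_nonzero q_lt1)
  have "(\<lambda>n. invq (int (n + nat \<bar>k\<bar>) + k)) \<longlonglongrightarrow> 1 / qpoch_inf q q"
  proof -
    have "invq (int (n + nat \<bar>k\<bar>) + k) = 1 / qpoch q q (n + nat (\<bar>k\<bar> + k))" for n
      by (cases "k \<ge> 0") (simp_all add: invq_def nat_add_distrib add.commute)
    then show ?thesis
      using LIMSEQ_ignore_initial_segment[OF lim] by simp
  qed
  then show ?thesis
    by (rule LIMSEQ_offset)
qed

lemma invq_bounded: "\<exists>C>0. \<forall>k. norm (invq k) \<le> C"
proof -
  have "Bseq (\<lambda>n. invq (int n))"
    using invq_LIMSEQ[of 0] by (simp add: convergentI convergent_imp_Bseq)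
  then obtain C where C: "C > 0" "\<And>n. norm (invq (int n)) \<le> C"
    by (auto simp: Bseq_def)
  have "norm (invq k) \<le> C" for k
    using C(1) C(2)[of "nat k"] by (cases "k < 0") (auto simp: invq_def)
  with C(1) show ?thesis
    by blast
qed

text \<open>Up to the factor \<open>qpoch q q (2 * n + 1)\<close>, these are the coefficients of the finite
  Jacobi product, the Laurent polynomial \<open>qpoch (z * q) q n * qpoch (1 / z) q (n + 1)\<close>.\<close>

definition jcoef :: "int \<Rightarrow> int \<Rightarrow> complex" where
  "jcoef n N = (- 1) powi N * q powi tri N * invq (n - N) * invq (n + N + 1)"

lemma jcoef_reflect: "jcoef n (- 1 - N) = - jcoef n N"
proof -
  have "(- 1) powi (- 1 - N) = - ((- 1 :: complex) powi N)"
    by (cases "even N") (simp_all add: power_int_minus_one_diff_commute)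
  then show ?thesis
    by (simp add: jcoef_def tri_reflect algebra_simps)
qed

lemma minus_one_powi_add_1: "(- 1 :: complex) powi (N + 1) = - ((- 1) powi N)"
  by (simp add: power_int_add)

lemma minus_one_powi_diff_1: "(- 1 :: complex) powi (N - 1) = - ((- 1) powi N)"
  by (simp add: power_int_diff)

text \<open>The quotient of neighbouring coefficients, cleared of denominators and sorted so that
  each side consists of a term and its partner under \<open>hecke_reflect\<close>; this is the form
  that \<open>hsum_1\<close> needs.\<close>

lemma jcoef_ratio:
  "jcoef n (N + 1) + q powi (N + 1) * jcoef n N =
   q powi (n + 1) * (jcoef n N + q powi (N + 1) * jcoef n (N + 1))"
proof -
  define x where "x = q powi N"
  define Q where "Q = q powi n"
  have x: "x \<noteq> 0"
    using q_nz by (simp add: x_def)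
  have "invq (n + N + 1) = (1 - Q * x * q\<^sup>2) * invq (n + N + 2)"
  proof -
    have "n + N + 2 - 1 = n + N + 1"
      by simp
    then show ?thesis
      using invq_rec[of "n + N + 2"] by (simp only: q_powi_add Q_def x_def power_int_numeral)
  qed
  moreover have "invq (n - N - 1) = (1 - Q / x) * invq (n - N)"
    using invq_rec[of "n - N"] q_nz by (simp add: power_int_diff Q_def x_def)
  moreover have "q powi tri (N + 1) = q powi tri N * (x * q)"
    by (simp add: tri_add q_powi_add x_def) (simp add: tri_def)
  ultimately show ?thesis
    using x unfolding jcoef_def minus_one_powi_add_1
    by (simp add: q_powi_add Q_def[symmetric] x_def[symmetric] diff_diff_eq[symmetric] add.assoc)
       (simp add: field_simps power2_eq_square)
qed

text \<open>Passing from n - 1 to n multiplies the finite Jacobi product by (1 - z q^n)(1 - q^n / z)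
  = 1 + q^(2n) - q^n (z + 1/z); compare coefficients of z^N. The two factors on the left come from
  the normalization by \<open>qpoch q q (2 * n + 1)\<close>.\<close>

lemma jcoef_rec:
  "(1 - q powi (2 * n)) * (1 - q powi (2 * n + 1)) * jcoef n N =
   (1 + q powi (2 * n)) * jcoef (n - 1) N
     - q powi n * (jcoef (n - 1) (N + 1) + jcoef (n - 1) (N - 1))"
proof -
  define x where "x = q powi N"
  define Q where "Q = q powi n"
  define A where "A = invq (n - N)"
  define B where "B = invq (n + N + 1)"
  define T where "T = (- 1) powi N * q powi tri N"
  have x: "x \<noteq> 0"
    using q_nz by (simp add: x_def)
  have A1: "invq (n - 1 - N) = (1 - Q / x) * A"
    using invq_rec[of "n - N"] q_nz by (simp add: power_int_diff Q_def x_def A_def algebra_simps)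
  have A2: "invq (n - 1 - (N + 1)) = (1 - Q / (x * q)) * (1 - Q / x) * A"
  proof -
    have "q powi (n - 1 - N) = Q / (x * q)"
      using q_nz by (simp add: power_int_diff Q_def x_def)
    moreover have "n - 1 - N - 1 = n - 1 - (N + 1)"
      by simp
    ultimately show ?thesis
      using invq_rec[of "n - 1 - N"] by (simp only: A1 mult.assoc)
  qed
  have B1: "invq (n - 1 + N + 1) = (1 - Q * x * q) * B"
    using invq_rec[of "n + N + 1"] q_nz by (simp add: q_powi_add Q_def x_def B_def)
  have B2: "invq (n - 1 + (N - 1) + 1) = (1 - Q * x) * (1 - Q * x * q) * B"
  proof -
    have "n + N - 1 = n - 1 + (N - 1) + 1" "n - 1 + N + 1 = n + N"
      by simp_all
    then show ?thesis
      using invq_rec[of "n + N"] B1 by (simp only: q_powi_add Q_def x_def mult.assoc)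
  qed
  have t1: "q powi tri (N + 1) = q powi tri N * (x * q)"
    by (simp add: tri_add q_powi_add x_def) (simp add: tri_def)
  have t2: "q powi tri (N - 1) = q powi tri N / x"
  proof -
    have "tri N = tri (N - 1) + N"
      using tri_add[of "N - 1" 1] by (simp add: tri_def)
    then have "q powi tri N = q powi tri (N - 1) * x"
      by (simp add: q_powi_add[symmetric] x_def)
    then show ?thesis
      using x by simp
  qed
  have Q2: "q powi (2 * n) = Q\<^sup>2"
    by (simp only: Q_def mult_2 q_powi_add power2_eq_square)
  have 0: "jcoef n N = T * A * B"
    by (simp add: jcoef_def A_def B_def T_def)
  have 1: "jcoef (n - 1) N = T * ((1 - Q / x) * A) * ((1 - Q * x * q) * B)"
    unfolding jcoef_def A1 B1 by (simp add: T_def)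
  have 2: "jcoef (n - 1) (N + 1) = - T * (x * q) * ((1 - Q / (x * q)) * (1 - Q / x) * A) * B"
    unfolding jcoef_def A2 minus_one_powi_add_1 t1 by (simp add: T_def B_def)
  have 3: "jcoef (n - 1) (N - 1) = - T / x * A * ((1 - Q * x) * (1 - Q * x * q) * B)"
    unfolding jcoef_def B2 minus_one_powi_diff_1 t2 by (simp add: T_def A_def)
  \<comment> \<open>What remains after division by the common factor \<open>T * A * B\<close>;
    \<open>opaque\<close> restores that factor without expanding the brackets.\<close>
  have id: "(1 - Q\<^sup>2) * (1 - Q\<^sup>2 * q) = (1 + Q\<^sup>2) * ((1 - Q / x) * (1 - Q * x * q))
      + Q * ((x * q) * ((1 - Q / (x * q)) * (1 - Q / x)) + (1 - Q * x) * (1 - Q * x * q) / x)"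
    using x q_nz by (simp add: field_simps power2_eq_square)
  have opaque: "K * (T * A * B) = L * (T * (u * A) * (v * B))
      - Q * (- T * w * (y * u * A) * B + - T / x * A * (z * v * B))"
    if "K = L * (u * v) + Q * (w * (y * u) + z * v / x)" for K L u v w y z
    unfolding that by (simp add: algebra_simps)
  show ?thesis
    unfolding 0 1 2 3 q_powi_add Q2 Q_def[symmetric]
    using opaque[OF id] by (simp only: power_int_1_right)
qed

section \<open>Hecke sums as linear functionals of a decaying sequence\<close>

definition decay :: "(int \<Rightarrow> complex) \<Rightarrow> bool" where
  "decay c \<longleftrightarrow> (\<exists>B\<ge>0. \<forall>N. norm (c N) \<le> B * norm q powi \<bar>N\<bar>)"

lemma decay_cmult: "decay c \<Longrightarrow> decay (\<lambda>N. a * c N)"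
proof -
  assume "decay c"
  then obtain B where B: "B \<ge> 0" "\<And>N. norm (c N) \<le> B * norm q powi \<bar>N\<bar>"
    by (auto simp: decay_def)
  have "norm (a * c N) \<le> (norm a * B) * norm q powi \<bar>N\<bar>" for N
    using mult_left_mono[OF B(2)[of N], of "norm a"] by (simp add: norm_mult mult.assoc)
  with B(1) show ?thesis
    unfolding decay_def by (intro exI[of _ "norm a * B"]) auto
qed

lemma decay_add: "decay c \<Longrightarrow> decay c' \<Longrightarrow> decay (\<lambda>N. c N + c' N)"
proof -
  assume "decay c" "decay c'"
  then obtain B B' where B: "B \<ge> 0" "\<And>N. norm (c N) \<le> B * norm q powi \<bar>N\<bar>"
    and B': "B' \<ge> 0" "\<And>N. norm (c' N) \<le> B' * norm q powi \<bar>N\<bar>"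
    by (auto simp: decay_def)
  have "norm (c N + c' N) \<le> (B + B') * norm q powi \<bar>N\<bar>" for N
    using B(2)[of N] B'(2)[of N] norm_triangle_ineq[of "c N" "c' N"] by (simp add: distrib_right)
  with B(1) B'(1) show ?thesis
    unfolding decay_def by (intro exI[of _ "B + B'"]) auto
qed

text \<open>A Gaussian bound absorbs both the shift by \<open>k\<close> and the linear exponent: the
  slope L = 1 + |a| in \<open>tri_ge\<close> leaves one |N| to spare.\<close>

lemma decay_tri:
  assumes "B \<ge> 0" "\<And>N. norm (c N) \<le> B * norm q powi tri N"
  shows "decay (\<lambda>N. q powi (a * N + b) * c (N + k))"
proof -
  define L where "L = 1 + \<bar>a\<bar>"
  define C where "C = L * \<bar>k\<bar> + L * (L + 1) + \<bar>b\<bar>"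
  have exp_le: "- C + \<bar>N\<bar> \<le> a * N + b + tri (N + k)" for N
  proof -
    have "L * \<bar>N + k\<bar> - L * (L + 1) \<le> tri (N + k)"
      by (rule tri_ge) (simp add: L_def)
    moreover have "L * \<bar>N\<bar> \<le> L * \<bar>N + k\<bar> + L * \<bar>k\<bar>"
      unfolding distrib_left[symmetric] by (rule mult_left_mono) (auto simp: L_def)
    moreover have "L * \<bar>N\<bar> = \<bar>N\<bar> + \<bar>a\<bar> * \<bar>N\<bar>"
      by (simp add: L_def algebra_simps)
    moreover have "- (\<bar>a\<bar> * \<bar>N\<bar>) \<le> a * N"
      by (metis abs_ge_minus_self abs_mult minus_le_iff)
    ultimately show ?thesis
      unfolding C_def by linarith
  qed
  have "norm (q powi (a * N + b) * c (N + k)) \<le> B * norm q powi (- C) * norm q powi \<bar>N\<bar>" for N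
  proof -
    have "norm (q powi (a * N + b) * c (N + k)) \<le> norm q powi (a * N + b) * (B * norm q powi tri (N + k))"
      unfolding norm_mult norm_power_int by (intro mult_left_mono assms) simp
    also have "\<dots> = B * norm q powi (a * N + b + tri (N + k))"
      using norm_q_pos by (subst power_int_add[of _ "a * N + b"]) auto
    also have "\<dots> \<le> B * norm q powi (- C + \<bar>N\<bar>)"
      by (intro mult_left_mono powi_mono_exp exp_le norm_q_pos q_lt1 assms)
    also have "\<dots> = B * norm q powi (- C) * norm q powi \<bar>N\<bar>"
      using norm_q_pos by (subst power_int_add) auto
    finally show ?thesis .
  qed
  then show ?thesis
    unfolding decay_def using assms(1) by (intro exI[of _ "B * norm q powi (- C)"]) auto
qed

lemma decay_summable: "decay c \<Longrightarrow> c summable_on UNIV"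
  unfolding decay_def
  by (elim exE conjE, rule abs_summable_summable)
     (rule abs_summable_gauss[OF norm_q_pos q_lt1, where C = 0], auto)

text \<open>With N = r + s the exponents of both Hecke sums are rs plus a function of N: N(N + 1)
  for \<phi>, (N + 1)(N + 2) for \<psi>. Where \<open>sgn2\<close> is nonzero, rs \<ge> 0 and |r +
  s| = |r| + |s|, so \<open>decay c\<close> gives absolute convergence.\<close>

definition hecke :: "(int \<Rightarrow> complex) \<Rightarrow> complex" where
  "hecke c = (\<Sum>\<^sub>\<infinity>(r, s). sgn2 r s * q powi (r * s) * c (r + s))"

lemma hecke_abs_summable:
  assumes "decay c"
  shows "(\<lambda>x. norm (case x of (r, s) \<Rightarrow> sgn2 r s * q powi (r * s) * c (r + s))) summable_on UNIV"
proof -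
  obtain B where B: "B \<ge> 0" "\<And>N. norm (c N) \<le> B * norm q powi \<bar>N\<bar>"
    using assms by (auto simp: decay_def)
  show ?thesis
  proof (rule abs_summable_gauss2[OF norm_q_pos q_lt1 B(1), where C = 0 and e = "\<lambda>r s. \<bar>r\<bar> + \<bar>s\<bar>"])
    fix r s
    assume "(case (r, s) of (r, s) \<Rightarrow> sgn2 r s * q powi (r * s) * c (r + s)) \<noteq> 0"
    then have rs: "r * s \<ge> 0" "\<bar>r + s\<bar> = \<bar>r\<bar> + \<bar>s\<bar>"
      using sgn2_nonzeroD[of r s] by auto
    have "norm q powi (r * s) \<le> 1"
      using powi_mono_exp[OF norm_q_pos q_lt1 rs(1)] by simp
    then have "norm (sgn2 r s) * norm q powi (r * s) * norm (c (r + s)) \<le> 1 * 1 * (B * norm q powi \<bar>r + s\<bar>)"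
      by (intro mult_mono norm_sgn2_le B) auto
    then show "norm (case (r, s) of (r, s) \<Rightarrow> sgn2 r s * q powi (r * s) * c (r + s))
        \<le> B * norm q powi (\<bar>r\<bar> + \<bar>s\<bar>)"
      using rs(2) by (simp add: norm_mult norm_power_int)
  qed simp
qed

lemmas hecke_summable = abs_summable_summable[OF hecke_abs_summable]

lemma hecke_add:
  assumes "decay c" "decay c'"
  shows "hecke (\<lambda>N. c N + c' N) = hecke c + hecke c'"
  unfolding hecke_def
  using infsum_add[OF hecke_summable[OF assms(1)] hecke_summable[OF assms(2)]]
  by (simp add: case_prod_unfold distrib_left)

lemma hecke_cmult: "hecke (\<lambda>N. a * c N) = a * hecke c"
  unfolding hecke_def infsum_cmult_right'[symmetric]
  by (intro infsum_cong) (auto simp: mult_ac)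

text \<open>The substitution (r, s) -> (-1 - r, -1 - s) reverses the sign weight and raises the
  exponent rs by r + s + 1.\<close>

lemma hecke_reflect: "hecke c = hecke (\<lambda>N. - (q powi (N + 1) * c (- 2 - N)))"
  unfolding hecke_def
proof (rule infsum_reindex_bij_witness[of _ "\<lambda>(r, s). (- 1 - r, - 1 - s)" "\<lambda>(r, s). (- 1 - r, - 1 - s)"])
  fix x :: "int \<times> int"
  obtain r s where x: "x = (r, s)"
    by (cases x)
  have "sgn2 (- 1 - r) (- 1 - s) = - sgn2 r s"
    by (rule sgn2_reflect)
  moreover have "(- 1 - r) * (- 1 - s) + ((- 1 - r) + (- 1 - s) + 1) = r * s"
    by (simp add: algebra_simps)
  then have "q powi ((- 1 - r) * (- 1 - s)) * q powi ((- 1 - r) + (- 1 - s) + 1) = q powi (r * s)"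
    by (simp only: q_powi_add[symmetric])
  moreover have "- 2 - ((- 1 - r) + (- 1 - s)) = r + s"
    by simp
  ultimately show "(case (case x of (r, s) \<Rightarrow> (- 1 - r, - 1 - s)) of
      (r, s) \<Rightarrow> sgn2 r s * q powi (r * s) * - (q powi (r + s + 1) * c (- 2 - (r + s)))) =
      (case x of (r, s) \<Rightarrow> sgn2 r s * q powi (r * s) * c (r + s))"
    unfolding x prod.case by (metis (no_types, lifting) minus_mult_minus mult.assoc mult_minus_right)
qed auto

text \<open>Substitute (r, s) -> (r + 1, s + 1). By \<open>sgn2_shift\<close> this leaves the sums
  of \<open>c\<close> over two boundary lines, each of which vanishes by the third
  assumption.\<close>

lemma hecke_shift:
  assumes "decay c" "decay (\<lambda>N. q powi (N + 1) * c (N + 2))" "(\<Sum>\<^sub>\<infinity>N. c N) = 0"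
  shows "hecke c = hecke (\<lambda>N. q powi (N + 1) * c (N + 2))"
proof -
  have c_sum: "c summable_on UNIV"
    by (rule decay_summable[OF assms(1)])
  have c1_sum: "(\<lambda>n. c (n + 1)) summable_on UNIV"
    using c_sum by (subst summable_on_reindex_bij_witness[of _ "\<lambda>n. n - 1" "\<lambda>n. n + 1" UNIV c]) auto
  \<comment> \<open>\<open>f\<close> is the shifted Hecke summand; \<open>g\<close> and
    \<open>h\<close> are the boundary lines, on which the exponent (r + 1)(s + 1) is 0.\<close>
  define f g h where "f = (\<lambda>(r, s). sgn2 r s * q powi (r * s) * (q powi (r + s + 1) * c (r + s + 2)))"
    and "g = (\<lambda>(r :: int, s). if r = - 1 then c (s + 1) else 0)"
    and "h = (\<lambda>(r, s :: int). if s = - 1 then c (r + 1) else 0)"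
  have g_eq: "g summable_on UNIV \<longleftrightarrow> (\<lambda>n. c (n + 1)) summable_on UNIV"
    "infsum g UNIV = (\<Sum>\<^sub>\<infinity>n. c (n + 1))"
  proof -
    have "g summable_on UNIV \<longleftrightarrow> g summable_on ({- 1} \<times> UNIV)"
      by (rule summable_on_cong_neutral) (auto simp: g_def split: if_splits)
    also have "\<dots> \<longleftrightarrow> (\<lambda>n. c (n + 1)) summable_on UNIV"
      by (rule summable_on_reindex_bij_witness[of _ "\<lambda>n. (- 1, n)" snd]) (auto simp: g_def split: if_splits)
    finally show "g summable_on UNIV \<longleftrightarrow> (\<lambda>n. c (n + 1)) summable_on UNIV" .
    have "infsum g UNIV = infsum g ({- 1} \<times> UNIV)"
      by (rule infsum_cong_neutral) (auto simp: g_def split: if_splits)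
    also have "\<dots> = (\<Sum>\<^sub>\<infinity>n. c (n + 1))"
      by (rule infsum_reindex_bij_witness[of _ "\<lambda>n. (- 1, n)" snd]) (auto simp: g_def split: if_splits)
    finally show "infsum g UNIV = (\<Sum>\<^sub>\<infinity>n. c (n + 1))" .
  qed
  have h_eq: "h summable_on UNIV \<longleftrightarrow> g summable_on UNIV" "infsum h UNIV = infsum g UNIV"
    by (rule summable_on_reindex_bij_witness[of _ prod.swap prod.swap], auto simp: g_def h_def)
       (rule infsum_reindex_bij_witness[of _ prod.swap prod.swap], auto simp: g_def h_def)
  have sums: "f summable_on UNIV" "g summable_on UNIV" "h summable_on UNIV"
    using hecke_summable[OF assms(2)] c1_sum by (simp_all add: f_def g_eq h_eq)
  have "hecke c = (\<Sum>\<^sub>\<infinity>x. f x + (g x + h x))"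
    unfolding hecke_def
  proof (rule infsum_reindex_bij_witness[of _ "\<lambda>(r, s). (r + 1, s + 1)" "\<lambda>(r, s). (r - 1, s - 1)"])
    fix x :: "int \<times> int"
    obtain r s where x: "x = (r + 1, s + 1)"
      by (metis diff_add_cancel surj_pair)
    have "q powi (r * s) * q powi (r + s + 1) = q powi ((r + 1) * (s + 1))"
      by (simp add: q_powi_add[symmetric] algebra_simps)
    then have "f (r, s) = sgn2 r s * q powi ((r + 1) * (s + 1)) * c (r + s + 2)"
      by (simp add: f_def mult_ac)
    moreover have "g (r, s) = (if r = - 1 then 1 else 0) * q powi ((r + 1) * (s + 1)) * c (r + s + 2)"
      by (simp add: g_def add.commute)
    moreover have "h (r, s) = (if s = - 1 then 1 else 0) * q powi ((r + 1) * (s + 1)) * c (r + s + 2)"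
      by (simp add: h_def add.commute)
    ultimately show "f (case x of (r, s) \<Rightarrow> (r - 1, s - 1)) +
        (g (case x of (r, s) \<Rightarrow> (r - 1, s - 1)) + h (case x of (r, s) \<Rightarrow> (r - 1, s - 1))) =
        (case x of (r, s) \<Rightarrow> sgn2 r s * q powi (r * s) * c (r + s))"
      unfolding x prod.case sgn2_shift by (simp add: algebra_simps)
  qed auto
  also have "\<dots> = infsum f UNIV + (infsum g UNIV + infsum h UNIV)"
    using sums by (simp add: infsum_add summable_on_add)
  also have "infsum g UNIV = 0"
    using g_eq infsum_int_shift[of c 1] assms(3) by simp
  finally show ?thesis
    using h_eq \<open>infsum g UNIV = 0\<close> by (simp add: hecke_def f_def)
qed

section \<open>A Bailey pair from the finite Jacobi product\<close>

lemma jcoef_bound: "\<exists>C>0. \<forall>n N. norm (jcoef n N) \<le> C * norm q powi tri N"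
proof -
  obtain C where C: "C > 0" "\<And>k. norm (invq k) \<le> C"
    using invq_bounded by blast
  have "norm (jcoef n N) \<le> (C * C) * norm q powi tri N" for n N
  proof -
    have "norm (invq (n - N)) * norm (invq (n + N + 1)) \<le> C * C"
      using C by (intro mult_mono) auto
    then have "norm q powi tri N * (norm (invq (n - N)) * norm (invq (n + N + 1))) \<le> norm q powi tri N * (C * C)"
      by (intro mult_left_mono) auto
    then show ?thesis
      by (simp add: jcoef_def norm_mult norm_power_int mult_ac)
  qed
  with C(1) show ?thesis
    by (intro exI[of _ "C * C"]) auto
qed

lemma decay_jcoef: "decay (\<lambda>N. q powi (a * N + b) * jcoef n (N + k))"
proof -
  obtain C where "C > 0" "\<And>n N. norm (jcoef n N) \<le> C * norm q powi tri N"
    using jcoef_bound by blast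
  then show ?thesis
    by (intro decay_tri[of C]) auto
qed

lemma decay_jcoef_simps [simp]:
  "decay (\<lambda>N. jcoef n (N + k))"
  "decay (jcoef n)"
  "decay (\<lambda>N. q powi (N + 1) * jcoef n (N + k))"
  "decay (\<lambda>N. q powi (N + 1) * jcoef n N)"
  using decay_jcoef[of 0 0 n k] decay_jcoef[of 0 0 n 0] decay_jcoef[of 1 1 n k] decay_jcoef[of 1 1 n 0]
  by simp_all

text \<open>The finite Jacobi product contains the factor 1 - 1/z and so vanishes at z = 1; for the
  coefficients this is the antisymmetry under N -> -1 - N.\<close>

lemma infsum_jcoef: "(\<Sum>\<^sub>\<infinity>N. jcoef n (N + k)) = 0"
proof -
  have "(\<Sum>\<^sub>\<infinity>N. jcoef n N) = (\<Sum>\<^sub>\<infinity>N. - jcoef n N)"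
    by (rule infsum_reindex_bij_witness[of _ "\<lambda>N. - 1 - N" "\<lambda>N. - 1 - N"])
       (auto simp: jcoef_reflect)
  then show ?thesis
    by (simp add: infsum_int_shift infsum_uminus)
qed

definition hsum :: "int \<Rightarrow> int \<Rightarrow> complex" where
  "hsum n k = hecke (\<lambda>N. jcoef n (N + k))"

lemma hsum_reflect: "hsum n k = hecke (\<lambda>N. q powi (N + 1) * jcoef n (N + (1 - k)))"
proof -
  have "jcoef n (- 2 - N + k) = - jcoef n (N + (1 - k))" for N
    using jcoef_reflect[of n "N + (1 - k)"] by (simp add: algebra_simps)
  then show ?thesis
    unfolding hsum_def by (subst hecke_reflect) simp
qed

text \<open>A diagonal shift followed by a reflection leads from offset -1 to offset 0; the boundary
  terms vanish by \<open>infsum_jcoef\<close>.\<close>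

lemma hsum_sym: "hsum n (- 1) = hsum n 0"
proof -
  have "hsum n (- 1) = hecke (\<lambda>N. q powi (N + 1) * jcoef n (N + 2 + (- 1)))"
    unfolding hsum_def
    by (rule hecke_shift) (use infsum_jcoef[of n "- 1"] decay_jcoef_simps(1)[of n "- 1"] decay_jcoef_simps(3)[of n 1]
        in \<open>simp_all add: add.assoc add.commute\<close>)
  then show ?thesis
    by (simp add: hsum_reflect[of n 0] add.assoc add.commute)
qed

text \<open>Apply \<open>hecke\<close> to both sides of \<open>jcoef_ratio\<close>. By
  \<open>hsum_reflect\<close> the two terms on each side have the same Hecke sum, so the claim comes
  out doubled.\<close>

lemma hsum_1: "hsum n 1 = q powi (n + 1) * hsum n 0"
proof -
  have "hecke (\<lambda>N. jcoef n (N + 1) + q powi (N + 1) * jcoef n N) =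
      hecke (\<lambda>N. q powi (n + 1) * (jcoef n N + q powi (N + 1) * jcoef n (N + 1)))"
    by (simp only: jcoef_ratio)
  then have "hsum n 1 + hecke (\<lambda>N. q powi (N + 1) * jcoef n N) =
      q powi (n + 1) * (hsum n 0 + hecke (\<lambda>N. q powi (N + 1) * jcoef n (N + 1)))"
    by (simp add: hecke_cmult hecke_add hsum_def)
  also have "hecke (\<lambda>N. q powi (N + 1) * jcoef n N) = hsum n 1"
    by (simp add: hsum_reflect)
  also have "hecke (\<lambda>N. q powi (N + 1) * jcoef n (N + 1)) = hsum n 0"
    by (simp add: hsum_reflect)
  finally have "2 * hsum n 1 = 2 * (q powi (n + 1) * hsum n 0)"
    by simp
  then show ?thesis
    by simp
qed

text \<open>\<open>jcoef_rec\<close> produces the offsets 0, 1 and -1, which \<open>hsum_1\<close>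
  and \<open>hsum_sym\<close> reduce to offset 0. The factor is 1 + q^(2n) - q^n (q^n + 1) = 1 -
  q^n.\<close>

lemma hsum_rec:
  "(1 - q powi (2 * n)) * (1 - q powi (2 * n + 1)) * hsum n 0 = (1 - q powi n) * hsum (n - 1) 0"
proof -
  have "(1 - q powi (2 * n)) * (1 - q powi (2 * n + 1)) * hsum n 0 =
      hecke (\<lambda>N. (1 + q powi (2 * n)) * jcoef (n - 1) N
        + (- (q powi n)) * (jcoef (n - 1) (N + 1) + jcoef (n - 1) (N + - 1)))"
    unfolding hsum_def hecke_cmult[symmetric] using jcoef_rec[of n] by simp
  also have "\<dots> = (1 + q powi (2 * n)) * hsum (n - 1) 0
      - q powi n * (hsum (n - 1) 1 + hsum (n - 1) (- 1))"
    by (simp only: hecke_add hecke_cmult decay_cmult decay_add decay_jcoef_simps) (simp add: hsum_def)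
  also have "\<dots> = (1 - q powi n) * hsum (n - 1) 0"
  proof -
    have "q powi (2 * n) = q powi n * q powi n"
      by (simp add: q_powi_add[symmetric])
    then show ?thesis
      by (simp add: hsum_1 hsum_sym algebra_simps)
  qed
  finally show ?thesis .
qed

lemma hsum_0_0: "hsum 0 0 = 1 / (1 - q)"
proof -
  have zero: "sgn2 r s * q powi (r * s) * jcoef 0 (r + s) = 0" if "(r, s) \<noteq> (0, 0)" for r s
  proof (cases "sgn2 r s = 0")
    case False
    then have "(r \<ge> 0 \<and> s \<ge> 0) \<or> (r < 0 \<and> s < 0)"
      by (auto simp: sgn2_def split: if_splits)
    \<comment> \<open>\<open>jcoef 0\<close> lives on N = 0 and N = -1, and r + s = -1 cannot occur
      when r and s are both nonnegative or both negative.\<close>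
    with that have "r + s > 0 \<or> r + s < - 1"
      by auto
    then show ?thesis
      by (auto simp: jcoef_def invq_def)
  qed simp
  have "hsum 0 0 = (\<Sum>\<^sub>\<infinity>(r, s)\<in>{(0, 0)}. sgn2 r s * q powi (r * s) * jcoef 0 (r + s))"
    unfolding hsum_def hecke_def by (rule infsum_cong_neutral) (use zero in \<open>force simp del: mult_eq_0_iff\<close>)+
  also have "\<dots> = 1 / (1 - q)"
    by (simp add: sgn2_def jcoef_def invq_def tri_def qpoch_def)
  finally show ?thesis .
qed

text \<open>The factors on the left are the two that \<open>qpoch q q (2 * n + 1)\<close> gains when
  n grows by one, so the recursion unrolls to a plain product. It serves the Bailey pair and both
  Jacobi identities.\<close>

lemma jrec_solve:
  assumes "\<And>n. (1 - q powi (2 * int (Suc n))) * (1 - q powi (2 * int (Suc n) + 1)) * f (Suc n) = a n * f n"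
  shows "f n * qpoch q q (2 * n + 1) = (1 - q) * f 0 * (\<Prod>i<n. a i)"
proof (induction n)
  case (Suc n)
  have "2 * int (Suc n) = int (2 * n + 2)" "2 * int (Suc n) + 1 = int (2 * n + 3)"
    by simp_all
  then have "q powi (2 * int (Suc n)) = q ^ (2 * n + 1) * q" "q powi (2 * int (Suc n) + 1) = q ^ (2 * n + 2) * q"
    by (simp_all only: power_int_of_nat) (simp_all add: power_add power2_eq_square power3_eq_cube)
  then have "f (Suc n) * qpoch q q (2 * Suc n + 1) = qpoch q q (2 * n + 1) *
      ((1 - q powi (2 * int (Suc n))) * (1 - q powi (2 * int (Suc n) + 1)) * f (Suc n))"
    by (simp add: qpoch_Suc mult_ac)
  also have "\<dots> = qpoch q q (2 * n + 1) * (a n * f n)"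
    by (simp only: assms)
  also have "\<dots> = a n * (f n * qpoch q q (2 * n + 1))"
    by simp
  finally show ?case
    unfolding Suc.IH by (simp add: mult_ac)
qed (simp add: qpoch_def)

text \<open>In Bailey's terms: \<open>qpoch q q n / qpoch q q (2 * n + 1)\<close> is the \<open>\<beta>\<close>-side of a Bailey pair
  relative to \<open>q\<close> whose \<open>\<alpha>\<close>-side is an indefinite theta sum.\<close>

theorem hsum_eq: "hsum (int n) 0 = qpoch q q n / qpoch q q (2 * n + 1)"
proof -
  have "hsum (int n) 0 * qpoch q q (2 * n + 1) = (1 - q) * hsum (int 0) 0 * (\<Prod>i<n. 1 - q ^ i * q)"
  proof (rule jrec_solve)
    show "(1 - q powi (2 * int (Suc n))) * (1 - q powi (2 * int (Suc n) + 1)) * hsum (int (Suc n)) 0 =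
        (1 - q ^ n * q) * hsum (int n) 0" for n
    proof -
      have "q powi int (Suc n) = q ^ n * q" "int (Suc n) - 1 = int n"
        by (simp_all only: power_int_of_nat) simp_all
      then show ?thesis
        using hsum_rec[of "int (Suc n)"] by (simp only:)
    qed
  qed
  moreover have "q \<noteq> 1"
    using q_lt1 by auto
  ultimately show ?thesis
    using qpoch_nonzero[OF q_lt1 q_lt1, of "2 * n + 1"]
    by (simp add: hsum_0_0 qpoch_def nonzero_eq_divide_eq)
qed

end

section \<open>Hecke sums for the mock theta functions\<close>

context nome
begin

text \<open>The weights of Bailey's lemma, chosen so that \<open>wt n * hsum (int n) 0\<close> is
  the n-th term of the series for \<phi>.\<close>

definition wt :: "nat \<Rightarrow> complex" where
  "wt n = qpoch (- q) q n * q powi tri (int n)"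

lemma qpoch_bounded: "\<exists>C>0. \<forall>n. norm (qpoch x q n) \<le> C"
proof -
  have "Bseq (qpoch x q)"
    using qpoch_LIMSEQ[OF q_lt1] by (intro convergent_imp_Bseq convergentI)
  then show ?thesis
    by (auto simp: Bseq_def)
qed

lemma norm_powi_tri_le: "norm q powi tri (int n) \<le> norm q ^ n"
proof -
  have "int n \<le> tri (int n)"
    using tri_ge[of 0 "int n"] two_tri[of "int n"]
    by (cases n) (auto simp: algebra_simps, smt (verit) mult_nonneg_nonneg of_nat_0_le_iff)
  then show ?thesis
    using powi_mono_exp[OF norm_q_pos q_lt1, of "int n" "tri (int n)"] by simp
qed

lemma wt_summable:
  assumes "\<And>n. norm (f n) \<le> B"
  shows "(\<lambda>n. norm (wt n * f n)) summable_on UNIV"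
proof -
  obtain C where C: "C > 0" "\<And>n. norm (qpoch (- q) q n) \<le> C"
    using qpoch_bounded by blast
  have "B \<ge> 0"
    using assms norm_ge_zero order_trans by blast
  show ?thesis
  proof (rule Infinite_Sum.abs_summable_on_comparison_test')
    show "(\<lambda>n. (C * B) * norm q ^ n) summable_on UNIV"
      using q_lt1 by (intro summable_on_cmult_right summable_nonneg_imp_summable_on summable_geometric) auto
    show "norm (wt n * f n) \<le> C * B * norm q ^ n" for n
    proof -
      have "norm (qpoch (- q) q n) * norm q powi tri (int n) * norm (f n) \<le> C * norm q ^ n * B"
        using C \<open>B \<ge> 0\<close> by (intro mult_mono assms norm_powi_tri_le) auto
      then show ?thesis
        by (simp add: wt_def norm_mult norm_power_int mult_ac)
    qed
  qed
qed

lemma wt_Suc: "wt (Suc n) = wt n * ((1 + q ^ Suc n) * q ^ Suc n)"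
proof -
  have "tri (int (Suc n)) = tri (int n) + int (Suc n)"
    by (rule tri_Suc)
  then have "q powi tri (int (Suc n)) = q powi tri (int n) * q ^ Suc n"
    by (simp only: q_powi_add power_int_of_nat)
  then show ?thesis
    by (simp add: wt_def qpoch_Suc)
qed

text \<open>In Bailey's terms \<open>wt\<close> and \<open>wsum\<close> form a conjugate pair: up to
  a sign and a power of q, \<open>wsum N\<close> is the sum of \<open>wt n * jcoef (int n) N\<close>
  over n.\<close>

definition wsum :: "int \<Rightarrow> complex" where
  "wsum N = (\<Sum>\<^sub>\<infinity>n. wt n * (invq (int n - N) * invq (int n + N + 1)))"

lemma invq2_bounded: "\<exists>C>0. \<forall>k l. norm (invq k * invq l) \<le> C"
proof -
  obtain C where C: "C > 0" "\<And>k. norm (invq k) \<le> C"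
    using invq_bounded by blast
  have "norm (invq k * invq l) \<le> C * C" for k l
    unfolding norm_mult using C by (intro mult_mono) auto
  with C(1) show ?thesis
    by (intro exI[of _ "C * C"]) auto
qed

lemma wt_invq_summable: "(\<lambda>n. wt n * (invq (k n) * invq (l n))) summable_on UNIV"
proof -
  obtain C where "\<And>k l. norm (invq k * invq l) \<le> C"
    using invq2_bounded by blast
  then show ?thesis
    by (rule abs_summable_summable[OF wt_summable])
qed

lemma wsum_rec: "wsum N = q powi N * wsum (N - 1)"
proof -
  define x where "x = q powi N"
  have x: "x \<noteq> 0"
    using q_nz by (simp add: x_def)
  \<comment> \<open>A telescoping certificate: the n-th term of
    \<open>wsum N - x * wsum (N - 1)\<close> is \<open>G (Suc n) - G n\<close>. Both ends vanish:
    \<open>G\<close> tends to 0 by summability, and at n = 0 either N = 0 and 1 - x = 0, or one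
    \<open>invq\<close> has a negative argument.\<close>
  define G where "G n = - (1 - x) * (wt n * (invq (int n - N) * invq (int n + N)))" for n
  have term_eq: "wt n * (invq (int n - N) * invq (int n + N + 1))
      - x * (wt n * (invq (int n - (N - 1)) * invq (int n + (N - 1) + 1))) = G (Suc n) - G n" for n
  proof -
    define Y where "Y = q ^ Suc n"
    define A where "A = invq (int n + 1 - N)"
    define B where "B = invq (int n + 1 + N)"
    have Y: "q powi (int n + 1) = Y"
      using power_int_of_nat[of q "Suc n"] by (simp add: Y_def add.commute)
    have "q powi (int n + 1 - N) = Y / x"
      using q_nz by (simp add: power_int_diff x_def Y)
    moreover have "int n + 1 - N - 1 = int n - N"
      by simp
    ultimately have a: "invq (int n - N) = (1 - Y / x) * A"
      using invq_rec[of "int n + 1 - N"] by (simp only: A_def)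
    have "q powi (int n + 1 + N) = Y * x"
      by (simp only: q_powi_add[of "int n + 1"] x_def Y)
    moreover have "int n + 1 + N - 1 = int n + N"
      by simp
    ultimately have b: "invq (int n + N) = (1 - Y * x) * B"
      using invq_rec[of "int n + 1 + N"] by (simp only: B_def)
    have idx: "int n + N + 1 = int n + 1 + N" "int n - (N - 1) = int n + 1 - N"
      "int n + (N - 1) + 1 = int n + N" "int (Suc n) - N = int n + 1 - N" "int (Suc n) + N = int n + 1 + N"
      by simp_all
    show ?thesis
      unfolding G_def idx a b wt_Suc A_def[symmetric] B_def[symmetric] Y_def[symmetric]
      using x by (simp add: field_simps)
  qed
  have Gsum: "(\<lambda>n. wt n * (invq (int n - N) * invq (int n + N))) summable_on UNIV"
    by (rule wt_invq_summable)
  have "G \<longlonglongrightarrow> 0"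
    unfolding G_def using summable_LIMSEQ_zero[OF summable_on_imp_summable[OF Gsum]]
    by (rule tendsto_mult_right_zero)
  then have tele: "(\<lambda>n. G (Suc n) - G n) sums (0 - G 0)"
    by (rule telescope_sums)
  have G0: "G 0 = 0"
    by (cases "N = 0") (auto simp: G_def x_def invq_def)
  have "((\<lambda>n. wt n * (invq (int n - N) * invq (int n + N + 1))
      - x * (wt n * (invq (int n - (N - 1)) * invq (int n + (N - 1) + 1))))
      has_sum (wsum N - x * wsum (N - 1))) UNIV"
    unfolding wsum_def
    using has_sum_add[OF has_sum_infsum[OF wt_invq_summable[of "\<lambda>n. int n - N" "\<lambda>n. int n + N + 1"]]
      has_sum_cmult_right[OF has_sum_infsum[OF wt_invq_summable[of "\<lambda>n. int n - (N - 1)" "\<lambda>n. int n + (N - 1) + 1"]],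
        of "- x"]] by simp
  then have "(\<lambda>n. G (Suc n) - G n) sums (wsum N - x * wsum (N - 1))"
    unfolding term_eq by (rule has_sum_imp_sums)
  with tele have "wsum N - x * wsum (N - 1) = 0 - G 0"
    by (rule sums_unique2[symmetric])
  then show ?thesis
    by (simp add: G0 x_def)
qed

text \<open>By the recursion, \<open>wsum (int k)\<close> is \<open>wsum 0\<close> times q^(tri k).
  Its sum starts at n = k; after n = m + k that power cancels, and letting k tend to infinity
  removes every term except m = 0.\<close>

lemma wsum_0: "wsum 0 = qpoch_inf (- q) q / qpoch_inf q q"
proof -
  have pow: "wsum (int k) = q powi tri (int k) * wsum 0" for k
  proof (induction k)
    case (Suc k)
    have "tri (int (Suc k)) = int (Suc k) + tri (int k)"
      using tri_Suc[of k] by simp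
    then show ?case
      using wsum_rec[of "int (Suc k)"] Suc.IH by (simp add: q_powi_add mult.assoc)
  qed (simp add: tri_def)
  define f where "f k m = qpoch (- q) q (m + k) * q powi (tri (int m) + int m * int k)
      * (invq (int m) * invq (int m + 2 * int k + 1))" for k m
  have wsum_f: "wsum 0 = (\<Sum>\<^sub>\<infinity>m. f k m)" for k
  proof -
    have "q powi tri (int k) * wsum 0 = (\<Sum>\<^sub>\<infinity>n. wt n * (invq (int n - int k) * invq (int n + int k + 1)))"
      unfolding pow[symmetric] by (simp only: wsum_def)
    also have "\<dots> = (\<Sum>\<^sub>\<infinity>n\<in>{k..}. wt n * (invq (int n - int k) * invq (int n + int k + 1)))"
      by (rule infsum_cong_neutral) (auto simp: invq_def)
    also have "\<dots> = (\<Sum>\<^sub>\<infinity>m. q powi tri (int k) * f k m)"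
    proof (rule infsum_reindex_bij_witness[of _ "\<lambda>m. m + k" "\<lambda>n. n - k"])
      fix n
      assume "n \<in> {k..}"
      then obtain m where n: "n = m + k"
        by (metis atLeast_iff le_add_diff_inverse2)
      have "q powi tri (int n) = q powi tri (int k) * q powi (tri (int m) + int m * int k)"
        unfolding q_powi_add[symmetric] by (simp add: n tri_add algebra_simps)
      moreover have "int n + int k + 1 = int m + 2 * int k + 1" "int n - int k = int m" "n - k = m"
        by (simp_all add: n)
      ultimately show "q powi tri (int k) * f k (n - k) =
          wt n * (invq (int n - int k) * invq (int n + int k + 1))"
        by (simp only: f_def wt_def n) (simp add: mult_ac)
    qed auto
    also have "\<dots> = q powi tri (int k) * (\<Sum>\<^sub>\<infinity>m. f k m)"
      by (rule infsum_cmult_right')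
    finally show ?thesis
      using q_nz by simp
  qed
  define g where "g m = (if m = 0 then qpoch_inf (- q) q / qpoch_inf q q else 0)" for m :: nat
  obtain C where C: "C > 0" "\<And>n. norm (qpoch (- q) q n) \<le> C"
    using qpoch_bounded by blast
  obtain D where D: "D > 0" "\<And>k l. norm (invq k * invq l) \<le> D"
    using invq2_bounded by blast
  have "(\<lambda>k. \<Sum>\<^sub>\<infinity>m. f k m) \<longlonglongrightarrow> (\<Sum>\<^sub>\<infinity>m. g m)"
  proof (rule infsum_tannery)
    show "(\<lambda>m. (C * D) * norm q ^ m) summable_on UNIV"
      using q_lt1 by (intro summable_on_cmult_right summable_nonneg_imp_summable_on summable_geometric) auto
    show "norm (f k m) \<le> (C * D) * norm q ^ m" for k m
    proof -
      have "norm q powi (tri (int m) + int m * int k) \<le> norm q powi tri (int m)"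
        by (rule powi_mono_exp[OF norm_q_pos q_lt1]) simp
      also have "\<dots> \<le> norm q ^ m"
        by (rule norm_powi_tri_le)
      finally have "norm (qpoch (- q) q (m + k)) * norm q powi (tri (int m) + int m * int k)
          * norm (invq (int m) * invq (int m + 2 * int k + 1)) \<le> C * norm q ^ m * D"
        using C D by (intro mult_mono) auto
      then show ?thesis
        by (simp add: f_def norm_mult norm_power_int mult_ac)
    qed
    show "(\<lambda>k. f k m) \<longlonglongrightarrow> g m" for m
    proof (cases "m = 0")
      case True
      have "(\<lambda>k. invq (2 * int k + 1)) \<longlonglongrightarrow> 1 / qpoch_inf q q"
        using LIMSEQ_subseq_LIMSEQ[OF invq_LIMSEQ[of 1], of "\<lambda>k. 2 * k"]
        by (simp add: strict_mono_def o_def)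
      then have "(\<lambda>k. qpoch (- q) q k * invq (2 * int k + 1)) \<longlonglongrightarrow> qpoch_inf (- q) q * (1 / qpoch_inf q q)"
        by (intro tendsto_mult qpoch_LIMSEQ q_lt1)
      then show ?thesis
        by (simp add: True f_def g_def tri_def invq_def)
    next
      case False
      have "(\<lambda>k. norm q ^ k) \<longlonglongrightarrow> 0"
        using q_lt1 by (intro LIMSEQ_power_zero) simp
      then have "(\<lambda>k. (C * D) * norm q ^ k) \<longlonglongrightarrow> 0"
        by (rule tendsto_mult_right_zero)
      moreover have "norm (f k m) \<le> (C * D) * norm q ^ k" for k
      proof -
        have "int k \<le> int m * int k"
          using False mult_right_mono[of 1 "int m" "int k"] by simp
        then have "int k \<le> tri (int m) + int m * int k"
          using tri_nonneg[of "int m"] by linarith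
        then have "norm q powi (tri (int m) + int m * int k) \<le> norm q ^ k"
          using powi_mono_exp[OF norm_q_pos q_lt1, of "int k"] by simp
        then have "norm (qpoch (- q) q (m + k)) * norm q powi (tri (int m) + int m * int k)
            * norm (invq (int m) * invq (int m + 2 * int k + 1)) \<le> C * norm q ^ k * D"
          using C D by (intro mult_mono) auto
        then show ?thesis
          by (simp add: f_def norm_mult norm_power_int mult_ac)
      qed
      ultimately show ?thesis
        using False by (simp add: g_def) (rule Lim_null_comparison, auto)
    qed
  qed
  then have "(\<lambda>k::nat. wsum 0) \<longlonglongrightarrow> (\<Sum>\<^sub>\<infinity>m. g m)"
    by (simp only: wsum_f[symmetric])
  then have "wsum 0 = (\<Sum>\<^sub>\<infinity>m. g m)"
    by (rule LIMSEQ_unique[OF tendsto_const])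
  also have "\<dots> = (\<Sum>\<^sub>\<infinity>m\<in>{0}. g m)"
    by (rule infsum_cong_neutral) (auto simp: g_def)
  finally show ?thesis
    by (simp add: g_def)
qed

lemma wsum_eq: "wsum N = q powi tri N * (qpoch_inf (- q) q / qpoch_inf q q)"
proof (induction N rule: int_induct[where k = 0])
  case base
  then show ?case
    by (simp add: wsum_0 tri_def)
next
  case (step1 N)
  have "tri (N + 1) = (N + 1) + tri N"
    using tri_add[of N 1] by (simp add: tri_def)
  then show ?case
    using wsum_rec[of "N + 1"] step1 by (simp add: q_powi_add mult.assoc)
next
  case (step2 N)
  have "tri N = N + tri (N - 1)"
    using tri_add[of "N - 1" 1] by (simp add: tri_def)
  then show ?case
    using wsum_rec[of N] step2 q_nz by (simp add: q_powi_add flip: times_divide_eq_right)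
qed

definition hcoef :: "int \<Rightarrow> complex" where
  "hcoef N = (- 1) powi N * q powi (N * (N + 1))"

lemma infsum_wt_jcoef:
  "(\<Sum>\<^sub>\<infinity>n. wt n * jcoef (int n) N) = hcoef N * (qpoch_inf (- q) q / qpoch_inf q q)"
proof -
  have "(\<Sum>\<^sub>\<infinity>n. wt n * jcoef (int n) N) = (- 1) powi N * q powi tri N * wsum N"
    unfolding wsum_def infsum_cmult_right'[symmetric]
    by (intro infsum_cong) (simp add: jcoef_def mult_ac)
  also have "\<dots> = (- 1) powi N * q powi (tri N + tri N) * (qpoch_inf (- q) q / qpoch_inf q q)"
    by (simp only: wsum_eq q_powi_add mult.assoc)
  also have "tri N + tri N = N * (N + 1)"
    using two_tri[of N] by simp
  finally show ?thesis
    by (simp add: hcoef_def)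
qed

lemma decay_powi_abs: "decay (\<lambda>N. q powi \<bar>N\<bar>)"
  unfolding decay_def by (intro exI[of _ 1]) (simp add: norm_power_int)

lemma jcoef_uniform_decay: "\<exists>B\<ge>0. \<forall>n N. norm (jcoef n (N + k)) \<le> B * norm q powi \<bar>N\<bar>"
proof -
  obtain C where C: "C > 0" "\<And>n N. norm (jcoef n N) \<le> C * norm q powi tri N"
    using jcoef_bound by blast
  have "decay (\<lambda>N. q powi (0 * N + 0) * (q powi tri (N + k)))"
    by (rule decay_tri[of 1]) (simp_all add: norm_power_int)
  then obtain B where B: "B \<ge> 0" "\<And>N. norm q powi tri (N + k) \<le> B * norm q powi \<bar>N\<bar>"
    by (auto simp: decay_def norm_power_int)
  have "norm (jcoef n (N + k)) \<le> (C * B) * norm q powi \<bar>N\<bar>" for n N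
    using order_trans[OF C(2) mult_left_mono[OF B(2)]] C(1) by (simp add: mult.assoc)
  with B(1) C(1) show ?thesis
    by (intro exI[of _ "C * B"]) auto
qed

text \<open>Bailey's lemma: carry out the sum over n first, inside the Hecke sum, where
  \<open>infsum_wt_jcoef\<close> evaluates it. The decay of \<open>jcoef\<close> uniform in n
  justifies the exchange.\<close>

lemma infsum_wt_hsum:
  "((\<lambda>n. wt n * hsum (int n) k) has_sum
     (hecke (\<lambda>N. hcoef (N + k)) * (qpoch_inf (- q) q / qpoch_inf q q))) UNIV"
proof -
  obtain B where B: "B \<ge> 0" "\<And>n N. norm (jcoef n (N + k)) \<le> B * norm q powi \<bar>N\<bar>"
    using jcoef_uniform_decay by blast
  define f where "f n x = (case x of (r, s) \<Rightarrow>
      wt n * (sgn2 r s * q powi (r * s) * jcoef (int n) (r + s + k)))" for n x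
  define h where "h x = norm (case x of (r, s) \<Rightarrow> sgn2 r s * q powi (r * s) * q powi \<bar>r + s\<bar>)" for x
  have sum: "(\<lambda>(n, x). f n x) summable_on (UNIV \<times> UNIV)"
  proof (rule abs_summable_summable, rule Infinite_Sum.abs_summable_on_comparison_test')
    have "(\<lambda>n. norm (wt n * 1)) summable_on UNIV"
      by (rule wt_summable[of _ 1]) simp
    then have "(\<lambda>(n, x). norm (wt n) * h x) summable_on UNIV"
      by (intro summable_on_product_real)
         (use hecke_abs_summable[OF decay_powi_abs] in \<open>auto simp: h_def\<close>)
    then show "(\<lambda>y. B * (case y of (n, x) \<Rightarrow> norm (wt n) * h x)) summable_on (UNIV \<times> UNIV)"
      by (intro summable_on_cmult_right) simp
    show "norm (case y of (n, x) \<Rightarrow> f n x) \<le> B * (case y of (n, x) \<Rightarrow> norm (wt n) * h x)" for y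
    proof -
      obtain n r s where y: "y = (n, r, s)"
        by (metis prod_cases3)
      have "norm (wt n * sgn2 r s * q powi (r * s)) * norm (jcoef (int n) (r + s + k))
          \<le> norm (wt n * sgn2 r s * q powi (r * s)) * (B * norm q powi \<bar>r + s\<bar>)"
        by (intro mult_left_mono B) simp
      then show ?thesis
        by (simp add: y f_def h_def norm_mult norm_power_int mult_ac)
    qed
  qed
  have inner: "(\<Sum>\<^sub>\<infinity>x. f n x) = wt n * hsum (int n) k" for n
    unfolding hsum_def hecke_def infsum_cmult_right'[symmetric]
    by (intro infsum_cong) (auto simp: f_def)
  have "(\<lambda>n. \<Sum>\<^sub>\<infinity>x. f n x) summable_on UNIV"
    by (rule summable_on_Sigma_banach[OF sum])
  moreover have "(\<Sum>\<^sub>\<infinity>n. \<Sum>\<^sub>\<infinity>x. f n x) = (\<Sum>\<^sub>\<infinity>x. \<Sum>\<^sub>\<infinity>n. f n x)"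
    by (rule infsum_swap_banach[OF sum])
  moreover have "(\<Sum>\<^sub>\<infinity>x. \<Sum>\<^sub>\<infinity>n. f n x) =
      hecke (\<lambda>N. hcoef (N + k)) * (qpoch_inf (- q) q / qpoch_inf q q)"
    unfolding hecke_def infsum_cmult_left'[symmetric]
  proof (intro infsum_cong, clarify)
    fix r s
    have "(\<Sum>\<^sub>\<infinity>n. f n (r, s)) =
        sgn2 r s * q powi (r * s) * (\<Sum>\<^sub>\<infinity>n. wt n * jcoef (int n) (r + s + k))"
      unfolding infsum_cmult_right'[symmetric] by (intro infsum_cong) (simp add: f_def mult_ac)
    then show "(\<Sum>\<^sub>\<infinity>n. f n (r, s)) = sgn2 r s * q powi (r * s) * hcoef (r + s + k)
        * (qpoch_inf (- q) q / qpoch_inf q q)"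
      by (simp add: infsum_wt_jcoef)
  qed
  ultimately show ?thesis
    by (simp add: has_sum_iff inner)
qed

text \<open>Cancelling (q; q)_n and (-q; q)_n from (q; q)_(2n+1) leaves the denominator (q;
  q^2)_(n+1).\<close>

lemma wt_hsum_0: "wt n * hsum (int n) 0 = q ^ ((n + 1) choose 2) / qpoch q (q\<^sup>2) (n + 1)"
proof -
  have nz: "qpoch q q n \<noteq> 0" for n
    by (rule qpoch_nonzero[OF q_lt1 q_lt1])
  have "q powi tri (int n) = q ^ (Suc n choose 2)"
    unfolding choose_2_tri[symmetric] power_int_of_nat ..
  moreover have "qpoch q q (2 * n + 1) = qpoch q (q\<^sup>2) (n + 1) * (qpoch q q n * qpoch (- q) q n)"
    by (simp only: qpoch_odd qpoch_mult_minus)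
  ultimately show ?thesis
    using nz[of "2 * n + 1"] by (simp add: wt_def hsum_eq field_simps)
qed

theorem mock_phi_hecke: "mock_phi q = hecke hcoef * (qpoch_inf (- q) q / qpoch_inf q q)"
  unfolding mock_phi_def
  using has_sum_imp_sums[OF infsum_wt_hsum[of 0]] by (simp add: wt_hsum_0 sums_iff)

theorem mock_psi_hecke:
  "mock_psi q = hecke (\<lambda>N. hcoef (N + 1)) * (qpoch_inf (- q) q / qpoch_inf q q)"
proof -
  \<comment> \<open>By \<open>hsum_1\<close> the offset 1 contributes q^(n+1), which is the quotient
    of the numerators of \<psi> and \<phi>.\<close>
  have "wt n * hsum (int n) 1 = q ^ ((n + 2) choose 2) / qpoch q (q\<^sup>2) (n + 1)" for n
  proof -
    have "q powi (int n + 1) = q ^ (n + 1)"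
      using power_int_of_nat[of q "n + 1"] by (simp only: of_nat_add of_nat_1)
    moreover have "(n + 2) choose 2 = ((n + 1) choose 2) + (n + 1)"
      by (simp add: numeral_2_eq_2)
    ultimately have "wt n * hsum (int n) 1 = q ^ (n + 1) * (wt n * hsum (int n) 0)"
      by (simp add: hsum_1 mult_ac)
    then show ?thesis
      unfolding wt_hsum_0 \<open>(n + 2) choose 2 = ((n + 1) choose 2) + (n + 1)\<close>
      by (simp add: power_add mult_ac)
  qed
  then show ?thesis
    unfolding mock_psi_def using has_sum_imp_sums[OF infsum_wt_hsum[of 1]] by (simp add: sums_iff)
qed

end

section \<open>The Jacobi triple product\<close>

context nome
begin

text \<open>At most exponential growth in |N|, which a Gaussian factor always beats. The instances
  needed are z^N and N.\<close>

definition moderate :: "(int \<Rightarrow> complex) \<Rightarrow> bool" where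
  "moderate g \<longleftrightarrow> (\<exists>A\<ge>0. \<exists>L\<ge>0. \<forall>N. norm (g N) \<le> A * norm q powi (- (L * \<bar>N\<bar>)))"

lemma moderate_powi:
  assumes "z \<noteq> 0"
  shows "moderate (\<lambda>N. z powi N)"
proof -
  obtain L where L: "norm q ^ L < min (norm z) (1 / norm z)"
    using real_arch_pow_inv[of "min (norm z) (1 / norm z)" "norm q"] assms q_lt1 by auto
  have pos: "0 < norm q ^ L"
    using norm_q_pos by simp
  have "norm (z powi N) \<le> 1 * norm q powi (- (int L * \<bar>N\<bar>))" for N
  proof -
    have eq: "norm q powi (- (int L * int n)) = (1 / norm q ^ L) ^ n" for n
      by (simp add: power_int_minus_divide power_mult power_one_over flip: of_nat_mult)
    have "norm z \<le> 1 / norm q ^ L" "1 / norm z \<le> 1 / norm q ^ L"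
      using L pos assms by (simp_all add: field_simps)
    then have "norm z ^ n \<le> norm q powi (- (int L * int n))"
      "(1 / norm z) ^ n \<le> norm q powi (- (int L * int n))" for n
      unfolding eq by (simp_all only: power_mono norm_ge_zero zero_le_divide_1_iff)
    then show ?thesis
      by (cases N rule: int_cases2)
         (auto simp: norm_divide norm_power norm_power_int power_int_minus_divide power_one_over)
  qed
  then show ?thesis
    unfolding moderate_def by (intro exI[of _ 1] conjI exI[of _ "int L"]) auto
qed

lemma moderate_of_int: "moderate of_int"
proof -
  have "(\<lambda>n. of_nat n * norm q ^ n) \<longlonglongrightarrow> 0"
    by (rule powser_times_n_limit_0) (use q_lt1 in simp)
  then have "Bseq (\<lambda>n. of_nat n * norm q ^ n)"
    by (intro convergent_imp_Bseq convergentI)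
  then obtain A where A: "A > 0" "\<And>n. norm (of_nat n * norm q ^ n) \<le> A"
    by (auto simp: Bseq_def)
  have "norm (of_int N :: complex) \<le> A * norm q powi (- (1 * \<bar>N\<bar>))" for N
  proof -
    have "real (nat \<bar>N\<bar>) * norm q ^ nat \<bar>N\<bar> \<le> A"
      using A(2)[of "nat \<bar>N\<bar>"] by simp
    then have "real (nat \<bar>N\<bar>) \<le> A / norm q ^ nat \<bar>N\<bar>"
      using norm_q_pos by (simp add: field_simps)
    moreover have "norm q powi (- (1 * \<bar>N\<bar>)) = 1 / norm q ^ nat \<bar>N\<bar>"
      by (simp add: power_int_def power_one_over[symmetric] inverse_eq_divide)
    ultimately show ?thesis
      by simp
  qed
  then show ?thesis
    unfolding moderate_def using A(1) by (intro exI[of _ A] conjI exI[of _ 1]) auto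
qed

lemma summable_tri_diff:
  assumes "L \<ge> 0"
  shows "(\<lambda>N. norm q powi (tri N - L * \<bar>N\<bar>)) summable_on UNIV"
proof -
  have "(\<lambda>N. norm (norm q powi (tri N - L * \<bar>N\<bar>))) summable_on UNIV"
  proof (rule abs_summable_gauss[OF norm_q_pos q_lt1, of 1])
    show "\<bar>N\<bar> \<le> tri N - L * \<bar>N\<bar> + (L + 1) * (L + 1 + 1)" for N
      using tri_ge[of "L + 1" N] assms by (simp add: algebra_simps)
  qed (simp_all add: norm_power_int)
  then show ?thesis
    by (simp add: norm_power_int)
qed

lemma jcoef_LIMSEQ:
  "(\<lambda>n. jcoef (int n) N) \<longlonglongrightarrow> (- 1) powi N * q powi tri N / (qpoch_inf q q)\<^sup>2"
proof -
  have "(\<lambda>n. (- 1) powi N * q powi tri N * invq (int n + - N) * invq (int n + (N + 1)))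
      \<longlonglongrightarrow> (- 1) powi N * q powi tri N * (1 / qpoch_inf q q) * (1 / qpoch_inf q q)"
    by (intro tendsto_mult tendsto_const invq_LIMSEQ)
  then show ?thesis
    by (simp add: jcoef_def power2_eq_square add.assoc)
qed

lemma jcoef_tannery:
  assumes "moderate g"
  shows "(\<lambda>n. \<Sum>\<^sub>\<infinity>N. jcoef (int n) N * g N) \<longlonglongrightarrow>
    (\<Sum>\<^sub>\<infinity>N. (- 1) powi N * q powi tri N * g N) / (qpoch_inf q q)\<^sup>2"
proof -
  obtain A L where AL: "A \<ge> 0" "L \<ge> 0" "\<And>N. norm (g N) \<le> A * norm q powi (- (L * \<bar>N\<bar>))"
    using assms by (auto simp: moderate_def)
  obtain C where C: "C > 0" "\<And>n N. norm (jcoef n N) \<le> C * norm q powi tri N"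
    using jcoef_bound by blast
  have "(\<lambda>n. \<Sum>\<^sub>\<infinity>N. jcoef (int n) N * g N) \<longlonglongrightarrow>
      (\<Sum>\<^sub>\<infinity>N. (- 1) powi N * q powi tri N / (qpoch_inf q q)\<^sup>2 * g N)"
  proof (rule infsum_tannery)
    show "(\<lambda>N. (C * A) * norm q powi (tri N - L * \<bar>N\<bar>)) summable_on UNIV"
      by (intro summable_on_cmult_right summable_tri_diff AL)
    show "norm (jcoef (int n) N * g N) \<le> (C * A) * norm q powi (tri N - L * \<bar>N\<bar>)" for n N
    proof -
      have "norm (jcoef (int n) N) * norm (g N) \<le>
          (C * norm q powi tri N) * (A * norm q powi (- (L * \<bar>N\<bar>)))"
        using AL C by (intro mult_mono) auto
      also have "\<dots> = (C * A) * norm q powi (tri N + - (L * \<bar>N\<bar>))"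
        using norm_q_pos by (subst power_int_add) auto
      finally show ?thesis
        by (simp add: norm_mult)
    qed
    show "(\<lambda>n. jcoef (int n) N * g N) \<longlonglongrightarrow>
        (- 1) powi N * q powi tri N / (qpoch_inf q q)\<^sup>2 * g N" for N
      by (intro tendsto_mult tendsto_const jcoef_LIMSEQ)
  qed
  also have "(\<Sum>\<^sub>\<infinity>N. (- 1) powi N * q powi tri N / (qpoch_inf q q)\<^sup>2 * g N) =
      (\<Sum>\<^sub>\<infinity>N. (- 1) powi N * q powi tri N * g N) / (qpoch_inf q q)\<^sup>2"
    unfolding divide_inverse infsum_cmult_left'[symmetric] by (intro infsum_cong) (simp add: mult_ac)
  finally show ?thesis .
qed

lemma jcoef_eq_0: "N \<notin> {- n - 1..n} \<Longrightarrow> jcoef n N = 0"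
  by (auto simp: jcoef_def invq_def)

lemma jcoef_summable: "(\<lambda>N. jcoef n (N + k) * g N) summable_on UNIV"
proof (rule finite_nonzero_values_imp_summable_on)
  have "{N \<in> UNIV. jcoef n (N + k) * g N \<noteq> 0} \<subseteq> {- n - 1 - k..n - k}"
    using jcoef_eq_0[of "_ + k" n] by force
  then show "finite {N \<in> UNIV. jcoef n (N + k) * g N \<noteq> 0}"
    by (rule finite_subset) simp
qed

text \<open>\<open>jcoef_rec\<close> with the index shifts moved to the test sequence
  \<open>g\<close>. For g(N) = z^N it is the recursion of the finite product, for g(N) = N that of
  its derivative at z = 1.\<close>

lemma infsum_jcoef_rec:
  "(1 - q powi (2 * n)) * (1 - q powi (2 * n + 1)) * (\<Sum>\<^sub>\<infinity>N. jcoef n N * g N) =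
   (1 + q powi (2 * n)) * (\<Sum>\<^sub>\<infinity>N. jcoef (n - 1) N * g N)
     - q powi n * ((\<Sum>\<^sub>\<infinity>N. jcoef (n - 1) N * g (N - 1)) + (\<Sum>\<^sub>\<infinity>N. jcoef (n - 1) N * g (N + 1)))"
proof -
  define f where "f k = (\<lambda>N. jcoef (n - 1) (N + k) * g N)" for k
  have f: "(f k has_sum (\<Sum>\<^sub>\<infinity>N. jcoef (n - 1) N * g (N - k))) UNIV" for k
  proof -
    have "infsum (f k) UNIV = (\<Sum>\<^sub>\<infinity>N. jcoef (n - 1) N * g (N - k))"
      unfolding f_def by (rule infsum_reindex_bij_witness[of _ "\<lambda>N. N - k" "\<lambda>N. N + k"]) auto
    then show ?thesis
      using jcoef_summable[of "n - 1" k g] by (simp add: has_sum_iff f_def)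
  qed
  have "((\<lambda>N. (1 - q powi (2 * n)) * (1 - q powi (2 * n + 1)) * (jcoef n N * g N)) has_sum
      (1 + q powi (2 * n)) * (\<Sum>\<^sub>\<infinity>N. jcoef (n - 1) N * g (N - 0))
      + (- (q powi n)) * ((\<Sum>\<^sub>\<infinity>N. jcoef (n - 1) N * g (N - 1)) + (\<Sum>\<^sub>\<infinity>N. jcoef (n - 1) N * g (N - (- 1))))) UNIV"
  proof (subst has_sum_cong)
    show "(1 - q powi (2 * n)) * (1 - q powi (2 * n + 1)) * (jcoef n N * g N) =
        (1 + q powi (2 * n)) * f 0 N + (- (q powi n)) * (f 1 N + f (- 1) N)" for N
      using arg_cong[OF jcoef_rec[of n N], of "\<lambda>y. y * g N"]
      by (simp add: f_def left_diff_distrib distrib_left distrib_right mult.assoc)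
  qed (intro has_sum_add has_sum_cmult_right f)
  then have "(\<Sum>\<^sub>\<infinity>N. (1 - q powi (2 * n)) * (1 - q powi (2 * n + 1)) * (jcoef n N * g N)) =
      (1 + q powi (2 * n)) * (\<Sum>\<^sub>\<infinity>N. jcoef (n - 1) N * g (N - 0))
      + (- (q powi n)) * ((\<Sum>\<^sub>\<infinity>N. jcoef (n - 1) N * g (N - 1)) + (\<Sum>\<^sub>\<infinity>N. jcoef (n - 1) N * g (N - (- 1))))"
    by (rule infsumI)
  then show ?thesis
    by (simp only: infsum_cmult_right' diff_0_right diff_minus_eq_add mult_minus_left
        add_uminus_conv_diff)
qed

lemma infsum_jcoef_0: "(\<Sum>\<^sub>\<infinity>N. jcoef 0 N * g N) = (g 0 - g (- 1)) / (1 - q)"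
proof -
  have "(\<Sum>\<^sub>\<infinity>N. jcoef 0 N * g N) = (\<Sum>\<^sub>\<infinity>N\<in>{- 1, 0}. jcoef 0 N * g N)"
    by (rule infsum_cong_neutral) (auto simp: jcoef_eq_0)
  then show ?thesis
    by (simp add: jcoef_def invq_def tri_def qpoch_def diff_divide_distrib)
qed

lemma q_powi_Suc: "q powi int (Suc n) = q ^ n * q"
  unfolding power_int_of_nat by simp

text \<open>First the finite version \<open>f_eq\<close>, from the recursion factor (1 - Q z)(1 - Q
  / z) and the initial value 1 - 1/z; then n tends to infinity.\<close>

theorem jacobi_triple_product:
  assumes "z \<noteq> 0"
  shows "(\<Sum>\<^sub>\<infinity>N. (- 1) powi N * q powi tri N * z powi N) =
    qpoch_inf (z * q) q * qpoch_inf (1 / z) q * qpoch_inf q q"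
proof -
  define f where "f n = (\<Sum>\<^sub>\<infinity>N. jcoef (int n) N * z powi N)" for n
  have "f n * qpoch q q (2 * n + 1) = (1 - q) * f 0 * (\<Prod>i<n. (1 - q ^ i * (z * q)) * (1 - q ^ Suc i * (1 / z)))" for n
  proof (rule jrec_solve)
    fix n
    define Q where "Q = q ^ n * q"
    have pred: "int (Suc n) - 1 = int n"
      by simp
    have Q2: "q powi (2 * int (Suc n)) = Q\<^sup>2"
      by (simp only: mult_2 q_powi_add q_powi_Suc Q_def power2_eq_square)
    have 1: "(\<Sum>\<^sub>\<infinity>N. jcoef (int n) N * z powi (N - 1)) = f n * (1 / z)"
      "(\<Sum>\<^sub>\<infinity>N. jcoef (int n) N * z powi (N + 1)) = f n * z"
      unfolding f_def infsum_cmult_left'[symmetric]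
      by (intro infsum_cong; use assms in \<open>simp add: power_int_diff power_int_add\<close>)+
    have "(1 - q powi (2 * int (Suc n))) * (1 - q powi (2 * int (Suc n) + 1)) * f (Suc n) =
        (1 + Q\<^sup>2) * f n - Q * (f n * (1 / z) + f n * z)"
      using infsum_jcoef_rec[of "int (Suc n)" "\<lambda>N. z powi N", unfolded pred Q2 q_powi_Suc, folded Q_def] 1
      by (simp only: f_def Q2)
    also have "\<dots> = (1 - Q * z) * (1 - Q * (1 / z)) * f n"
      using assms by (simp add: field_simps power2_eq_square)
    finally show "(1 - q powi (2 * int (Suc n))) * (1 - q powi (2 * int (Suc n) + 1)) * f (Suc n) =
        (1 - q ^ n * (z * q)) * (1 - q ^ Suc n * (1 / z)) * f n"
      by (simp add: Q_def mult_ac)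
  qed
  moreover have "(1 - q) * f 0 * (\<Prod>i<n. (1 - q ^ i * (z * q)) * (1 - q ^ Suc i * (1 / z))) =
      qpoch (z * q) q n * qpoch (1 / z) q (Suc n)" for n
  proof -
    have "q \<noteq> 1"
      using q_lt1 by auto
    then have "(1 - q) * f 0 = 1 - 1 / z"
      by (simp add: f_def infsum_jcoef_0 power_int_minus_divide)
    then show ?thesis
      by (simp add: qpoch_def prod.distrib prod.lessThan_Suc_shift del: prod.lessThan_Suc)
  qed
  ultimately have f_eq: "f n * qpoch q q (2 * n + 1) = qpoch (z * q) q n * qpoch (1 / z) q (Suc n)" for n
    by simp
  have "f \<longlonglongrightarrow> (\<Sum>\<^sub>\<infinity>N. (- 1) powi N * q powi tri N * z powi N) / (qpoch_inf q q)\<^sup>2"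
    unfolding f_def by (rule jcoef_tannery[OF moderate_powi[OF assms]])
  then have "(\<lambda>n. f n * qpoch q q (2 * n + 1)) \<longlonglongrightarrow>
      (\<Sum>\<^sub>\<infinity>N. (- 1) powi N * q powi tri N * z powi N) / (qpoch_inf q q)\<^sup>2 * qpoch_inf q q"
    by (intro tendsto_mult qpoch_LIMSEQ_subseq q_lt1) (simp_all add: strict_mono_def)
  moreover have "(\<lambda>n. qpoch (z * q) q n * qpoch (1 / z) q (Suc n)) \<longlonglongrightarrow>
      qpoch_inf (z * q) q * qpoch_inf (1 / z) q"
    by (intro tendsto_mult qpoch_LIMSEQ qpoch_LIMSEQ_subseq q_lt1) (simp_all add: strict_mono_def)
  ultimately have "(\<Sum>\<^sub>\<infinity>N. (- 1) powi N * q powi tri N * z powi N) / (qpoch_inf q q)\<^sup>2 * qpoch_inf q q =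
      qpoch_inf (z * q) q * qpoch_inf (1 / z) q"
    unfolding f_eq by (rule LIMSEQ_unique)
  then show ?thesis
    using qpoch_inf_nonzero[OF q_lt1 q_lt1] by (simp add: field_simps power2_eq_square)
qed

text \<open>The derivative of the triple product at its zero z = 1. As the coefficients sum to 0,
  the weights N - 1, N and N + 1 give equal sums, so the recursion factor is 1 + Q^2 - 2 Q = (1 -
  Q)^2.\<close>

theorem jacobi_cube:
  "(\<Sum>\<^sub>\<infinity>N. (- 1) powi N * q powi tri N * of_int N) = (qpoch_inf q q) ^ 3"
proof -
  define f where "f n = (\<Sum>\<^sub>\<infinity>N. jcoef (int n) N * of_int N)" for n
  have "f n * qpoch q q (2 * n + 1) = (1 - q) * f 0 * (\<Prod>i<n. (1 - q ^ i * q)\<^sup>2)" for n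
  proof (rule jrec_solve)
    fix n
    define Q where "Q = q ^ n * q"
    have pred: "int (Suc n) - 1 = int n"
      by simp
    have Q2: "q powi (2 * int (Suc n)) = Q\<^sup>2"
      by (simp only: mult_2 q_powi_add q_powi_Suc Q_def power2_eq_square)
    have sum: "(\<lambda>N. jcoef (int n) N * g N) summable_on UNIV" for g
      using jcoef_summable[of "int n" 0 g] by simp
    have zero: "(\<Sum>\<^sub>\<infinity>N. jcoef (int n) N) = 0"
      using infsum_jcoef[of "int n" 0] by simp
    have "(\<Sum>\<^sub>\<infinity>N. jcoef (int n) N * of_int N + c * (jcoef (int n) N * 1)) = f n" for c
      using sum[of "\<lambda>_. 1"] by (subst infsum_add) (simp_all add: sum summable_on_cmult_right infsum_cmult_right' zero f_def)
    from this[of 1] this[of "- 1"]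
    have 1: "(\<Sum>\<^sub>\<infinity>N. jcoef (int n) N * of_int (N - 1)) = f n"
      "(\<Sum>\<^sub>\<infinity>N. jcoef (int n) N * of_int (N + 1)) = f n"
      by (simp_all add: algebra_simps)
    have "(1 - q powi (2 * int (Suc n))) * (1 - q powi (2 * int (Suc n) + 1)) * f (Suc n) =
        (1 + Q\<^sup>2) * f n - Q * (f n + f n)"
      using infsum_jcoef_rec[of "int (Suc n)" "of_int", unfolded pred Q2 q_powi_Suc, folded Q_def] 1
      by (simp only: f_def Q2)
    also have "\<dots> = (1 - Q)\<^sup>2 * f n"
      by (simp add: power2_eq_square algebra_simps)
    finally show "(1 - q powi (2 * int (Suc n))) * (1 - q powi (2 * int (Suc n) + 1)) * f (Suc n) =
        (1 - q ^ n * q)\<^sup>2 * f n"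
      by (simp only: Q_def)
  qed
  moreover have "q \<noteq> 1"
    using q_lt1 by auto
  ultimately have f_eq: "f n * qpoch q q (2 * n + 1) = (qpoch q q n)\<^sup>2" for n
    by (simp add: f_def infsum_jcoef_0 qpoch_def prod_power_distrib)
  have "f \<longlonglongrightarrow> (\<Sum>\<^sub>\<infinity>N. (- 1) powi N * q powi tri N * of_int N) / (qpoch_inf q q)\<^sup>2"
    unfolding f_def by (rule jcoef_tannery[OF moderate_of_int])
  then have "(\<lambda>n. f n * qpoch q q (2 * n + 1)) \<longlonglongrightarrow>
      (\<Sum>\<^sub>\<infinity>N. (- 1) powi N * q powi tri N * of_int N) / (qpoch_inf q q)\<^sup>2 * qpoch_inf q q"
    by (intro tendsto_mult qpoch_LIMSEQ_subseq q_lt1) (simp_all add: strict_mono_def)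
  moreover have "(\<lambda>n. (qpoch q q n)\<^sup>2) \<longlonglongrightarrow> (qpoch_inf q q)\<^sup>2"
    by (intro tendsto_power qpoch_LIMSEQ q_lt1)
  ultimately have "(\<Sum>\<^sub>\<infinity>N. (- 1) powi N * q powi tri N * of_int N) / (qpoch_inf q q)\<^sup>2 * qpoch_inf q q =
      (qpoch_inf q q)\<^sup>2"
    unfolding f_eq by (rule LIMSEQ_unique)
  then show ?thesis
    using qpoch_inf_nonzero[OF q_lt1 q_lt1] by (simp add: field_simps power2_eq_square power3_eq_cube)
qed

lemma jtheta_eq_infsum:
  assumes "x \<noteq> 0"
  shows "jtheta x q = (\<Sum>\<^sub>\<infinity>N. (- 1) powi N * q powi tri N * x powi (- N))"
proof -
  have "jtheta x q = (\<Sum>\<^sub>\<infinity>N. (- 1) powi N * q powi tri N * (1 / x) powi N)"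
    using assms by (subst jacobi_triple_product) (simp_all add: jtheta_def mult_ac)
  then show ?thesis
    by (simp add: power_int_minus_divide power_int_divide_distrib)
qed

end

section \<open>Kronecker's series\<close>

text \<open>On the line r + s = N the weight is 1 for 0 \<le> r \<le> N and -1 for N < r < 0, which
  makes this an oriented telescoping sum. The induction runs both ways from N = -1, where the line
  carries no weight.\<close>

lemma sgn2_telescope:
  fixes g :: "int \<Rightarrow> complex"
  shows "((\<lambda>r. sgn2 r (N - r) * (g (r + 1) - g r)) has_sum (g (N + 1) - g 0)) UNIV"
proof (induction N rule: int_induct[where k = "- 1"])
  case base
  have "sgn2 r (- 1 - r) = 0" for r
    by (simp add: sgn2_def)
  then show ?case
    by simp
next
  case (step1 N)
  have "((\<lambda>r. if r = N + 1 then g (r + 1) - g r else 0) has_sum (g (N + 1 + 1) - g (N + 1))) UNIV"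
    by (rule has_sum_finite_neutralI[of "{N + 1}"]) auto
  from has_sum_add[OF step1.IH this] show ?case
    by (rule back_subst[where P = "\<lambda>f. (f has_sum _) UNIV", THEN back_subst[where P = "\<lambda>y. (_ has_sum y) UNIV"]])
       (auto simp: sgn2_def fun_eq_iff)
next
  case (step2 N)
  have "((\<lambda>r. if r = N then - (g (r + 1) - g r) else 0) has_sum (- (g (N + 1) - g N))) UNIV"
    by (rule has_sum_finite_neutralI[of "{N}"]) auto
  from has_sum_add[OF step2.IH this] show ?case
    by (rule back_subst[where P = "\<lambda>f. (f has_sum _) UNIV", THEN back_subst[where P = "\<lambda>y. (_ has_sum y) UNIV"]])
       (auto simp: sgn2_def fun_eq_iff)
qed

lemma infsum_product:
  fixes f :: "'a \<Rightarrow> complex" and g :: "'b \<Rightarrow> complex"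
  assumes "(\<lambda>(x, y). f x * g y) summable_on UNIV"
  shows "(\<Sum>\<^sub>\<infinity>(x, y). f x * g y) = (\<Sum>\<^sub>\<infinity>x. f x) * (\<Sum>\<^sub>\<infinity>y. g y)"
proof -
  have "(\<Sum>\<^sub>\<infinity>(x, y)\<in>UNIV \<times> UNIV. f x * g y) = (\<Sum>\<^sub>\<infinity>x. \<Sum>\<^sub>\<infinity>y. f x * g y)"
    by (rule infsum_Sigma'_banach[symmetric]) (use assms in simp)
  then show ?thesis
    by (simp add: infsum_cmult_right' infsum_cmult_left')
qed

context nome
begin

definition theta_term :: "int \<Rightarrow> complex" where
  "theta_term n = (- 1) powi n * q powi tri n"

text \<open>Coefficients of a theta function of nome q^2. The shift to m + 1 moves the symmetry
  centre of the convolution with \<open>theta_term\<close> to -3/2, which is the centre of r^2 +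
  3r.\<close>

definition square_term :: "int \<Rightarrow> complex" where
  "square_term m = (- 1) powi m * q powi (m + 1)\<^sup>2"

definition conv_term :: "int \<Rightarrow> complex" where
  "conv_term r = (\<Sum>\<^sub>\<infinity>m. square_term m * theta_term (r - m))"

lemma norm_minus_one_powi [simp]: "norm ((- 1 :: complex) powi n) = 1"
  by (simp add: norm_power_int)

lemma theta_term_mult_summable:
  assumes "moderate g"
  shows "(\<lambda>n. norm (theta_term n * g n)) summable_on UNIV"
proof -
  obtain A L where AL: "A \<ge> 0" "L \<ge> 0" "\<And>N. norm (g N) \<le> A * norm q powi (- (L * \<bar>N\<bar>))"
    using assms by (auto simp: moderate_def)
  show ?thesis
  proof (rule Infinite_Sum.abs_summable_on_comparison_test')
    show "(\<lambda>N. A * norm q powi (tri N - L * \<bar>N\<bar>)) summable_on UNIV"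
      by (intro summable_on_cmult_right summable_tri_diff AL)
    show "norm (theta_term N * g N) \<le> A * norm q powi (tri N - L * \<bar>N\<bar>)" for N
    proof -
      have "norm q powi tri N * norm (g N) \<le> norm q powi tri N * (A * norm q powi (- (L * \<bar>N\<bar>)))"
        using AL by (intro mult_left_mono) auto
      also have "\<dots> = A * norm q powi (tri N + - (L * \<bar>N\<bar>))"
        using norm_q_pos by (subst power_int_add) auto
      finally show ?thesis
        by (simp add: theta_term_def norm_mult norm_power_int)
    qed
  qed
qed

lemma theta_term_summable: "(\<lambda>n. norm (theta_term n)) summable_on UNIV"
  using theta_term_mult_summable[OF moderate_powi[of 1]] by simp

lemma square_term_summable: "(\<lambda>n. norm (square_term n)) summable_on UNIV"
proof (rule abs_summable_gauss[OF norm_q_pos q_lt1, of 1])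
  show "norm (square_term n) \<le> 1 * norm q powi (n + 1)\<^sup>2" for n
    by (simp add: square_term_def norm_mult norm_power_int)
  show "\<bar>n\<bar> \<le> (n + 1)\<^sup>2 + 1" for n :: int
  proof -
    have "\<bar>n + 1\<bar> \<le> (n + 1)\<^sup>2"
      by (metis abs_ge_zero abs_le_square_iff abs_zero power2_abs self_le_power zero_less_numeral
          int_one_le_iff_zero_less order_le_less power_zero_numeral zero_power2)
    then show ?thesis
      by linarith
  qed
qed simp

lemma conv_pair_summable:
  "(\<lambda>(r, m). norm (square_term m) * norm (theta_term (r - m))) summable_on UNIV"
proof -
  have "(\<lambda>(m, n). norm (square_term m) * norm (theta_term n)) summable_on UNIV"
    by (intro summable_on_product_real square_term_summable theta_term_summable) auto
  then show ?thesis
    by (rule summable_on_reindex_bij_witness[of _ "\<lambda>(m, n). (m + n, m)" "\<lambda>(r, m). (m, r - m)", THEN iffD2, rotated -1])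
       auto
qed

text \<open>The fourfold summand behind the double sum over
  \<open>conv_term r * conv_term s\<close>; its absolute summability lets the pairs (r, s) and (m,
  l) trade places.\<close>

definition quad_term :: "int \<times> int \<Rightarrow> int \<times> int \<Rightarrow> complex" where
  "quad_term = (\<lambda>(r, s) (m, l). sgn2 r s * q powi (r * s) *
     ((square_term m * theta_term (r - m)) * (square_term l * theta_term (s - l))))"

lemma norm_sgn2_powi_le: "norm (sgn2 r s * q powi (r * s)) \<le> 1"
proof (cases "sgn2 r s = 0")
  case False
  then have "norm q powi (r * s) \<le> 1"
    using powi_mono_exp[OF norm_q_pos q_lt1, of 0 "r * s"] sgn2_nonzeroD[of r s] by simp
  then have "norm (sgn2 r s) * norm q powi (r * s) \<le> 1 * 1"
    by (intro mult_mono norm_sgn2_le) auto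
  then show ?thesis
    by (simp add: norm_mult norm_power_int)
qed simp

lemma quad_term_summable: "(\<lambda>(x, y). quad_term x y) summable_on UNIV"
proof (rule abs_summable_summable, rule Infinite_Sum.abs_summable_on_comparison_test')
  define a where "a = (\<lambda>(r, m). norm (square_term m) * norm (theta_term (r - m)))"
  have "(\<lambda>(x, y). a x * a y) summable_on UNIV"
    using conv_pair_summable by (intro summable_on_product_real) (auto simp: a_def)
  then show "(\<lambda>((r, s), (m, l)). a (r, m) * a (s, l)) summable_on UNIV"
    by (rule summable_on_reindex_bij_witness[of _ "\<lambda>((r, m), (s, l)). ((r, s), (m, l))"
          "\<lambda>((r, s), (m, l)). ((r, m), (s, l))", THEN iffD2, rotated -1]) auto
  show "norm (case z of (x, y) \<Rightarrow> quad_term x y) \<le> (\<lambda>((r, s), (m, l)). a (r, m) * a (s, l)) z" for z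
  proof -
    obtain r s m l where z: "z = ((r, s), (m, l))"
      by (metis surj_pair)
    have "norm (sgn2 r s * q powi (r * s)) * (a (r, m) * a (s, l)) \<le> 1 * (a (r, m) * a (s, l))"
      by (intro mult_right_mono norm_sgn2_powi_le) (simp add: a_def)
    then show ?thesis
      by (simp add: z quad_term_def a_def norm_mult)
  qed
qed

lemma infsum_quad_term_right:
  "(\<Sum>\<^sub>\<infinity>y. quad_term (r, s) y) = sgn2 r s * q powi (r * s) * (conv_term r * conv_term s)"
proof -
  have conv: "(\<lambda>m. norm (square_term m * theta_term (r - m))) summable_on UNIV" for r
  proof -
    have "(\<lambda>(r, m). norm (square_term m) * norm (theta_term (r - m))) summable_on (SIGMA r:UNIV. UNIV)"
      using conv_pair_summable by simp
    from summable_on_SigmaD1[OF this, of r] show ?thesis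
      by (simp add: norm_mult)
  qed
  have "(\<lambda>(m, l). (square_term m * theta_term (r - m)) * (square_term l * theta_term (s - l))) summable_on UNIV"
    by (rule abs_summable_summable)
       (use summable_on_product_real[OF conv[of r] conv[of s]] in \<open>simp add: norm_mult case_prod_unfold\<close>)
  from infsum_product[OF this] show ?thesis
    unfolding conv_term_def infsum_cmult_right'[symmetric, of "sgn2 r s * q powi (r * s)"]
    by (simp add: quad_term_def case_prod_unfold infsum_cmult_right')
qed

section \<open>Value and derivative of the theta series at its zeros\<close>

lemma tri_shift_identity: "tri N - m * N = tri (N - m) - tri (- m)"
  using tri_add[of N "- m"] by (simp add: algebra_simps)

text \<open>Quasi-periodicity of the theta series, seen on its coefficients; it carries statements
  at q^m back to m = 0.\<close>

lemma theta_term_shift: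
  "theta_term N * q powi (- (m * N)) = (- 1) powi m * q powi (- tri (- m)) * theta_term (N - m)"
proof -
  have "tri N + - (m * N) = - tri (- m) + tri (N - m)"
    using tri_shift_identity[of N m] by linarith
  then have "q powi tri N * q powi (- (m * N)) = q powi (- tri (- m)) * q powi tri (N - m)"
    by (simp only: q_powi_add[symmetric])
  moreover have "(- 1 :: complex) powi N = (- 1) powi m * (- 1) powi (N - m)"
    by (simp add: power_int_add[symmetric])
  ultimately show ?thesis
    by (simp add: theta_term_def mult_ac)
qed

lemma theta_term_sum: "(\<Sum>\<^sub>\<infinity>N. theta_term N) = 0"
proof -
  have "(\<Sum>\<^sub>\<infinity>N. theta_term N) = (\<Sum>\<^sub>\<infinity>N. - theta_term N)"
  proof (rule infsum_reindex_bij_witness[of _ "\<lambda>N. - 1 - N" "\<lambda>N. - 1 - N"])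
    have "(- 1) powi (- 1 - N) = - ((- 1 :: complex) powi N)" for N
      by (cases "even N") (simp_all add: power_int_minus_one_diff_commute)
    then show "- theta_term (- 1 - N) = theta_term N" for N
      by (simp add: theta_term_def tri_reflect)
  qed auto
  then show ?thesis
    by (simp add: infsum_uminus)
qed

lemma theta_term_sum_zero:
  "(\<Sum>\<^sub>\<infinity>N. theta_term N * q powi (- (m * N))) = 0"
  unfolding theta_term_shift infsum_cmult_right'
  using infsum_int_shift[of theta_term "- m"] theta_term_sum by simp

text \<open>After the shift by m the weight is N + (m + 1): the constant part is killed by
  \<open>theta_term_sum\<close>, the linear part is \<open>jacobi_cube\<close>.\<close>

lemma theta_term_sum_deriv:
  "(\<Sum>\<^sub>\<infinity>N. theta_term N * q powi (- (m * N)) * of_int (N + 1)) =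
   (- 1) powi m * q powi (- tri (- m)) * qpoch_inf q q ^ 3"
proof -
  have sum1: "(\<lambda>N. theta_term N * of_int N) summable_on UNIV"
    by (rule abs_summable_summable[OF theta_term_mult_summable[OF moderate_of_int]])
  have sum2: "theta_term summable_on UNIV"
    by (rule abs_summable_summable[OF theta_term_summable])
  have "(\<Sum>\<^sub>\<infinity>N. theta_term N * q powi (- (m * N)) * of_int (N + 1)) =
      (\<Sum>\<^sub>\<infinity>N. (- 1) powi m * q powi (- tri (- m)) * (theta_term (N + - m) * of_int ((N + - m) + (m + 1))))"
    unfolding theta_term_shift by (simp add: mult.assoc)
  also have "\<dots> = (- 1) powi m * q powi (- tri (- m)) * (\<Sum>\<^sub>\<infinity>N. theta_term N * of_int (N + (m + 1)))"
    unfolding infsum_cmult_right'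
    using infsum_int_shift[of "\<lambda>N. theta_term N * of_int (N + (m + 1))" "- m"] by simp
  also have "(\<Sum>\<^sub>\<infinity>N. theta_term N * of_int (N + (m + 1))) =
      (\<Sum>\<^sub>\<infinity>N. theta_term N * of_int N + of_int (m + 1) * theta_term N)"
    by (simp add: algebra_simps)
  also have "\<dots> = (\<Sum>\<^sub>\<infinity>N. theta_term N * of_int N)"
    by (simp add: infsum_add sum1 sum2 summable_on_cmult_right infsum_cmult_right' theta_term_sum)
  also have "\<dots> = qpoch_inf q q ^ 3"
    unfolding theta_term_def by (rule jacobi_cube)
  finally show ?thesis .
qed

text \<open>The sum is the coefficient of \<open>x\<^sup>m y\<^sup>l\<close> in \<open>j(x) j(y)\<close> times Kronecker's series
  \<open>\<Sum> sgn2 r s q\<^bsup>rs\<^esup> x\<^sup>r y\<^sup>s = J\<^sub>1\<^sup>3 j(xy) / (j(x) j(y))\<close>, up to the orientation of the exponents,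
  hence a coefficient of \<open>j(xy)\<close>, where \<open>j(x) = j(x; q)\<close>.\<close>

lemma kronecker_coeff:
  "(\<Sum>\<^sub>\<infinity>(r, s). sgn2 r s * q powi (r * s) * (theta_term (r - m) * theta_term (s - l))) =
   (if m = l then (- 1) powi m * q powi tri (- m) * qpoch_inf q q ^ 3 else 0)"
proof -
  define c where "c = (- 1) powi (m + l) * q powi (tri (- m) + tri (- l))"
  define f where "f = (\<lambda>(r, s). sgn2 r s * q powi (r * s) * (theta_term (r - m) * theta_term (s - l)))"
  define h where "h N r = theta_term N * (sgn2 r (N - r) * (q powi (- (m * r)) * q powi (- (l * (N - r)))))" for N r
  \<comment> \<open>For fixed N = r + s the quadratic terms collect in \<open>theta_term N\<close>;
    the rest is geometric in r with ratio q^(l - m).\<close>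
  have f_eq: "f (r, s) = c * h (r + s) r" for r s
  proof -
    have "r * s + (tri (r - m) + tri (s - l)) =
        (tri (- m) + tri (- l)) + (tri (r + s) + (- (m * r) + - (l * s)))"
      using tri_add[of r s] tri_add[of r "- m"] tri_add[of s "- l"] by (simp add: algebra_simps)
    then have "q powi (r * s) * (q powi tri (r - m) * q powi tri (s - l)) =
        q powi (tri (- m) + tri (- l)) * (q powi tri (r + s) * (q powi (- (m * r)) * q powi (- (l * s))))"
      by (simp only: q_powi_add[symmetric])
    moreover have "(- 1 :: complex) powi (r - m) * (- 1) powi (s - l) = (- 1) powi (m + l) * (- 1) powi (r + s)"
    proof -
      have "(- 1 :: complex) powi (a - b) = (- 1) powi b * (- 1) powi a" for a b
        by (simp add: power_int_diff) (metis minus_one_mult_self mult.commute nonzero_eq_divide_eq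
            power_int_minus_one_mult_self' power_int_not_zero mult.assoc mult.left_neutral zero_neq_neg_one)
      then show ?thesis
        by (simp add: power_int_add mult_ac)
    qed
    ultimately show ?thesis
      unfolding f_def h_def c_def theta_term_def prod.case
      by (simp add: algebra_simps)
  qed
  have f_sum: "f summable_on UNIV"
  proof (rule abs_summable_summable, rule Infinite_Sum.abs_summable_on_comparison_test')
    have shift: "(\<lambda>n. norm (theta_term (n - k))) summable_on UNIV" for k
      using theta_term_summable
      by (rule summable_on_reindex_bij_witness[of _ "\<lambda>n. n + k" "\<lambda>n. n - k", THEN iffD2, rotated -1]) auto
    show "(\<lambda>(r, s). norm (theta_term (r - m)) * norm (theta_term (s - l))) summable_on UNIV"
      by (intro summable_on_product_real shift) auto
    show "norm (f z) \<le> (case z of (r, s) \<Rightarrow> norm (theta_term (r - m)) * norm (theta_term (s - l)))" for z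
    proof -
      obtain r s where z: "z = (r, s)"
        by (metis surj_pair)
      have "norm (sgn2 r s * q powi (r * s)) * norm (theta_term (r - m) * theta_term (s - l))
          \<le> 1 * norm (theta_term (r - m) * theta_term (s - l))"
        by (intro mult_right_mono norm_sgn2_powi_le) simp
      then show ?thesis
        by (simp add: z f_def norm_mult)
    qed
  qed
  have ch_sum: "(\<lambda>(N, r). c * h N r) summable_on UNIV \<times> UNIV"
    using f_sum
    by (rule summable_on_reindex_bij_witness[of _ "\<lambda>(r, s). (r + s, r)" "\<lambda>(N, r). (r, N - r)", THEN iffD2, rotated -1])
       (auto simp: f_eq)
  have "infsum f UNIV = (\<Sum>\<^sub>\<infinity>(N, r)\<in>UNIV \<times> UNIV. c * h N r)"
    by (rule infsum_reindex_bij_witness[of _ "\<lambda>(N, r). (r, N - r)" "\<lambda>(r, s). (r + s, r)"])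
       (auto simp: f_eq)
  also have "\<dots> = (\<Sum>\<^sub>\<infinity>N. \<Sum>\<^sub>\<infinity>r. c * h N r)"
    by (rule infsum_Sigma'_banach[symmetric, OF ch_sum])
  also have "\<dots> = c * (\<Sum>\<^sub>\<infinity>N. \<Sum>\<^sub>\<infinity>r. h N r)"
    by (simp only: infsum_cmult_right')
  finally have main: "infsum f UNIV = c * (\<Sum>\<^sub>\<infinity>N. \<Sum>\<^sub>\<infinity>r. h N r)" .
  show ?thesis
  \<comment> \<open>For m = l the inner sum over r is a power times the signed count N + 1, and the
    derivative at a zero appears. For m \<noteq> l it is a difference quotient of powers, and both
    parts sum to theta series at zeros.\<close>
  proof (cases "m = l")
    case True
    have "(\<Sum>\<^sub>\<infinity>r. h N r) = theta_term N * q powi (- (m * N)) * of_int (N + 1)" for N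
    proof -
      have "q powi (- (m * r)) * q powi (- (l * (N - r))) = q powi (- (m * N))" for r
        unfolding q_powi_add[symmetric] by (simp add: True algebra_simps)
      then have "(\<Sum>\<^sub>\<infinity>r. h N r) = theta_term N * q powi (- (m * N)) * (\<Sum>\<^sub>\<infinity>r. sgn2 r (N - r))"
        unfolding h_def infsum_cmult_right'[symmetric] by (simp add: mult_ac)
      also have "(\<Sum>\<^sub>\<infinity>r. sgn2 r (N - r)) = of_int (N + 1)"
        using infsumI[OF sgn2_telescope[of N of_int]] by simp
      finally show ?thesis .
    qed
    then have "infsum f UNIV = c * ((- 1) powi m * q powi (- tri (- m)) * qpoch_inf q q ^ 3)"
      by (simp only: main theta_term_sum_deriv)
    moreover have "c * ((- 1) powi m * q powi (- tri (- m))) = (- 1) powi m * q powi tri (- m)"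
    proof -
      have "c = q powi (tri (- m) + tri (- m))"
        by (simp add: c_def True)
      then have "c * q powi (- tri (- m)) = q powi (tri (- m) + tri (- m) + - tri (- m))"
        by (simp only: q_powi_add)
      then show ?thesis
        by (simp add: mult_ac)
    qed
    ultimately show ?thesis
      using True by (simp add: f_def mult.assoc)
  next
    case False
    define x where "x = q powi (- m)"
    define y where "y = q powi (- l)"
    have xy: "x \<noteq> 0" "y \<noteq> 0"
      using q_nz by (simp_all add: x_def y_def)
    have "x \<noteq> y"
    proof
      assume "x = y"
      then have "q powi (l - m) = 1"
        using q_nz by (simp add: x_def y_def power_int_diff power_int_minus)
      then show False
        using q_powi_ne_1[of "l - m"] False by simp
    qed
    have powx: "q powi (- (m * n)) = x powi n" and powy: "q powi (- (l * n)) = y powi n" for n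
      unfolding x_def y_def power_int_mult[symmetric] by simp_all
    have "(\<Sum>\<^sub>\<infinity>r. h N r) = theta_term N * q powi (- (m * N)) * (x / (x - y))
        + theta_term N * q powi (- (l * N)) * (- y / (x - y))" for N
    proof -
      define g where "g r = x powi r * y powi (N + 1 - r) / (x - y)" for r
      have "x powi r * y powi (N - r) = g (r + 1) - g r" for r
      proof -
        have "N + 1 - r = (N - r) + 1" "N + 1 - (r + 1) = N - r"
          by simp_all
        then have "g (r + 1) - g r = x powi r * y powi (N - r) * (x - y) / (x - y)"
          using xy unfolding g_def by (simp only: power_int_add_1 diff_divide_distrib[symmetric] simp_thms)
            (simp add: algebra_simps)
        then show ?thesis
          using \<open>x \<noteq> y\<close> by simp
      qed
      then have "(\<Sum>\<^sub>\<infinity>r. h N r) = theta_term N * (\<Sum>\<^sub>\<infinity>r. sgn2 r (N - r) * (g (r + 1) - g r))"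
        unfolding h_def powx powy infsum_cmult_right'[symmetric] by simp
      also have "\<dots> = theta_term N * (g (N + 1) - g 0)"
        using infsumI[OF sgn2_telescope[of N g]] by simp
      also have "g (N + 1) - g 0 = x powi N * (x / (x - y)) + y powi N * (- y / (x - y))"
        using xy by (simp add: g_def power_int_add)
      finally show ?thesis
        unfolding powx powy by (simp add: algebra_simps)
    qed
    moreover have "(\<Sum>\<^sub>\<infinity>N. theta_term N * q powi (- (m * N)) * (x / (x - y))
        + theta_term N * q powi (- (l * N)) * (- y / (x - y))) = 0"
    proof -
      have sum: "(\<lambda>N. theta_term N * q powi (- (k * N)) * a) summable_on UNIV" for k a
      proof -
        have "(\<lambda>N. theta_term N * (q powi (- k)) powi N) summable_on UNIV"
          by (rule abs_summable_summable[OF theta_term_mult_summable[OF moderate_powi]]) (use q_nz in simp)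
        then show ?thesis
          by (intro summable_on_cmult_left) (simp add: power_int_mult[symmetric])
      qed
      then show ?thesis
        by (simp only: infsum_add[OF sum sum] infsum_cmult_left' theta_term_sum_zero mult_zero_left add_0)
    qed
    ultimately show ?thesis
      using main False by (simp add: f_def)
  qed
qed

text \<open>Sum over (r, s) first: \<open>kronecker_coeff\<close> removes all terms with m \<noteq>
  l. On the diagonal, with N = -m - 1, the exponent 2(m + 1)^2 + tri(-m) is 1 + 5 tri(N) - N, a
  theta series of nome q^5.\<close>

theorem conv_term_double_sum:
  "(\<Sum>\<^sub>\<infinity>(r, s). sgn2 r s * q powi (r * s) * (conv_term r * conv_term s)) =
   - q * qpoch_inf q q ^ 3 * jtheta q (q ^ 5)"
proof -
  let ?D = "qpoch_inf q q ^ 3"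
  have "(\<Sum>\<^sub>\<infinity>(r, s). sgn2 r s * q powi (r * s) * (conv_term r * conv_term s)) =
      (\<Sum>\<^sub>\<infinity>x. \<Sum>\<^sub>\<infinity>y. quad_term x y)"
    by (intro infsum_cong) (auto simp: infsum_quad_term_right)
  also have "\<dots> = (\<Sum>\<^sub>\<infinity>y. \<Sum>\<^sub>\<infinity>x. quad_term x y)"
    by (rule infsum_swap_banach) (use quad_term_summable in simp)
  also have "\<dots> = (\<Sum>\<^sub>\<infinity>(m, l). square_term m * square_term l *
      (if m = l then (- 1) powi m * q powi tri (- m) * ?D else 0))"
  proof (intro infsum_cong, clarify)
    fix m l
    have "(\<Sum>\<^sub>\<infinity>x. quad_term x (m, l)) = square_term m * square_term l *
        (\<Sum>\<^sub>\<infinity>(r, s). sgn2 r s * q powi (r * s) * (theta_term (r - m) * theta_term (s - l)))"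
      unfolding infsum_cmult_right'[symmetric]
      by (intro infsum_cong) (auto simp: quad_term_def mult_ac)
    then show "(\<Sum>\<^sub>\<infinity>x. quad_term x (m, l)) = square_term m * square_term l *
        (if m = l then (- 1) powi m * q powi tri (- m) * ?D else 0)"
      by (simp only: kronecker_coeff)
  qed
  also have "\<dots> = (\<Sum>\<^sub>\<infinity>(m, l)\<in>range (\<lambda>m. (m, m)). square_term m * square_term l *
      (if m = l then (- 1) powi m * q powi tri (- m) * ?D else 0))"
    by (rule infsum_cong_neutral) auto
  also have "\<dots> = (\<Sum>\<^sub>\<infinity>N. - q * ?D * ((- 1) powi N * (q ^ 5) powi tri N * q powi (- N)))"
  proof (rule infsum_reindex_bij_witness[of _ "\<lambda>N. (- N - 1, - N - 1)" "\<lambda>(m, l). - m - 1"])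
    fix a :: "int \<times> int"
    assume "a \<in> range (\<lambda>m. (m, m))"
    then obtain m where a: "a = (m, m)"
      by auto
    define N where "N = - m - 1"
    have m: "m = - N - 1"
      by (simp add: N_def)
    have "tri (N + 1) = tri N + N + 1"
      by (simp add: tri_add) (simp add: tri_def)
    then have "(m + 1)\<^sup>2 + (m + 1)\<^sup>2 + tri (- m) = 1 + (5 * tri N + - N)"
      using two_tri[of N] by (simp add: m power2_eq_square algebra_simps)
    then have "q powi ((m + 1)\<^sup>2 + (m + 1)\<^sup>2 + tri (- m)) = q powi (1 + (5 * tri N + - N))"
      by (simp only:)
    then have "q powi (m + 1)\<^sup>2 * q powi (m + 1)\<^sup>2 * q powi tri (- m) = q * (q powi (5 * tri N) * q powi (- N))"
      by (simp only: q_powi_add power_int_1_right)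
    moreover have "q powi (5 * tri N) = (q ^ 5) powi tri N"
      by (simp add: power_int_mult)
    moreover have "(- 1 :: complex) powi m = - ((- 1) powi N)"
      unfolding m by (cases "even N") (simp_all add: power_int_minus_one_diff_commute)
    ultimately have key: "square_term m * square_term m * ((- 1) powi m * q powi tri (- m) * ?D) =
        - q * ?D * ((- 1) powi N * (q ^ 5) powi tri N * q powi (- N))"
    proof -
      assume 1: "q powi (m + 1)\<^sup>2 * q powi (m + 1)\<^sup>2 * q powi tri (- m) = q * (q powi (5 * tri N) * q powi (- N))"
        and 2: "q powi (5 * tri N) = (q ^ 5) powi tri N" and 3: "(- 1 :: complex) powi m = - ((- 1) powi N)"
      have "square_term m * square_term m * ((- 1) powi m * q powi tri (- m) * ?D) =
          ((- 1) powi m * (- 1) powi m) * ((- 1) powi m * ?D *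
            (q powi (m + 1)\<^sup>2 * q powi (m + 1)\<^sup>2 * q powi tri (- m)))"
        by (simp only: square_term_def mult_ac)
      also have "\<dots> = (- 1) powi m * ?D * (q * (q powi (5 * tri N) * q powi (- N)))"
        by (simp only: 1 power_int_minus_one_mult_self mult_1_left)
      finally show ?thesis
        by (simp only: 2 3) simp
    qed
    show "- q * ?D * ((- 1) powi (case a of (m, l) \<Rightarrow> - m - 1) * (q ^ 5) powi tri (case a of (m, l) \<Rightarrow> - m - 1) *
        q powi (- (case a of (m, l) \<Rightarrow> - m - 1))) =
        (case a of (m, l) \<Rightarrow> square_term m * square_term l *
          (if m = l then (- 1) powi m * q powi tri (- m) * ?D else 0))"
      unfolding a prod.case N_def[symmetric] using key by simp
  qed auto
  also have "\<dots> = - q * ?D * jtheta q (q ^ 5)"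
  proof -
    interpret q5: nome "q ^ 5"
      using q_nz q_lt1 by unfold_locales (simp_all add: norm_power power_less_one_iff)
    show ?thesis
      unfolding q5.jtheta_eq_infsum[OF q_nz] by (rule infsum_cmult_right')
  qed
  finally show ?thesis .
qed

end

section \<open>Theta identities and the dissection modulo 3\<close>

lemma qpoch_inf_dissect2:
  assumes "norm p < 1"
  shows "qpoch_inf x p = qpoch_inf x (p\<^sup>2) * qpoch_inf (p * x) (p\<^sup>2)"
  using qpoch_inf_dissect[OF assms, of 2 x] by (simp add: numeral_2_eq_2)

lemma qpoch_inf_dissect3:
  assumes "norm p < 1"
  shows "qpoch_inf x p = qpoch_inf x (p ^ 3) * qpoch_inf (p * x) (p ^ 3) * qpoch_inf (p\<^sup>2 * x) (p ^ 3)"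
  using qpoch_inf_dissect[OF assms, of 3 x] by (simp add: numeral_3_eq_3 numeral_2_eq_2)

lemma jtheta_self_cube:
  assumes "norm x < 1" "x \<noteq> 0"
  shows "jtheta x (x ^ 3) = qpoch_inf x x"
proof -
  have "x ^ 3 / x = x * x" "x\<^sup>2 * x = x ^ 3"
    using assms by (simp_all add: power3_eq_cube power2_eq_square)
  then show ?thesis
    using qpoch_inf_dissect3[OF assms(1), of x] by (simp add: jtheta_def)
qed

text \<open>This is \<open>J\<^sub>1\<^sub>,\<^sub>2\<close>, i.e. \<open>\<phi>(-q)\<close> for Ramanujan's theta function \<open>\<phi>\<close> (not the mock theta function).\<close>

definition gauss_theta :: "complex \<Rightarrow> complex" where
  "gauss_theta q = qpoch_inf q q / qpoch_inf (- q) q"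

lemma square_mod_3: "(n :: int)\<^sup>2 mod 3 = (if 3 dvd n then 0 else 1)"
proof -
  have "n mod 3 = 0 \<or> n mod 3 = 1 \<or> n mod 3 = 2"
    by auto
  moreover have "n\<^sup>2 mod 3 = (n mod 3)\<^sup>2 mod 3"
    by (simp only: power_mod)
  ultimately show ?thesis
    unfolding dvd_eq_mod_eq_0 by (elim disjE) (simp_all only:, simp_all)
qed

lemma powi_mod_3:
  fixes \<zeta> :: complex
  assumes "\<zeta> ^ 3 = 1"
  shows "\<zeta> powi n = \<zeta> powi (n mod 3)"
proof -
  have "\<zeta> \<noteq> 0"
    using assms by auto
  have "\<zeta> powi n = \<zeta> powi (3 * (n div 3) + n mod 3)"
    by simp
  also have "\<dots> = (\<zeta> powi 3) powi (n div 3) * \<zeta> powi (n mod 3)"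
    by (simp only: power_int_add[OF disjI1[OF \<open>\<zeta> \<noteq> 0\<close>]] power_int_mult)
  finally show ?thesis
    using assms by simp
qed

definition psi_exp :: "int \<Rightarrow> int \<Rightarrow> int" where
  "psi_exp r s = r * s + (r + s)\<^sup>2 + 3 * (r + s) + 2"

lemma psi_exp_mod_3:
  "psi_exp r s mod 3 = (if 3 dvd r \<and> 3 dvd s then 2 else if 3 dvd r \<or> 3 dvd s then 0 else 1)"
proof -
  have "psi_exp r s = (r\<^sup>2 + s\<^sup>2 + 2) + 3 * (r * s + r + s)"
    by (simp add: psi_exp_def power2_eq_square algebra_simps)
  then have "psi_exp r s mod 3 = (r\<^sup>2 + s\<^sup>2 + 2) mod 3"
    by (simp only: mod_mult_self2)
  also have "\<dots> = (r\<^sup>2 mod 3 + s\<^sup>2 mod 3 + 2) mod 3"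
  proof -
    have "(x + y + 2) mod 3 = (x mod 3 + y mod 3 + 2) mod 3" for x y :: int
      by presburger
    then show ?thesis .
  qed
  finally show ?thesis
    by (simp add: square_mod_3)
qed

context nome
begin

lemma nome_power: "n > 0 \<Longrightarrow> nome (q ^ n)"
  using q_nz q_lt1 by unfold_locales (simp_all add: norm_power power_less_one_iff)

lemma nome_rotate: "norm \<zeta> = 1 \<Longrightarrow> nome (\<zeta> * q)"
  using q_nz q_lt1 by unfold_locales (auto simp: norm_mult)

lemma qpoch_inf_self_nonzero: "qpoch_inf q q \<noteq> 0" "qpoch_inf (- q) q \<noteq> 0"
  using q_lt1 by (intro qpoch_inf_nonzero; simp)+

lemma gauss_theta_nonzero: "gauss_theta q \<noteq> 0"
  by (simp add: gauss_theta_def qpoch_inf_self_nonzero)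

lemma qpoch_inf_even: "qpoch_inf q q * qpoch_inf (- q) q = qpoch_inf (q\<^sup>2) (q\<^sup>2)"
  by (rule qpoch_inf_mult_minus[OF q_lt1])

text \<open>Euler's theorem on odd and distinct parts: split (q; q) into odd and even powers and
  cancel it.\<close>

lemma qpoch_inf_euler: "qpoch_inf q (q\<^sup>2) * qpoch_inf (- q) q = 1"
proof -
  have "qpoch_inf q q = qpoch_inf q (q\<^sup>2) * (qpoch_inf q q * qpoch_inf (- q) q)"
    unfolding qpoch_inf_even using qpoch_inf_dissect2[OF q_lt1, of q] by (simp add: power2_eq_square)
  then show ?thesis
    using qpoch_inf_self_nonzero(1) by (simp add: mult_ac)
qed

lemma jtheta_eq_gauss_theta: "jtheta q (q\<^sup>2) = gauss_theta q"
proof -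
  have "jtheta q (q\<^sup>2) = qpoch_inf q (q\<^sup>2) * (qpoch_inf q (q\<^sup>2) * qpoch_inf (q * q) (q\<^sup>2))"
    using q_nz by (simp add: jtheta_def power2_eq_square)
  also have "\<dots> = qpoch_inf q (q\<^sup>2) * qpoch_inf q q"
    by (subst qpoch_inf_dissect2[OF q_lt1, of q, symmetric]) (rule refl)
  also have "\<dots> = gauss_theta q"
    using qpoch_inf_euler qpoch_inf_self_nonzero(2) by (simp add: gauss_theta_def field_simps)
  finally show ?thesis .
qed

lemma gauss_theta_summable: "(\<lambda>n. (- 1) powi n * q powi n\<^sup>2) summable_on UNIV"
proof (rule abs_summable_summable, rule abs_summable_gauss[OF norm_q_pos q_lt1, of 1])
  show "norm ((- 1) powi n * q powi n\<^sup>2) \<le> 1 * norm q powi n\<^sup>2" for n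
    by (simp add: norm_mult norm_power_int)
  show "\<bar>n\<bar> \<le> n\<^sup>2 + 0" for n :: int
    using self_le_power[of "\<bar>n\<bar>" 2] by (cases "n = 0") auto
qed simp

lemma gauss_theta_eq_infsum: "gauss_theta q = (\<Sum>\<^sub>\<infinity>n. (- 1) powi n * q powi n\<^sup>2)"
proof -
  interpret q2: nome "q\<^sup>2"
    by (rule nome_power) simp
  have "(q\<^sup>2) powi tri N * q powi (- N) = q powi N\<^sup>2" for N
  proof -
    have "(q\<^sup>2) powi tri N = q powi (2 * tri N)"
      by (simp add: power_int_mult)
    then show ?thesis
      by (simp add: q_powi_add[symmetric] two_tri power2_eq_square distrib_left)
  qed
  then show ?thesis
    unfolding jtheta_eq_gauss_theta[symmetric] q2.jtheta_eq_infsum[OF q_nz] by (simp add: mult.assoc)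
qed

section \<open>Convolution coefficients: symmetry, quasi-periodicity and special values\<close>

lemma conv_term_eq: "conv_term r = (- 1) powi r * (\<Sum>\<^sub>\<infinity>m. q powi ((m + 1)\<^sup>2 + tri (r - m)))"
  unfolding conv_term_def infsum_cmult_right'[symmetric]
  by (intro infsum_cong)
     (simp add: square_term_def theta_term_def q_powi_add power_int_diff mult_ac)

definition conv_sum :: "int \<Rightarrow> complex" where
  "conv_sum r = (\<Sum>\<^sub>\<infinity>m. q powi ((m + 1)\<^sup>2 + tri (r - m)))"

lemma conv_sum_reflect: "conv_sum (- 3 - r) = conv_sum r"
  unfolding conv_sum_def
proof (rule infsum_reindex_bij_witness[of _ "\<lambda>m. - 2 - m" "\<lambda>m. - 2 - m"])
  fix m :: int
  have "tri (r - (- 2 - m)) = tri (- 3 - r - m)"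
  proof -
    have "- 1 - (r - (- 2 - m)) = - 3 - r - m"
      by simp
    then show ?thesis
      using tri_reflect[of "r - (- 2 - m)"] by (simp only:)
  qed
  moreover have "(- 2 - m + 1)\<^sup>2 = (m + 1)\<^sup>2"
    by (simp add: power2_eq_square algebra_simps)
  ultimately show "q powi ((- 2 - m + 1)\<^sup>2 + tri (r - (- 2 - m))) = q powi ((m + 1)\<^sup>2 + tri (- 3 - r - m))"
    by simp
qed auto

text \<open>Substitute m -> m + 1; the linear changes of the two quadratic exponents cancel in m.
  Together with \<open>conv_sum_reflect\<close> this reduces all values to those at 0 and
  -1.\<close>

lemma conv_sum_shift: "conv_sum (r + 3) = q powi (2 * r + 6) * conv_sum r"
proof -
  have "conv_sum (r + 3) = (\<Sum>\<^sub>\<infinity>m. q powi (((m + 1) + 1)\<^sup>2 + tri (r + 3 - (m + 1))))"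
    unfolding conv_sum_def by (rule infsum_int_shift[symmetric])
  also have "\<dots> = (\<Sum>\<^sub>\<infinity>m. q powi (2 * r + 6) * q powi ((m + 1)\<^sup>2 + tri (r - m)))"
  proof (intro infsum_cong)
    fix m :: int
    have "tri (r + 3 - (m + 1)) = tri (r - m) + 3 + (r - m) * 2"
      using tri_add[of "r - m" 2] by (simp add: tri_def[of 2] algebra_simps)
    then have "((m + 1) + 1)\<^sup>2 + tri (r + 3 - (m + 1)) = (2 * r + 6) + ((m + 1)\<^sup>2 + tri (r - m))"
      by (simp add: power2_eq_square algebra_simps)
    then show "q powi (((m + 1) + 1)\<^sup>2 + tri (r + 3 - (m + 1))) =
        q powi (2 * r + 6) * q powi ((m + 1)\<^sup>2 + tri (r - m))"
      by (simp only: q_powi_add)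
  qed
  finally show ?thesis
    unfolding conv_sum_def by (simp only: infsum_cmult_right')
qed

text \<open>With N = -m - 1 the exponent is 3 tri(N) - N, so the triple product of nome q^3 applies;
  the negative argument -1/q cancels its alternating sign.\<close>

lemma conv_sum_neg1: "conv_sum (- 1) = qpoch_inf (- q) q * gauss_theta (q ^ 3)"
proof -
  interpret q3: nome "q ^ 3"
    by (rule nome_power) simp
  have "conv_sum (- 1) = (\<Sum>\<^sub>\<infinity>N. (- 1) powi N * (q ^ 3) powi tri N * (- (1 / q)) powi N)"
    unfolding conv_sum_def
  proof (rule infsum_reindex_bij_witness[of _ "\<lambda>N. - N - 1" "\<lambda>m. - m - 1"])
    fix m :: int
    define N where "N = - m - 1"
    have m: "m = - N - 1"
      by (simp add: N_def)
    have "(m + 1)\<^sup>2 + tri (- 1 - m) = 3 * tri N + - N"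
      using two_tri[of N] by (simp add: m power2_eq_square algebra_simps)
    then have "q powi ((m + 1)\<^sup>2 + tri (- 1 - m)) = (q ^ 3) powi tri N * (1 / q) powi N"
    proof -
      have "q powi (3 * tri N) = (q ^ 3) powi tri N" "q powi (- N) = (1 / q) powi N"
        by (simp_all add: power_int_mult power_int_minus_divide power_int_divide_distrib)
      then show ?thesis
        by (simp only: \<open>(m + 1)\<^sup>2 + tri (- 1 - m) = 3 * tri N + - N\<close> q_powi_add)
    qed
    moreover have "(- 1) powi N * (- (1 / q)) powi N = (1 / q) powi N"
      by (simp flip: power_int_mult_distrib)
    ultimately show "(- 1) powi (- m - 1) * (q ^ 3) powi tri (- m - 1) * (- (1 / q)) powi (- m - 1) =
        q powi ((m + 1)\<^sup>2 + tri (- 1 - m))"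
      unfolding N_def[symmetric] by (simp add: mult_ac)
  qed auto
  also have "\<dots> = qpoch_inf (- (q\<^sup>2)) (q ^ 3) * qpoch_inf (- q) (q ^ 3) * qpoch_inf (q ^ 3) (q ^ 3)"
    using q_nz by (subst q3.jacobi_triple_product) (simp_all add: power2_eq_square power3_eq_cube)
  also have "\<dots> = qpoch_inf (- q) q * gauss_theta (q ^ 3)"
    using qpoch_inf_dissect3[OF q_lt1, of "- q"] q3.qpoch_inf_self_nonzero(2)
    by (simp add: gauss_theta_def power2_eq_square power3_eq_cube mult_ac)
  finally show ?thesis .
qed

text \<open>The exponent is 1 + 3 tri(m), which calls for the triple product at z = -1; the 2 is the
  first factor of \<open>qpoch_inf (- 1) (q ^ 3)\<close>.\<close>

lemma conv_sum_0: "conv_sum 0 = 2 * q * qpoch_inf (- (q ^ 3)) (q ^ 3) ^ 2 * qpoch_inf (q ^ 3) (q ^ 3)"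
proof -
  interpret q3: nome "q ^ 3"
    by (rule nome_power) simp
  have "conv_sum 0 = (\<Sum>\<^sub>\<infinity>N. q * ((- 1) powi N * (q ^ 3) powi tri N * (- 1) powi N))"
    unfolding conv_sum_def
  proof (intro infsum_cong)
    fix m :: int
    have "tri (- m) = tri m - m"
      using two_tri[of m] two_tri[of "- m"] by (simp add: algebra_simps)
    then have "(m + 1)\<^sup>2 + tri (0 - m) = 1 + 3 * tri m"
      using two_tri[of m] by (simp add: power2_eq_square algebra_simps)
    then have "q powi ((m + 1)\<^sup>2 + tri (0 - m)) = q * (q ^ 3) powi tri m"
      by (simp only: q_powi_add power_int_1_right) (simp add: power_int_mult)
    then show "q powi ((m + 1)\<^sup>2 + tri (0 - m)) = q * ((- 1) powi m * (q ^ 3) powi tri m * (- 1) powi m)"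
      by (simp add: mult_ac)
  qed
  also have "\<dots> = q * (qpoch_inf (- (q ^ 3)) (q ^ 3) * qpoch_inf (- 1) (q ^ 3) * qpoch_inf (q ^ 3) (q ^ 3))"
    unfolding infsum_cmult_right' by (subst q3.jacobi_triple_product) simp_all
  also have "qpoch_inf (- 1) (q ^ 3) = 2 * qpoch_inf (- (q ^ 3)) (q ^ 3)"
    by (subst qpoch_inf_rec[OF q3.q_lt1]) simp
  finally show ?thesis
    by (simp add: power2_eq_square mult_ac)
qed

text \<open>The sum is the product of (q; q^6), (q^5; q^6) and (q^6; q^6). Euler's identity for q
  cancels the first two against (-q; q), and Euler's identity for q^3 rewrites what is left.\<close>

lemma theta6_product:
  "(\<Sum>\<^sub>\<infinity>N. (- 1) powi N * (q ^ 6) powi tri N * (1 / q) powi N) * qpoch_inf (- q) q =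
   qpoch_inf (- (q ^ 3)) (q ^ 3) ^ 2 * qpoch_inf (q ^ 3) (q ^ 3)"
proof -
  interpret q2: nome "q\<^sup>2"
    by (rule nome_power) simp
  interpret q3: nome "q ^ 3"
    by (rule nome_power) simp
  interpret q6: nome "q ^ 6"
    by (rule nome_power) simp
  define B where "B = qpoch_inf (q ^ 5) (q ^ 6) * qpoch_inf q (q ^ 6) * qpoch_inf (q ^ 6) (q ^ 6)"
  have pows: "(q\<^sup>2) ^ 3 = q ^ 6" "q\<^sup>2 * q = q ^ 3" "(q\<^sup>2)\<^sup>2 * q = q ^ 5" "(q ^ 3)\<^sup>2 = q ^ 6"
    by (simp_all add: flip: power_mult power_Suc2)
  have "1 / q * q ^ 6 = q ^ 5"
    using q_nz by (simp add: power_numeral_reduce)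
  then have "(\<Sum>\<^sub>\<infinity>N. (- 1) powi N * (q ^ 6) powi tri N * (1 / q) powi N) = B"
    using q_nz by (subst q6.jacobi_triple_product) (simp_all add: B_def)
  moreover have "B * qpoch_inf (- q) q = qpoch_inf (- (q ^ 3)) (q ^ 3) ^ 2 * qpoch_inf (q ^ 3) (q ^ 3)"
  proof -
    have 1: "qpoch_inf q (q ^ 6) * qpoch_inf (q ^ 3) (q ^ 6) * qpoch_inf (q ^ 5) (q ^ 6) * qpoch_inf (- q) q = 1"
      using qpoch_inf_euler unfolding qpoch_inf_dissect3[OF q2.q_lt1, of q] pows .
    have 2: "qpoch_inf (q ^ 3) (q ^ 6) * qpoch_inf (- (q ^ 3)) (q ^ 3) = 1"
      using q3.qpoch_inf_euler by (simp add: pows)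
    have 3: "qpoch_inf (q ^ 6) (q ^ 6) = qpoch_inf (q ^ 3) (q ^ 3) * qpoch_inf (- (q ^ 3)) (q ^ 3)"
      using q3.qpoch_inf_even by (simp add: pows)
    have "B * qpoch_inf (- q) q = (B * qpoch_inf (- q) q) * (qpoch_inf (q ^ 3) (q ^ 6) * qpoch_inf (- (q ^ 3)) (q ^ 3))"
      by (simp only: 2 mult_1_right)
    also have "\<dots> = (qpoch_inf q (q ^ 6) * qpoch_inf (q ^ 3) (q ^ 6) * qpoch_inf (q ^ 5) (q ^ 6) * qpoch_inf (- q) q)
        * (qpoch_inf (q ^ 6) (q ^ 6) * qpoch_inf (- (q ^ 3)) (q ^ 3))"
      by (simp only: B_def mult_ac)
    also have "\<dots> = qpoch_inf (- (q ^ 3)) (q ^ 3) ^ 2 * qpoch_inf (q ^ 3) (q ^ 3)"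
      by (simp only: 1 3) (simp add: power2_eq_square)
    finally show ?thesis .
  qed
  ultimately show ?thesis
    by simp
qed

text \<open>The ratio of the two special values. With q^3 in place of q the series is that of
  \<open>theta_nonmult3_eq\<close>, which is how the weights -b and a arise.\<close>

lemma conv_sum_0_neg1:
  "conv_sum 0 * gauss_theta (q ^ 3) =
   2 * q * (\<Sum>\<^sub>\<infinity>N. (- 1) powi N * (q ^ 6) powi tri N * (1 / q) powi N) * conv_sum (- 1)"
  unfolding conv_sum_0 conv_sum_neg1 mult.assoc theta6_product[symmetric]
  by (simp add: theta6_product[symmetric] mult_ac)

section \<open>The 3-dissection of Gauss's theta function\<close>

definition theta_mult3 :: complex where
  "theta_mult3 = (\<Sum>\<^sub>\<infinity>n. if 3 dvd n then (- 1) powi n * q powi n\<^sup>2 else 0)"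

text \<open>\<open>theta_mult3\<close> and \<open>theta_nonmult3\<close> are the numbers a and b of
  the overview. As n^2 is 0 or 1 modulo 3, there is no third part.\<close>

definition theta_nonmult3 :: complex where
  "theta_nonmult3 = (\<Sum>\<^sub>\<infinity>n. if 3 dvd n then 0 else (- 1) powi n * q powi n\<^sup>2)"

lemma theta_mult3_summable:
  "(\<lambda>n. if 3 dvd n then (- 1) powi n * q powi n\<^sup>2 else 0) summable_on UNIV"
  "(\<lambda>n. if 3 dvd n then 0 else (- 1) powi n * q powi n\<^sup>2) summable_on UNIV"
proof -
  have "(\<lambda>n. (- 1) powi n * q powi n\<^sup>2) summable_on {n. 3 dvd n}"
    by (rule summable_on_subset[OF gauss_theta_summable]) simp
  then show "(\<lambda>n. if 3 dvd n then (- 1) powi n * q powi n\<^sup>2 else 0) summable_on UNIV"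
    by (rule summable_on_cong_neutral[THEN iffD1, rotated -1]) auto
  have "(\<lambda>n. (- 1) powi n * q powi n\<^sup>2) summable_on {n. \<not> 3 dvd n}"
    by (rule summable_on_subset[OF gauss_theta_summable]) simp
  then show "(\<lambda>n. if 3 dvd n then 0 else (- 1) powi n * q powi n\<^sup>2) summable_on UNIV"
    by (rule summable_on_cong_neutral[THEN iffD1, rotated -1]) auto
qed

lemma gauss_theta_rotate:
  assumes "\<zeta> ^ 3 = 1" "norm \<zeta> = 1"
  shows "gauss_theta (\<zeta> * q) = theta_mult3 + \<zeta> * theta_nonmult3"
proof -
  interpret r: nome "\<zeta> * q"
    by (rule nome_rotate[OF assms(2)])
  have "(- 1) powi n * (\<zeta> * q) powi n\<^sup>2 = (if 3 dvd n then (- 1) powi n * q powi n\<^sup>2 else 0)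
      + \<zeta> * (if 3 dvd n then 0 else (- 1) powi n * q powi n\<^sup>2)" for n
    unfolding power_int_mult_distrib powi_mod_3[OF assms(1), of "n\<^sup>2"] square_mod_3 by simp
  then have "gauss_theta (\<zeta> * q) = (\<Sum>\<^sub>\<infinity>n. (if 3 dvd n then (- 1) powi n * q powi n\<^sup>2 else 0)
      + \<zeta> * (if 3 dvd n then 0 else (- 1) powi n * q powi n\<^sup>2))"
    unfolding r.gauss_theta_eq_infsum by (simp only:)
  also have "\<dots> = theta_mult3 + \<zeta> * theta_nonmult3"
    unfolding theta_mult3_def theta_nonmult3_def infsum_cmult_right'[symmetric]
    by (intro infsum_add summable_on_cmult_right theta_mult3_summable)
  finally show ?thesis .
qed

lemma theta_mult3_eq: "theta_mult3 = gauss_theta (q ^ 9)"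
proof -
  interpret q9: nome "q ^ 9"
    by (rule nome_power) simp
  have "theta_mult3 = (\<Sum>\<^sub>\<infinity>n\<in>{n. 3 dvd n}. (- 1) powi n * q powi n\<^sup>2)"
    unfolding theta_mult3_def by (rule infsum_cong_neutral) auto
  also have "\<dots> = (\<Sum>\<^sub>\<infinity>k. (- 1) powi k * (q ^ 9) powi k\<^sup>2)"
  proof (rule infsum_reindex_bij_witness[of _ "\<lambda>k. 3 * k" "\<lambda>n. n div 3"])
    fix n :: int
    assume "n \<in> {n. 3 dvd n}"
    then obtain k where n: "n = 3 * k"
      by auto
    have "q powi (3 * k)\<^sup>2 = (q ^ 9) powi k\<^sup>2"
      by (simp add: power_mult_distrib power_int_mult)
    moreover have "(- 1 :: complex) powi (3 * k) = (- 1) powi k"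
      by (simp add: power_int_mult)
    ultimately show "(- 1) powi (n div 3) * (q ^ 9) powi (n div 3)\<^sup>2 = (- 1) powi n * q powi n\<^sup>2"
      by (simp add: n)
  qed auto
  finally show ?thesis
    by (simp add: q9.gauss_theta_eq_infsum)
qed

lemma theta_nonmult3_eq:
  "theta_nonmult3 = - 2 * q * (\<Sum>\<^sub>\<infinity>N. (- 1) powi N * (q ^ 18) powi tri N * (1 / q ^ 3) powi N)"
proof -
  define t where "t n = (- 1) powi n * q powi n\<^sup>2" for n
  define c where "c = (\<Sum>\<^sub>\<infinity>N. t (3 * N + 1))"
  have t_summable: "t summable_on A" for A
    unfolding t_def[abs_def] by (rule summable_on_subset[OF gauss_theta_summable]) simp
  \<comment> \<open>The classes 1 and -1 modulo 3 are exchanged by n -> -n, which preserves the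
    terms; hence the factor 2.\<close>
  have sets: "{n :: int. \<not> 3 dvd n} = range (\<lambda>N. 3 * N + 1) \<union> range (\<lambda>N. - (3 * N + 1))"
  proof (intro set_eqI iffI)
    fix n :: int
    assume "n \<in> {n. \<not> 3 dvd n}"
    then have "n mod 3 = 1 \<or> n mod 3 = 2"
      by (auto simp: dvd_eq_mod_eq_0)
    then have "n = 3 * (n div 3) + 1 \<or> n = - (3 * (- (n div 3) - 1) + 1)"
      by presburger
    then show "n \<in> range (\<lambda>N. 3 * N + 1) \<union> range (\<lambda>N. - (3 * N + 1))"
      by blast
  qed (auto, presburger+)
  have "theta_nonmult3 = infsum t {n. \<not> 3 dvd n}"
    unfolding theta_nonmult3_def t_def by (rule infsum_cong_neutral) auto
  also have "\<dots> = infsum t (range (\<lambda>N. 3 * N + 1)) + infsum t (range (\<lambda>N. - (3 * N + 1)))"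
    unfolding sets by (intro infsum_Un_disjoint t_summable) (auto, presburger)
  also have "infsum t (range (\<lambda>N. 3 * N + 1)) = c"
    by (subst infsum_reindex) (auto simp: inj_on_def c_def o_def)
  also have "infsum t (range (\<lambda>N. - (3 * N + 1))) = (\<Sum>\<^sub>\<infinity>N. t (- (3 * N + 1)))"
    by (subst infsum_reindex) (auto simp: inj_on_def o_def)
  also have "\<dots> = c"
    by (simp only: c_def t_def power_int_minus_one_minus power2_minus)
  also have "c = (\<Sum>\<^sub>\<infinity>N. - q * ((- 1) powi N * (q ^ 18) powi tri N * (1 / q ^ 3) powi N))"
    unfolding c_def
  proof (intro infsum_cong)
    fix N
    have "(3 * N + 1)\<^sup>2 = 1 + (18 * tri N + - (3 * N))"
      using two_tri[of N] by (simp add: power2_eq_square algebra_simps)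
    then have "q powi (3 * N + 1)\<^sup>2 = q * (q powi (18 * tri N) * q powi (- (3 * N)))"
      by (simp only: q_powi_add power_int_1_right)
    moreover have "q powi (18 * tri N) = (q ^ 18) powi tri N" "q powi (- (3 * N)) = (1 / q ^ 3) powi N"
      by (simp_all add: power_int_mult power_int_minus_divide power_int_divide_distrib)
    moreover have "(- 1 :: complex) powi (3 * N + 1) = - ((- 1) powi N)"
      by (simp add: power_int_add power_int_mult)
    ultimately show "t (3 * N + 1) = - q * ((- 1) powi N * (q ^ 18) powi tri N * (1 / q ^ 3) powi N)"
      by (simp add: t_def mult_ac)
  qed
  also have "\<dots> = - q * (\<Sum>\<^sub>\<infinity>N. (- 1) powi N * (q ^ 18) powi tri N * (1 / q ^ 3) powi N)"
    by (rule infsum_cmult_right')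
  finally show ?thesis
    by simp
qed

section \<open>The Hecke sum of \<psi> at q times a cube root of unity\<close>

definition psi_term :: "int \<Rightarrow> int \<Rightarrow> complex" where
  "psi_term r s = - (sgn2 r s * (- 1) powi (r + s) * q powi psi_exp r s)"

lemma decay_hcoef: "decay (\<lambda>N. hcoef (N + k))"
proof -
  have "decay (\<lambda>N. q powi (0 * N + 0) * hcoef (N + k))"
  proof (rule decay_tri[of 1])
    show "norm (hcoef N) \<le> 1 * norm q powi tri N" for N
      using powi_mono_exp[OF norm_q_pos q_lt1, of "tri N" "N * (N + 1)"] two_tri[of N] tri_nonneg[of N]
      by (simp add: hcoef_def norm_mult norm_power_int)
  qed simp
  then show ?thesis
    by simp
qed

lemma hecke_psi_term: "((\<lambda>(r, s). psi_term r s) has_sum hecke (\<lambda>N. hcoef (N + 1))) UNIV"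
proof -
  have eq: "(case x of (r, s) \<Rightarrow> psi_term r s) =
      (case x of (r, s) \<Rightarrow> sgn2 r s * q powi (r * s) * hcoef (r + s + 1))" for x
  proof (cases x)
    case (Pair r s)
    have "r * s + (r + s + 1) * (r + s + 1 + 1) = psi_exp r s"
      by (simp add: psi_exp_def power2_eq_square algebra_simps)
    then have "q powi (r * s) * q powi ((r + s + 1) * (r + s + 1 + 1)) = q powi psi_exp r s"
      by (simp only: q_powi_add[symmetric])
    then show ?thesis
      by (simp add: Pair psi_term_def hcoef_def minus_one_powi_add_1 mult_ac)
  qed
  show ?thesis
    unfolding hecke_def eq by (rule has_sum_infsum[OF hecke_summable[OF decay_hcoef]])
qed

text \<open>Rotating q multiplies each term by \<zeta> to its exponent, which
  \<open>psi_exp_mod_3\<close> determines modulo 3 from the divisibility of r and s.\<close>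

lemma mock_psi_rotate:
  assumes "\<zeta> ^ 3 = 1" "norm \<zeta> = 1"
  shows "((\<lambda>(r, s). \<zeta> powi (if 3 dvd r \<and> 3 dvd s then 2 else if 3 dvd r \<or> 3 dvd s then 0 else 1) * psi_term r s)
    has_sum (mock_psi (\<zeta> * q) * (theta_mult3 + \<zeta> * theta_nonmult3))) UNIV"
proof -
  interpret r: nome "\<zeta> * q"
    by (rule nome_rotate[OF assms(2)])
  have "mock_psi (\<zeta> * q) * gauss_theta (\<zeta> * q) = r.hecke (\<lambda>N. r.hcoef (N + 1))"
    using r.qpoch_inf_self_nonzero by (simp add: r.mock_psi_hecke gauss_theta_def)
  moreover have "r.psi_term r s =
      \<zeta> powi (if 3 dvd r \<and> 3 dvd s then 2 else if 3 dvd r \<or> 3 dvd s then 0 else 1) * psi_term r s" for r s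
    unfolding psi_term_def r.psi_term_def power_int_mult_distrib
      powi_mod_3[OF assms(1), of "psi_exp r s"] psi_exp_mod_3 by simp
  ultimately show ?thesis
    using r.hecke_psi_term by (simp add: gauss_theta_rotate[OF assms])
qed

text \<open>\<open>psi_exp (3 * r) (3 * s)\<close> is 2 plus 9 times the exponent of the \<phi> sum;
  tripling preserves \<open>sgn2\<close> and the parity of r + s. The minus sign is that of
  \<open>psi_term\<close>.\<close>

lemma mock_phi_ninth:
  "((\<lambda>(r, s). if 3 dvd r \<and> 3 dvd s then psi_term r s else 0)
    has_sum (- q\<^sup>2 * (mock_phi (q ^ 9) * theta_mult3))) UNIV"
proof -
  interpret q9: nome "q ^ 9"
    by (rule nome_power) simp
  have "mock_phi (q ^ 9) * theta_mult3 = q9.hecke q9.hcoef"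
    unfolding theta_mult3_eq using q9.qpoch_inf_self_nonzero
    by (simp add: q9.mock_phi_hecke gauss_theta_def)
  moreover have "((\<lambda>(r, s). sgn2 r s * (q ^ 9) powi (r * s) * q9.hcoef (r + s)) has_sum q9.hecke q9.hcoef) UNIV"
    unfolding q9.hecke_def using q9.hecke_summable[OF q9.decay_hcoef[of 0]] by simp
  ultimately have "((\<lambda>x. - q\<^sup>2 * (case x of (r, s) \<Rightarrow> sgn2 r s * (q ^ 9) powi (r * s) * q9.hcoef (r + s)))
      has_sum (- q\<^sup>2 * (mock_phi (q ^ 9) * theta_mult3))) UNIV"
    by (simp only: has_sum_cmult_right)
  also have "?this \<longleftrightarrow> ((\<lambda>(r, s). if 3 dvd r \<and> 3 dvd s then psi_term r s else 0)
    has_sum (- q\<^sup>2 * (mock_phi (q ^ 9) * theta_mult3))) {(r, s). 3 dvd r \<and> 3 dvd s}"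
  proof (rule has_sum_reindex_bij_witness[of _ "\<lambda>(r, s). (r div 3, s div 3)" "\<lambda>(r, s). (3 * r, 3 * s)"])
    fix x :: "int \<times> int"
    obtain r s where x: "x = (r, s)"
      by (metis surj_pair)
    have "psi_exp (3 * r) (3 * s) = 2 + (9 * (r * s) + 9 * ((r + s) * (r + s + 1)))"
      by (simp add: psi_exp_def power2_eq_square algebra_simps)
    then have "q powi psi_exp (3 * r) (3 * s) = q\<^sup>2 * ((q ^ 9) powi (r * s) * (q ^ 9) powi ((r + s) * (r + s + 1)))"
      by (simp only: q_powi_add power_int_numeral power_int_mult)
    moreover have "(- 1 :: complex) powi (3 * r + 3 * s) = (- 1) powi (r + s)"
      by (simp add: power_int_mult distrib_left[symmetric] del: distrib_left_numeral)
    moreover have "sgn2 (3 * r) (3 * s) = sgn2 r s"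
      by (auto simp: sgn2_def)
    ultimately show "(case (case x of (r, s) \<Rightarrow> (3 * r, 3 * s)) of (r, s) \<Rightarrow>
        if 3 dvd r \<and> 3 dvd s then psi_term r s else 0) =
        - q\<^sup>2 * (case x of (r, s) \<Rightarrow> sgn2 r s * (q ^ 9) powi (r * s) * q9.hcoef (r + s))"
      by (simp add: x psi_term_def q9.hcoef_def)
  qed auto
  also have "\<dots> \<longleftrightarrow> ?thesis"
    by (rule has_sum_cong_neutral) (auto split: if_splits)
  finally show ?thesis .
qed

text \<open>The u_r of the overview. The products b^2, -ab and a^2 of two weights belong to the
  residues 2, 0 and 1 of \<open>psi_exp\<close>.\<close>

definition weight :: "int \<Rightarrow> complex" where
  "weight r = (if 3 dvd r then - theta_nonmult3 else theta_mult3)"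

text \<open>The multipliers a(a + \<omega>^2 b) and -a(a + \<omega> b) bring both \<psi> values to a
  common factor. Up to \<omega> - \<omega>^2 they yield the wanted weights -ab and a^2 on the
  residues 0 and 1. On residue 2 they yield ab - a^2 in place of b^2; the \<phi> sum times a^2 - ab
  + b^2 makes up the difference.\<close>

lemma psi_combination:
  fixes \<omega> :: complex
  assumes "\<omega> ^ 3 = 1" "norm \<omega> = 1"
  defines "a \<equiv> theta_mult3" and "b \<equiv> theta_nonmult3"
  shows "(\<omega> - \<omega>\<^sup>2) * (\<Sum>\<^sub>\<infinity>(r, s). weight r * weight s * psi_term r s) =
    a * (a + \<omega> * b) * (a + \<omega>\<^sup>2 * b) * (mock_psi (\<omega> * q) - mock_psi (\<omega>\<^sup>2 * q))
      - (\<omega> - \<omega>\<^sup>2) * (a\<^sup>2 - a * b + b\<^sup>2) * (q\<^sup>2 * mock_phi (q ^ 9) * a)"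
proof -
  have w2: "(\<omega>\<^sup>2) ^ 3 = 1" "norm (\<omega>\<^sup>2) = 1"
    using assms(2) arg_cong[OF assms(1), of "\<lambda>y. y\<^sup>2"]
    by (simp_all add: norm_power power_mult[symmetric])
  define T1 T2 M where "T1 = a + \<omega> * b" and "T2 = a + \<omega>\<^sup>2 * b" and "M = a\<^sup>2 - a * b + b\<^sup>2"
  define e :: "int \<Rightarrow> int \<Rightarrow> int" where
    "e r s = (if 3 dvd r \<and> 3 dvd s then 2 else if 3 dvd r \<or> 3 dvd s then 0 else 1)" for r s
  have "((\<lambda>x. a * T2 * (case x of (r, s) \<Rightarrow> \<omega> powi e r s * psi_term r s)
      + (- (a * T1) * (case x of (r, s) \<Rightarrow> (\<omega>\<^sup>2) powi e r s * psi_term r s)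
      + (\<omega> - \<omega>\<^sup>2) * M * (case x of (r, s) \<Rightarrow> if 3 dvd r \<and> 3 dvd s then psi_term r s else 0)))
      has_sum (a * T2 * (mock_psi (\<omega> * q) * T1) + (- (a * T1) * (mock_psi (\<omega>\<^sup>2 * q) * T2)
        + (\<omega> - \<omega>\<^sup>2) * M * (- q\<^sup>2 * (mock_phi (q ^ 9) * a))))) UNIV"
    unfolding T1_def T2_def a_def b_def e_def
    by (intro has_sum_add has_sum_cmult_right mock_psi_rotate mock_phi_ninth assms w2)
  also have "(\<lambda>x. a * T2 * (case x of (r, s) \<Rightarrow> \<omega> powi e r s * psi_term r s)
      + (- (a * T1) * (case x of (r, s) \<Rightarrow> (\<omega>\<^sup>2) powi e r s * psi_term r s)
      + (\<omega> - \<omega>\<^sup>2) * M * (case x of (r, s) \<Rightarrow> if 3 dvd r \<and> 3 dvd s then psi_term r s else 0)))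
      = (\<lambda>x. (\<omega> - \<omega>\<^sup>2) * (case x of (r, s) \<Rightarrow> weight r * weight s * psi_term r s))"
  proof
    fix x :: "int \<times> int"
    obtain r s where x: "x = (r, s)"
      by (metis surj_pair)
    have "a * T2 * \<omega> powi e r s - a * T1 * (\<omega>\<^sup>2) powi e r s
        + (\<omega> - \<omega>\<^sup>2) * M * (if 3 dvd r \<and> 3 dvd s then 1 else 0) = (\<omega> - \<omega>\<^sup>2) * (weight r * weight s)"
    proof -
      have "a * T2 * \<omega>\<^sup>2 - a * T1 * (\<omega>\<^sup>2)\<^sup>2 + (\<omega> - \<omega>\<^sup>2) * M = (\<omega> - \<omega>\<^sup>2) * (b * b)"
      proof -
        have "\<omega> ^ 4 = \<omega>"
          using assms(1) by (simp add: power_numeral_reduce)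
        then have "(\<omega>\<^sup>2)\<^sup>2 = \<omega>" and "\<omega>\<^sup>2 * \<omega>\<^sup>2 = \<omega>"
          by (simp_all add: power2_eq_square power_numeral_reduce mult_ac)
        then show ?thesis
          unfolding T1_def T2_def M_def by (simp add: algebra_simps) (simp add: power2_eq_square algebra_simps)
      qed
      moreover have "a * T2 - a * T1 = (\<omega> - \<omega>\<^sup>2) * (- (a * b))"
        unfolding T1_def T2_def by (simp add: algebra_simps)
      moreover have "a * T2 * \<omega> - a * T1 * \<omega>\<^sup>2 = (\<omega> - \<omega>\<^sup>2) * (a * a)"
        unfolding T1_def T2_def by (simp add: algebra_simps)
      ultimately show ?thesis
        by (auto simp: e_def weight_def a_def b_def mult.commute)
    qed
    note scalar = this
    have gen: "x * (p * k) + (- y * (p' * k) + z * (i * k)) = (x * p - y * p' + z * i) * k" for x y z p p' i k :: complex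
      by (simp add: algebra_simps)
    have "(if 3 dvd r \<and> 3 dvd s then psi_term r s else 0) = (if 3 dvd r \<and> 3 dvd s then 1 else 0) * psi_term r s"
      by simp
    then
    show "a * T2 * (case x of (r, s) \<Rightarrow> \<omega> powi e r s * psi_term r s)
      + (- (a * T1) * (case x of (r, s) \<Rightarrow> (\<omega>\<^sup>2) powi e r s * psi_term r s)
      + (\<omega> - \<omega>\<^sup>2) * M * (case x of (r, s) \<Rightarrow> if 3 dvd r \<and> 3 dvd s then psi_term r s else 0))
      = (\<omega> - \<omega>\<^sup>2) * (case x of (r, s) \<Rightarrow> weight r * weight s * psi_term r s)"
      unfolding x prod.case by (simp only: gen scalar) (simp only: mult.assoc)
  qed
  finally have "(\<omega> - \<omega>\<^sup>2) * (\<Sum>\<^sub>\<infinity>(r, s). weight r * weight s * psi_term r s) =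
      a * T2 * (mock_psi (\<omega> * q) * T1) + (- (a * T1) * (mock_psi (\<omega>\<^sup>2 * q) * T2)
        + (\<omega> - \<omega>\<^sup>2) * M * (- q\<^sup>2 * (mock_phi (q ^ 9) * a)))"
    unfolding infsum_cmult_right'[symmetric] by (rule infsumI)
  then show ?thesis
    unfolding T1_def[symmetric] T2_def[symmetric] M_def[symmetric] by (simp add: algebra_simps)
qed

text \<open>Dividing \<open>conv_sum r\<close> at nome q^3 by q^(r^2 + 3r) gives \<open>v\<close>,
  which has period 3 by \<open>conv_sum_shift\<close> and satisfies v(-1) = v(-2) by reflection. So
  only two values occur, and by \<open>conv_sum_0_neg1\<close> their ratio is -b / a.\<close>

lemma weight_conv_sum:
  "theta_mult3 * nome.conv_sum (q ^ 3) r =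
   q\<^sup>2 * nome.conv_sum (q ^ 3) (- 1) * (q powi (r\<^sup>2 + 3 * r) * weight r)"
proof -
  interpret q3: nome "q ^ 3"
    by (rule nome_power) simp
  define v where "v r = q3.conv_sum r * q powi (- (r\<^sup>2 + 3 * r))" for r
  have v_shift: "v (r + 3) = v r" for r
  proof -
    have "(q ^ 3) powi (2 * r + 6) = q powi (6 * r + 18)"
      by (simp add: power_int_power)
    moreover have "6 * r + 18 + - ((r + 3)\<^sup>2 + 3 * (r + 3)) = - (r\<^sup>2 + 3 * r)"
      by (simp add: power2_eq_square algebra_simps)
    then have "q powi (6 * r + 18) * q powi (- ((r + 3)\<^sup>2 + 3 * (r + 3))) = q powi (- (r\<^sup>2 + 3 * r))"
      by (simp only: q_powi_add[symmetric])
    ultimately show ?thesis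
      by (simp add: v_def q3.conv_sum_shift mult_ac)
  qed
  have v_period: "v (3 * k + j) = v j" for k j
  proof (induction k rule: int_induct[where k = 0])
    case (step1 k)
    then show ?case
      using v_shift[of "3 * k + j"] by (simp add: algebra_simps)
  next
    case (step2 k)
    then show ?case
      using v_shift[of "3 * (k - 1) + j"] by (simp add: algebra_simps)
  qed simp
  have v0: "v 0 = q3.conv_sum 0"
    by (simp add: v_def)
  have v1: "v (- 1) = q\<^sup>2 * q3.conv_sum (- 1)"
    by (simp add: v_def)
  have v2: "v (- 2) = q\<^sup>2 * q3.conv_sum (- 1)"
    using q3.conv_sum_reflect[of "- 1"] by (simp add: v_def)
  have conv: "q3.conv_sum r = q powi (r\<^sup>2 + 3 * r) * v r"
  proof -
    have "q powi (r\<^sup>2 + 3 * r) * q powi (- (r\<^sup>2 + 3 * r)) = 1"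
      by (simp only: q_powi_add[symmetric]) simp
    then show ?thesis
      by (simp add: v_def mult_ac)
  qed
  have "theta_mult3 * v r = q\<^sup>2 * q3.conv_sum (- 1) * weight r"
  proof (cases "3 dvd r")
    case True
    then obtain k where "r = 3 * k"
      by auto
    then have "v r = q3.conv_sum 0"
      using v_period[of k 0] v0 by simp
    moreover have "theta_mult3 * q3.conv_sum 0 = - (q\<^sup>2 * q3.conv_sum (- 1) * theta_nonmult3)"
    proof -
      have "(q ^ 3) ^ 6 = q ^ 18" "(q ^ 3) ^ 3 = q ^ 9"
        by (simp_all flip: power_mult)
      then show ?thesis
        using q3.conv_sum_0_neg1 unfolding theta_mult3_eq theta_nonmult3_eq
        by (simp add: mult_ac power2_eq_square power3_eq_cube)
    qed
    ultimately show ?thesis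
      using True by (simp add: weight_def)
  next
    case False
    then have "r = 3 * (r div 3 + 1) + - 1 \<or> r = 3 * (r div 3 + 1) + - 2"
      by presburger
    then have "v r = v (- 1) \<or> v r = v (- 2)"
      by (metis v_period)
    then have "v r = q\<^sup>2 * q3.conv_sum (- 1)"
      using v1 v2 by auto
    then show ?thesis
      using False by (simp add: weight_def mult_ac)
  qed
  then have "q powi (r\<^sup>2 + 3 * r) * (theta_mult3 * v r) =
      q powi (r\<^sup>2 + 3 * r) * (q\<^sup>2 * q3.conv_sum (- 1) * weight r)"
    by (simp only:)
  then show ?thesis
    unfolding conv by (simp only: mult_ac)
qed

text \<open>Since psi_exp r s = 2 + 3rs + (r^2 + 3r) + (s^2 + 3s), multiplying by \<open>c\<close>
  squared turns the terms, by \<open>weight_conv_sum\<close>, into a constant times those of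
  \<open>conv_term_double_sum\<close> at nome q^3.\<close>

lemma psi_weighted_sum:
  "(\<Sum>\<^sub>\<infinity>(r, s). weight r * weight s * psi_term r s) =
   q * qpoch_inf (q ^ 3) (q ^ 3) ^ 3 / qpoch_inf (- (q ^ 3)) (q ^ 3) ^ 2 * jtheta (q ^ 3) (q ^ 15)"
proof -
  interpret q3: nome "q ^ 3"
    by (rule nome_power) simp
  interpret q9: nome "q ^ 9"
    by (rule nome_power) simp
  define a where "a = theta_mult3"
  define c where "c = q\<^sup>2 * q3.conv_sum (- 1)"
  have a: "a \<noteq> 0"
    by (simp add: a_def theta_mult3_eq q9.gauss_theta_nonzero)
  have c: "c = q\<^sup>2 * (qpoch_inf (- (q ^ 3)) (q ^ 3) * a)"
    by (simp add: c_def a_def theta_mult3_eq q3.conv_sum_neg1 flip: power_mult)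
  have conv: "(- 1) powi r * (c * (q powi (r\<^sup>2 + 3 * r) * weight r)) = a * q3.conv_term r" for r
    using weight_conv_sum[of r] by (simp add: a_def c_def q3.conv_term_eq q3.conv_sum_def)
  have "c\<^sup>2 * (\<Sum>\<^sub>\<infinity>(r, s). weight r * weight s * psi_term r s) =
      (\<Sum>\<^sub>\<infinity>x. c\<^sup>2 * (case x of (r, s) \<Rightarrow> weight r * weight s * psi_term r s))"
    by (rule infsum_cmult_right'[symmetric])
  also have "\<dots> = (\<Sum>\<^sub>\<infinity>x. - (q\<^sup>2 * a\<^sup>2) * (case x of (r, s) \<Rightarrow>
      sgn2 r s * (q ^ 3) powi (r * s) * (q3.conv_term r * q3.conv_term s)))"
  proof (intro infsum_cong)
    fix x :: "int \<times> int"
    obtain r s where x: "x = (r, s)"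
      by (metis surj_pair)
    have "psi_exp r s = 2 + (3 * (r * s) + ((r\<^sup>2 + 3 * r) + (s\<^sup>2 + 3 * s)))"
      by (simp add: psi_exp_def power2_eq_square algebra_simps)
    then have "q powi psi_exp r s = q\<^sup>2 * ((q ^ 3) powi (r * s) * (q powi (r\<^sup>2 + 3 * r) * q powi (s\<^sup>2 + 3 * s)))"
      by (simp only: q_powi_add power_int_numeral power_int_mult)
    then have "c\<^sup>2 * (weight r * weight s * psi_term r s) =
        - (q\<^sup>2 * (sgn2 r s * (q ^ 3) powi (r * s) * (((- 1) powi r * (c * (q powi (r\<^sup>2 + 3 * r) * weight r)))
          * ((- 1) powi s * (c * (q powi (s\<^sup>2 + 3 * s) * weight s))))))"
      by (simp add: psi_term_def power_int_add power2_eq_square mult_ac)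
    also have "\<dots> = - (q\<^sup>2 * (sgn2 r s * (q ^ 3) powi (r * s) * ((a * q3.conv_term r) * (a * q3.conv_term s))))"
      by (simp only: conv)
    finally show "c\<^sup>2 * (case x of (r, s) \<Rightarrow> weight r * weight s * psi_term r s) =
        - (q\<^sup>2 * a\<^sup>2) * (case x of (r, s) \<Rightarrow>
          sgn2 r s * (q ^ 3) powi (r * s) * (q3.conv_term r * q3.conv_term s))"
      by (simp add: x power2_eq_square mult_ac)
  qed
  also have "\<dots> = - (q\<^sup>2 * a\<^sup>2) * (- (q ^ 3) * qpoch_inf (q ^ 3) (q ^ 3) ^ 3 * jtheta (q ^ 3) ((q ^ 3) ^ 5))"
    by (simp only: infsum_cmult_right' q3.conv_term_double_sum)
  finally show ?thesis
    using a q_nz q3.qpoch_inf_self_nonzero(2) unfolding c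
    by (simp add: field_simps power2_eq_square power3_eq_cube flip: power_mult)
qed

end

text \<open>The parameter \<open>e\<close> covers numerator (e = 1) and denominator (e = -1) of
  \<open>gauss_theta\<close> at once. Split the first three factors modulo 3: multiples of 3 give
  the same product three times, the other classes run through all cube roots of unity. By
  \<open>qpoch_inf_cube\<close> the latter become two classes of a fourth copy, which the factor of
  nome q^9 completes.\<close>

lemma qpoch_inf_rotate_product:
  fixes q w e :: complex
  assumes q: "norm q < 1" and w: "1 + w + w\<^sup>2 = 0" "w ^ 3 = 1" "norm w = 1" and e: "e ^ 3 = e"
  shows "qpoch_inf (e * q) q * qpoch_inf (e * (w * q)) (w * q) * qpoch_inf (e * (w\<^sup>2 * q)) (w\<^sup>2 * q)
    * qpoch_inf (e * q ^ 9) (q ^ 9) = qpoch_inf (e * q ^ 3) (q ^ 3) ^ 4"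
proof -
  have q3: "norm (q ^ 3) < 1"
    using q by (simp add: norm_power power_less_one_iff)
  have nw: "norm (w * q) < 1" "norm (w\<^sup>2 * q) < 1"
    using q w(3) by (simp_all add: norm_mult norm_power)
  have w4: "w ^ 4 = w" "w ^ 6 = 1"
    using w(2) power_add[of w 3 1] power_add[of w 3 3] by simp_all
  have 1: "qpoch_inf (e * q) q = qpoch_inf (e * q) (q ^ 3) * qpoch_inf (e * q\<^sup>2) (q ^ 3) * qpoch_inf (e * q ^ 3) (q ^ 3)"
    using qpoch_inf_dissect3[OF q, of "e * q"] by (simp add: power2_eq_square power3_eq_cube mult_ac)
  have 2: "qpoch_inf (e * (w * q)) (w * q) =
      qpoch_inf (w * (e * q)) (q ^ 3) * qpoch_inf (w\<^sup>2 * (e * q\<^sup>2)) (q ^ 3) * qpoch_inf (e * q ^ 3) (q ^ 3)"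
  proof -
    have powers: "(w * q) ^ 3 = q ^ 3" "w * q * (e * (w * q)) = w\<^sup>2 * (e * q\<^sup>2)"
      "(w * q)\<^sup>2 * (e * (w * q)) = e * q ^ 3" "e * (w * q) = w * (e * q)"
      using w(2) by (simp_all add: power_mult_distrib power2_eq_square power3_eq_cube mult_ac)
    show ?thesis
      using qpoch_inf_dissect3[OF nw(1), of "e * (w * q)"] unfolding powers(1-3) unfolding powers(4) .
  qed
  have 3: "qpoch_inf (e * (w\<^sup>2 * q)) (w\<^sup>2 * q) =
      qpoch_inf (w\<^sup>2 * (e * q)) (q ^ 3) * qpoch_inf (w * (e * q\<^sup>2)) (q ^ 3) * qpoch_inf (e * q ^ 3) (q ^ 3)"
  proof -
    have "(w\<^sup>2 * q) ^ 3 = w ^ 6 * q ^ 3" "w\<^sup>2 * q * (e * (w\<^sup>2 * q)) = w ^ 4 * (e * q\<^sup>2)"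
      "(w\<^sup>2 * q)\<^sup>2 * (e * (w\<^sup>2 * q)) = e * (w ^ 6 * q ^ 3)" "e * (w\<^sup>2 * q) = w\<^sup>2 * (e * q)"
      by (simp_all add: power_mult_distrib power_numeral_reduce power2_eq_square mult_ac)
    then show ?thesis
      using qpoch_inf_dissect3[OF nw(2), of "e * (w\<^sup>2 * q)"] by (simp only: w4 mult_1_left)
  qed
  have 4: "qpoch_inf (e * q ^ 3) (q ^ 3) =
      qpoch_inf ((e * q) ^ 3) ((q ^ 3) ^ 3) * qpoch_inf ((e * q\<^sup>2) ^ 3) ((q ^ 3) ^ 3) * qpoch_inf (e * q ^ 9) (q ^ 9)"
  proof -
    have "(e * q) ^ 3 = e * q ^ 3"
      by (simp only: power_mult_distrib e)
    moreover have "q ^ 3 * (e * q ^ 3) = (e * q\<^sup>2) ^ 3"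
      unfolding power_mult_distrib e by (simp add: power_numeral_reduce mult_ac)
    moreover have "(q ^ 3)\<^sup>2 * (e * q ^ 3) = e * q ^ 9" "(q ^ 3) ^ 3 = q ^ 9"
      by (simp_all add: power_numeral_reduce mult_ac)
    ultimately show ?thesis
      using qpoch_inf_dissect3[OF q3, of "e * q ^ 3"] by (simp only:)
  qed
  have 5: "qpoch_inf (e * q) (q ^ 3) * qpoch_inf (w * (e * q)) (q ^ 3) * qpoch_inf (w\<^sup>2 * (e * q)) (q ^ 3) =
      qpoch_inf ((e * q) ^ 3) ((q ^ 3) ^ 3)"
    "qpoch_inf (e * q\<^sup>2) (q ^ 3) * qpoch_inf (w * (e * q\<^sup>2)) (q ^ 3) * qpoch_inf (w\<^sup>2 * (e * q\<^sup>2)) (q ^ 3) =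
      qpoch_inf ((e * q\<^sup>2) ^ 3) ((q ^ 3) ^ 3)"
    by (rule qpoch_inf_cube[OF q3 w(1)])+
  define P where "P = qpoch_inf (e * q ^ 3) (q ^ 3)"
  have "qpoch_inf (e * q) q * qpoch_inf (e * (w * q)) (w * q) * qpoch_inf (e * (w\<^sup>2 * q)) (w\<^sup>2 * q)
      * qpoch_inf (e * q ^ 9) (q ^ 9) =
      P ^ 3 * ((qpoch_inf (e * q) (q ^ 3) * qpoch_inf (w * (e * q)) (q ^ 3) * qpoch_inf (w\<^sup>2 * (e * q)) (q ^ 3))
      * (qpoch_inf (e * q\<^sup>2) (q ^ 3) * qpoch_inf (w * (e * q\<^sup>2)) (q ^ 3) * qpoch_inf (w\<^sup>2 * (e * q\<^sup>2)) (q ^ 3))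
      * qpoch_inf (e * q ^ 9) (q ^ 9))"
    unfolding 1 2 3 P_def[symmetric] by (simp only: power3_eq_cube mult_ac)
  also have "\<dots> = P ^ 3 * P"
    unfolding 5 using 4 by (simp only: P_def)
  finally show ?thesis
    by (simp add: P_def power_numeral_reduce)
qed

lemma gauss_theta_rotate_product:
  fixes q w :: complex
  assumes "norm q < 1" "1 + w + w\<^sup>2 = 0" "w ^ 3 = 1" "norm w = 1"
  shows "gauss_theta q * gauss_theta (w * q) * gauss_theta (w\<^sup>2 * q) * gauss_theta (q ^ 9) = gauss_theta (q ^ 3) ^ 4"
  using qpoch_inf_rotate_product[OF assms, of 1] qpoch_inf_rotate_product[OF assms, of "- 1"]
  by (simp add: gauss_theta_def power_divide)

theorem mainTheorem1:
  fixes q \<omega> :: complex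
  assumes "0 < norm q" and "norm q < 1"
    and "primitive_root_of_unity 3 \<omega>"
  shows "q\<^sup>2 * mock_phi (q ^ 9)
           - (mock_psi (\<omega> * q) - mock_psi (\<omega>\<^sup>2 * q)) / (\<omega> - \<omega>\<^sup>2)
         = - q * (J2 1 2 q / J2 3 6 q) * (J2 3 15 q * J1 6 q / J1 3 q)"
proof -
  interpret nome q
    using assms(1,2) by unfold_locales auto
  interpret q3: nome "q ^ 3"
    by (rule nome_power) simp
  interpret q6: nome "q ^ 6"
    by (rule nome_power) simp
  interpret q9: nome "q ^ 9"
    by (rule nome_power) simp
  have \<omega>3: "\<omega> ^ 3 = 1" and "\<omega> ^ 1 \<noteq> 1"
    using assms(3) unfolding primitive_root_of_unity_def by (blast, metis one_less_numeral_iff semiring_norm(77) zero_less_one)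
  have "(\<omega> - 1) * (1 + \<omega> + \<omega>\<^sup>2) = \<omega> ^ 3 - 1"
    by (simp add: algebra_simps power2_eq_square power3_eq_cube)
  then have \<omega>_sum: "1 + \<omega> + \<omega>\<^sup>2 = 0"
    using \<omega>3 \<open>\<omega> ^ 1 \<noteq> 1\<close> by auto
  have norm_\<omega>: "norm \<omega> = 1"
    using power_eq_imp_eq_norm[of \<omega> 3 1] \<omega>3 by simp
  have w2: "(\<omega>\<^sup>2) ^ 3 = 1" "norm (\<omega>\<^sup>2) = 1"
    using norm_\<omega> arg_cong[OF \<omega>3, of "\<lambda>y. y\<^sup>2"]
    by (simp_all add: norm_power power_mult[symmetric])
  have \<omega>_diff: "\<omega> - \<omega>\<^sup>2 \<noteq> 0"
    using \<omega>3 \<open>\<omega> ^ 1 \<noteq> 1\<close> by (auto simp: power2_eq_square)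
  define a b where "a = theta_mult3" and "b = theta_nonmult3"
  define T0 M P E where "T0 = gauss_theta q" and "M = (a + \<omega> * b) * (a + \<omega>\<^sup>2 * b)"
    and "P = gauss_theta (q ^ 3)" and "E = qpoch_inf (- (q ^ 3)) (q ^ 3)"
  define U where "U = (\<Sum>\<^sub>\<infinity>(r, s). weight r * weight s * psi_term r s)"
  interpret r1: nome "\<omega> * q"
    by (rule nome_rotate[OF norm_\<omega>])
  interpret r2: nome "\<omega>\<^sup>2 * q"
    by (rule nome_rotate[OF w2(2)])
  have M_gauss: "M = gauss_theta (\<omega> * q) * gauss_theta (\<omega>\<^sup>2 * q)"
    by (simp add: M_def a_def b_def gauss_theta_rotate[OF \<omega>3 norm_\<omega>] gauss_theta_rotate[OF w2])
  \<comment> \<open>The polynomial attached to \<phi> in \<open>psi_combination\<close> is the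
    product of the two rotated thetas, so \<open>a * M\<close> is a common factor.\<close>
  have M_poly: "M = a\<^sup>2 - a * b + b\<^sup>2"
  proof -
    have "M = a\<^sup>2 + (1 + \<omega> + \<omega>\<^sup>2) * (a * b) - a * b + \<omega> ^ 3 * b\<^sup>2"
      by (simp add: M_def algebra_simps power2_eq_square power3_eq_cube)
    then show ?thesis
      by (simp add: \<omega>_sum \<omega>3)
  qed
  have nz: "a \<noteq> 0" "M \<noteq> 0" "T0 \<noteq> 0" "P \<noteq> 0" "E \<noteq> 0"
    using q9.gauss_theta_nonzero r1.gauss_theta_nonzero r2.gauss_theta_nonzero gauss_theta_nonzero
      q3.gauss_theta_nonzero q3.qpoch_inf_self_nonzero(2)
    by (simp_all add: a_def theta_mult3_eq M_gauss T0_def P_def E_def)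
  \<comment> \<open>Replaces the denominator \<open>a * M\<close> by \<open>P ^ 4 / T0\<close>, the
    source of the quotient of J_(1,2) by J_(3,6).\<close>
  have prod4: "T0 * M * a = P ^ 4"
    using gauss_theta_rotate_product[OF q_lt1 \<omega>_sum \<omega>3 norm_\<omega>]
    by (simp add: T0_def M_gauss a_def theta_mult3_eq P_def mult.assoc)
  have comb: "(\<omega> - \<omega>\<^sup>2) * U = a * M * (mock_psi (\<omega> * q) - mock_psi (\<omega>\<^sup>2 * q))
      - (\<omega> - \<omega>\<^sup>2) * M * (q\<^sup>2 * mock_phi (q ^ 9) * a)"
    using psi_combination[OF \<omega>3 norm_\<omega>]
    by (simp add: U_def a_def b_def M_poly[unfolded a_def b_def, symmetric]) (simp add: M_def a_def b_def mult.assoc)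
  have "q\<^sup>2 * mock_phi (q ^ 9) - (mock_psi (\<omega> * q) - mock_psi (\<omega>\<^sup>2 * q)) / (\<omega> - \<omega>\<^sup>2) = - U / (a * M)"
  proof -
    have "(q\<^sup>2 * mock_phi (q ^ 9) - D / d) * (a * M) = - U"
      if "d * U = a * M * D - d * M * (q\<^sup>2 * mock_phi (q ^ 9) * a)" "d \<noteq> 0" for d D
    proof -
      have "d * ((q\<^sup>2 * mock_phi (q ^ 9) - D / d) * (a * M)) = d * (- U)"
        using that by (simp add: algebra_simps)
      then show ?thesis
        by (simp only: mult_left_cancel[OF \<open>d \<noteq> 0\<close>])
    qed
    from this[OF comb \<omega>_diff] show ?thesis
      using nz by (intro eq_divide_imp) simp_all
  qed
  also have "\<dots> = - U * T0 / P ^ 4"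
    using nz unfolding prod4[symmetric] by (simp add: field_simps)
  \<comment> \<open>\<open>P * E\<close> is (q^3; q^3), so \<open>U\<close> contributes P^3 and a
    single P stays in the denominator, while E^3 / E^2 leaves one \<open>E\<close>.\<close>
  also have "U = q * (P * E) ^ 3 / E\<^sup>2 * jtheta (q ^ 3) (q ^ 15)"
    unfolding U_def psi_weighted_sum using nz by (simp add: P_def E_def gauss_theta_def)
  also have "- (q * (P * E) ^ 3 / E\<^sup>2 * jtheta (q ^ 3) (q ^ 15)) * T0 / P ^ 4 =
      - q * (T0 / P) * (jtheta (q ^ 3) (q ^ 15) * E)"
    using nz by (simp add: field_simps power_numeral_reduce)
  also have "E = qpoch_inf (q ^ 6) (q ^ 6) / qpoch_inf (q ^ 3) (q ^ 3)"
    using q3.qpoch_inf_even q3.qpoch_inf_self_nonzero(1) by (simp add: E_def field_simps flip: power_mult)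
  also have "qpoch_inf (q ^ 6) (q ^ 6) = J1 6 q"
    using jtheta_self_cube[OF q6.q_lt1 q6.q_nz] by (simp add: J1_def J2_def flip: power_mult)
  also have "qpoch_inf (q ^ 3) (q ^ 3) = J1 3 q"
    using jtheta_self_cube[OF q3.q_lt1 q3.q_nz] by (simp add: J1_def J2_def flip: power_mult)
  also have "T0 = J2 1 2 q"
    by (simp add: T0_def J2_def jtheta_eq_gauss_theta)
  also have "P = J2 3 6 q"
    using q3.jtheta_eq_gauss_theta by (simp add: P_def J2_def flip: power_mult)
  also have "jtheta (q ^ 3) (q ^ 15) = J2 3 15 q"
    by (simp add: J2_def)
  finally show ?thesis
    by simp
qed

end
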